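(* Let $f=(f_1,\ldots,f_n)$ be an $n$-tuple of formal power series with the model property and let $(M_{Z_1},\ldots,M_{Z_n})$ be the universal model associated with $\mathbb B_f$ (the multiplication operators on $\mathbb H^2(f)$). For $j=1,2$, let $\mathcal K_j$ be a Hilbert space and let $\mathcal E_j\subset\mathbb H^2(f)\otimes\mathcal K_j$ be a co-invariant subspace under each operator $M_{Z_i}\otimes I_{\mathcal K_j}$, $i=1,\ldots,n$. If $X:\mathcal E_1\to\mathcal E_2$ is a bounded operator such that $$X[P_{\mathcal E_1}(M_{Z_i}\otimes I_{\mathcal K_1})|_{\mathcal E_1}]=[P_{\mathcal E_2}(M_{Z_i}\otimes I_{\mathcal K_2})|_{\mathcal E_2}]X,\qquad i=1,\ldots,n,$$ then there exists a bounded operator $Y:\mathbb H^2(f)\otimes\mathcal K_1\to\mathbb H^2(f)\otimes\mathcal K_2$ with the property $$Y(M_{Z_i}\otimes I_{\mathcal K_1})=(M_{Z_i}\otimes I_{\mathcal K_2})Y,\qquad i=1,\ldots,n,$$ and such that $Y^*\mathcal E_2\subseteq\mathcal E_1$, $Y^*|_{\mathcal E_2}=X^*$, and $\|Y\|=\|X\|$.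
   Context: Notation. $\mathbb F_n^+$ is the free semigroup on $g_1,\ldots,g_n$ with identity $g_0$ and length $|\cdot|$. For an $n$-tuple $X$ of elements of a unital algebra, $X_\alpha=X_{i_1}\cdots X_{i_k}$ if $\alpha=g_{i_1}\cdots g_{i_k}$, $X_{g_0}=I$. A tuple $X\in B(\mathcal H)^n$ is viewed as a row operator, so $\|X\|=\|\sum X_iX_i^*\|^{1/2}$; $[B(\mathcal H)^n]_\gamma=\{X:\|X\|<\gamma\}$. A free holomorphic function on $[B(\mathcal H)^n]_\gamma$ is a formal power series $\sum a_\alpha Z_\alpha$ in noncommuting indeterminates (complex coefficients) with radius of convergence $r$, $r^{-1}=\limsup_k(\sum_{|\alpha|=k}|a_\alpha|^2)^{1/2k}$, at least $\gamma$, identified with the map $X\mapsto\sum_k\sum_{|\alpha|=k}a_\alpha X_\alpha$ (norm convergence; $\mathcal H$ separable infinite-dimensional). $H^2_{\bf ball}$ is the Hilbert space of series with $\sum|a_\alpha|^2<\infty$ (the $Z_\alpha$ being orthonormal). Convergence sets. For an $n$-tuple $f$ of formal power series $f_j=\sum c^{(j)}_\alpha Z_\alpha$ and a Hilbert space $\mathcal H$: $\mathcal C_f^{SOT}(\mathcal H)$ is the set of $X\in B(\mathcal H)^n$ such that each series $f_j(X):=\sum_k\sum_{|\alpha|=k}c^{(j)}_\alpha X_\alpha$ is SOT-convergent; $\mathcal C_f^{rad}(\mathcal H)$ is the set of $X$ such that for some $\delta\in(0,1)$ these series converge in norm at $rX$ for all $r\in(\delta,1)$ and $f_j(X):=\text{SOT-}\lim_{r\to1}f_j(rX)$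 exists for each $j$. Model property. $f=(f_1,\ldots,f_n)$ has the model property if one of the following holds. (A) $f$ is an $n$-tuple of noncommutative polynomials for which there is an $n$-tuple $g$ of noncommutative polynomials with $f\circ g=g\circ f=\mathrm{id}$. Then $\{f_\alpha\}$ is a linear basis of $\mathbb C[Z_1,\ldots,Z_n]$ and $\mathbb H^2(f)$ is the completion of $\mathbb C[Z_1,\ldots,Z_n]$ for the inner product $\langle f_\alpha,f_\beta\rangle=\delta_{\alpha\beta}$. (S) $f$ is an $n$-tuple of formal power series with $f(0)=0$, nonzero radius of convergence and $\det J_f(0)\neq0$ ($J_f(0)_{ij}$ is the coefficient of $Z_j$ in $f_i$); $\mathbb H^2(f)$ is the Hilbert space of formal power series $\sum a_\alpha f_\alpha$, $\sum|a_\alpha|^2<\infty$, with $\{f_\alpha\}$ orthonormal; $Z_1,\ldots,Z_n\in\mathbb H^2(f)$; left multiplication $M_{Z_i}$ by $Z_i$ is bounded on $\mathbb H^2(f)$; and $M_Z=(M_{Z_1},\ldots,M_{Z_n})$ belongs to $\mathcal C_f^{SOT}(\mathbb H^2(f))$ or $\mathcal C_f^{rad}(\mathbb H^2(f))$ with $f_j(M_Z)=M_{f_j}$ (left multiplication by $f_j$), $j=1,\ldots,n$. (F) $f$ is an $n$-tuple of free holomorphic functions on some $[B(\mathcal H)^n]_\gamma$, $\gamma>0$, with range in $[B(\mathcal H)^n]_1$, such that $G\circ f\not\equiv0$ for every nonzero free holomorphic $G$ on $[B(\mathcal H)^n]_1$; $\mathbb H^2(f)=\{G\circ f:G\in H^2_{\bf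 ball}\}$ with $\langle F\circ f,G\circ f\rangle=\langle F,G\rangle$; the coordinate functions $Z_1,\ldots,Z_n$ lie in $\mathbb H^2(f)$, left multiplications $M_{Z_i}$ by them are bounded on $\mathbb H^2(f)$, and $M_Z$ is in $\mathcal C_f^{SOT}(\mathbb H^2(f))$ or $\mathcal C_f^{rad}(\mathbb H^2(f))$ with $f_j(M_Z)=M_{f_j}$ for all $j$. In all cases $\{f_\alpha\}_{\alpha\in\mathbb F_n^+}$ is an orthonormal basis of $\mathbb H^2(f)$; writing $Z_i=\sum_\alpha a^{(i)}_\alpha f_\alpha$ in $\mathbb H^2(f)$, one has $M_{Z_i}f_\beta=\sum_\alpha a^{(i)}_\alpha f_{\alpha\beta}$. $M_Z$ is called the universal model. A subspace (assumed closed) is co-invariant under an operator if it is invariant under its adjoint; $P_{\mathcal E}$ is the orthogonal projection onto $\mathcal E$. *)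

theory Defs
  imports "HOL-Analysis.Analysis"
begin

section \<open>Complex Hilbert spaces\<close>

text \<open>The distribution only has real inner product spaces. Here \<open>cinner\<close> is linear in its
  first argument; the metric structure comes from \<open>inner = Re \<circ> cinner\<close>.\<close>

class complex_inner = real_inner +
  fixes scaleC :: "complex \<Rightarrow> 'a \<Rightarrow> 'a" (infixr "*\<^sub>C" 75)
    and cinner :: "'a \<Rightarrow> 'a \<Rightarrow> complex"
  assumes scaleC_add_right: "c *\<^sub>C (x + y) = c *\<^sub>C x + c *\<^sub>C y"
    and scaleC_add_left: "(c + d) *\<^sub>C x = c *\<^sub>C x + d *\<^sub>C x"
    and scaleC_scaleC: "c *\<^sub>C d *\<^sub>C x = (c * d) *\<^sub>C x"
    and scaleR_scaleC: "r *\<^sub>R x = complex_of_real r *\<^sub>C x"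
    and cinner_add_left: "cinner (x + y) z = cinner x z + cinner y z"
    and cinner_scaleC_left: "cinner (c *\<^sub>C x) y = c * cinner x y"
    and cinner_commute: "cinner x y = cnj (cinner y x)"
    and inner_eq_Re_cinner: "inner x y = Re (cinner x y)"

class chilbert_space = complex_inner + complete_space

definition clinear :: "('a::complex_inner \<Rightarrow> 'b::complex_inner) \<Rightarrow> bool" where
  "clinear T \<longleftrightarrow> (\<forall>x y. T (x + y) = T x + T y) \<and> (\<forall>c x. T (c *\<^sub>C x) = c *\<^sub>C T x)"

definition bounded_clinear :: "('a::complex_inner \<Rightarrow> 'b::complex_inner) \<Rightarrow> bool" where
  "bounded_clinear T \<longleftrightarrow> clinear T \<and> bounded_linear T"

definition csubspace :: "'a::complex_inner set \<Rightarrow> bool" where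
  "csubspace E \<longleftrightarrow> 0 \<in> E \<and> (\<forall>x\<in>E. \<forall>y\<in>E. x + y \<in> E) \<and> (\<forall>c. \<forall>x\<in>E. c *\<^sub>C x \<in> E)"

definition cspan :: "'a::complex_inner set \<Rightarrow> 'a set" where
  "cspan S = \<Inter>{E. csubspace E \<and> S \<subseteq> E}"

text \<open>Bounded operators between subspaces \<open>E\<^sub>1\<close> and \<open>E\<^sub>2\<close> are functions on the ambient types of
  which only the values on \<open>E\<^sub>1\<close> matter.\<close>

definition bounded_op_on ::
  "'a::complex_inner set \<Rightarrow> 'b::complex_inner set \<Rightarrow> ('a \<Rightarrow> 'b) \<Rightarrow> bool" where
  "bounded_op_on E1 E2 X \<longleftrightarrow>
     X ` E1 \<subseteq> E2 \<and>
     (\<forall>x\<in>E1. \<forall>y\<in>E1. X (x + y) = X x + X y) \<and>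
     (\<forall>c. \<forall>x\<in>E1. X (c *\<^sub>C x) = c *\<^sub>C X x) \<and>
     (\<exists>B. \<forall>x\<in>E1. norm (X x) \<le> B * norm x)"

text \<open>\<open>onorm_on UNIV\<close> is the library's \<open>onorm\<close>.\<close>

definition onorm_on :: "'a::complex_inner set \<Rightarrow> ('a \<Rightarrow> 'b::complex_inner) \<Rightarrow> real" where
  "onorm_on E X = (SUP x\<in>E. norm (X x) / norm x)"

text \<open>The adjoint of an operator defined on the closed subspace \<open>E\<close>, with values in \<open>E\<close>.\<close>

definition adj_on :: "'a::complex_inner set \<Rightarrow> ('a \<Rightarrow> 'b::complex_inner) \<Rightarrow> 'b \<Rightarrow> 'a" where
  "adj_on E X y = (THE z. z \<in> E \<and> (\<forall>x\<in>E. cinner (X x) y = cinner x z))"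

abbreviation cadj :: "('a::complex_inner \<Rightarrow> 'b::complex_inner) \<Rightarrow> 'b \<Rightarrow> 'a" where
  "cadj \<equiv> adj_on UNIV"

definition proj :: "'a::complex_inner set \<Rightarrow> 'a \<Rightarrow> 'a" where
  "proj E x = (THE y. y \<in> E \<and> (\<forall>z\<in>E. cinner (x - y) z = 0))"

definition coinvariant :: "('a::complex_inner \<Rightarrow> 'a) \<Rightarrow> 'a set \<Rightarrow> bool" where
  "coinvariant T E \<longleftrightarrow> cadj T ` E \<subseteq> E"

text \<open>\<open>hilbert_tensor t\<close>: the type \<open>'t\<close> is the Hilbert space tensor product of \<open>'h\<close> and \<open>'k\<close>, with
  \<open>t x k\<close> as the elementary tensor of \<open>x\<close> and \<open>k\<close>. This determines \<open>'t\<close> up to a unique unitary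
  preserving elementary tensors.\<close>

definition hilbert_tensor ::
  "('h::chilbert_space \<Rightarrow> 'k::chilbert_space \<Rightarrow> 't::chilbert_space) \<Rightarrow> bool" where
  "hilbert_tensor t \<longleftrightarrow>
     (\<forall>x. clinear (t x)) \<and> (\<forall>k. clinear (\<lambda>x. t x k)) \<and>
     (\<forall>x k y l. cinner (t x k) (t y l) = cinner x y * cinner k l) \<and>
     closure (cspan {t x k | x k. True}) = UNIV"

definition tensor_id ::
  "('h::chilbert_space \<Rightarrow> 'k::chilbert_space \<Rightarrow> 't::chilbert_space) \<Rightarrow> ('h \<Rightarrow> 'h) \<Rightarrow> 't \<Rightarrow> 't" where
  "tensor_id t A = (THE T. bounded_clinear T \<and> (\<forall>x k. T (t x k) = t (A x) k))"

subsection \<open>Square summable families\<close>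

typedef 'i ell2 = "{x :: 'i \<Rightarrow> complex. (\<lambda>i. (cmod (x i))\<^sup>2) summable_on UNIV}"
  morphisms coords Abs_ell2
  by (rule exI[of _ "\<lambda>_. 0"]) auto

setup_lifting type_definition_ell2

lemma coords_summable: "(\<lambda>i. (cmod (coords x i))\<^sup>2) summable_on UNIV"
  using coords[of x] by simp

lemma ell2_prod_abs_summable:
  fixes x y :: "'i \<Rightarrow> complex"
  assumes "(\<lambda>i. (cmod (x i))\<^sup>2) summable_on UNIV" "(\<lambda>i. (cmod (y i))\<^sup>2) summable_on UNIV"
  shows "(\<lambda>i. norm (x i * cnj (y i))) summable_on UNIV"
  by (rule abs_summable_product)
    (use assms in \<open>simp_all add: norm_mult power2_eq_square\<close>)

lemma ell2_prod_summable: "(\<lambda>i. coords x i * cnj (coords y i)) summable_on UNIV"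
  by (rule abs_summable_summable[OF ell2_prod_abs_summable[OF coords_summable coords_summable]])

instantiation ell2 :: (type) complex_inner
begin

lift_definition zero_ell2 :: "'a ell2" is "\<lambda>_. 0" by simp

lift_definition scaleC_ell2 :: "complex \<Rightarrow> 'a ell2 \<Rightarrow> 'a ell2" is "\<lambda>c x i. c * x i"
  by (simp add: norm_mult power_mult_distrib summable_on_cmult_right)

lift_definition scaleR_ell2 :: "real \<Rightarrow> 'a ell2 \<Rightarrow> 'a ell2" is "\<lambda>c x i. of_real c * x i"
  by (simp add: norm_mult power_mult_distrib summable_on_cmult_right)

lift_definition uminus_ell2 :: "'a ell2 \<Rightarrow> 'a ell2" is "\<lambda>x i. - x i" by simp

lift_definition plus_ell2 :: "'a ell2 \<Rightarrow> 'a ell2 \<Rightarrow> 'a ell2" is "\<lambda>x y i. x i + y i"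
proof -
  fix x y :: "'a \<Rightarrow> complex"
  assume x: "(\<lambda>i. (cmod (x i))\<^sup>2) summable_on UNIV" and y: "(\<lambda>i. (cmod (y i))\<^sup>2) summable_on UNIV"
  have "(\<lambda>i. 2 * (cmod (x i))\<^sup>2 + 2 * (cmod (y i))\<^sup>2) summable_on UNIV"
    by (intro summable_on_add summable_on_cmult_right x y)
  then show "(\<lambda>i. (cmod (x i + y i))\<^sup>2) summable_on UNIV"
  proof (rule summable_on_comparison_test)
    fix i
    have "(cmod (x i + y i))\<^sup>2 \<le> (cmod (x i) + cmod (y i))\<^sup>2"
      by (simp add: norm_triangle_ineq power_mono)
    also have "\<dots> \<le> 2 * (cmod (x i))\<^sup>2 + 2 * (cmod (y i))\<^sup>2"
      using sum_squares_bound[of "cmod (x i)" "cmod (y i)"] by (simp add: power2_sum)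
    finally show "(cmod (x i + y i))\<^sup>2 \<le> 2 * (cmod (x i))\<^sup>2 + 2 * (cmod (y i))\<^sup>2" .
  qed auto
qed

definition minus_ell2 :: "'a ell2 \<Rightarrow> 'a ell2 \<Rightarrow> 'a ell2" where
  "minus_ell2 x y = x + - y"

definition cinner_ell2 :: "'a ell2 \<Rightarrow> 'a ell2 \<Rightarrow> complex" where
  "cinner_ell2 x y = (\<Sum>\<^sub>\<infinity>i. coords x i * cnj (coords y i))"

definition inner_ell2 :: "'a ell2 \<Rightarrow> 'a ell2 \<Rightarrow> real" where
  "inner_ell2 x y = Re (cinner x y)"

definition norm_ell2 :: "'a ell2 \<Rightarrow> real" where
  "norm_ell2 x = sqrt (inner x x)"

definition sgn_ell2 :: "'a ell2 \<Rightarrow> 'a ell2" where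
  "sgn_ell2 x = inverse (norm x) *\<^sub>R x"

definition dist_ell2 :: "'a ell2 \<Rightarrow> 'a ell2 \<Rightarrow> real" where
  "dist_ell2 x y = norm (x - y)"

definition uniformity_ell2 :: "('a ell2 \<times> 'a ell2) filter" where
  "uniformity_ell2 = (INF e\<in>{0 <..}. principal {(x, y). dist x y < e})"

definition open_ell2 :: "'a ell2 set \<Rightarrow> bool" where
  "open_ell2 U = (\<forall>x\<in>U. eventually (\<lambda>(x', y). x' = x \<longrightarrow> y \<in> U) uniformity)"

instance
proof
  fix x y z :: "'a ell2" and a b :: real and c d :: complex
  note [simp] = plus_ell2.rep_eq scaleC_ell2.rep_eq scaleR_ell2.rep_eq uminus_ell2.rep_eq
    zero_ell2.rep_eq
  have eqI: "u = v" if "\<And>i. coords u i = coords v i" for u v :: "'a ell2"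
    using that coords_inject by blast
  show "x + y + z = x + (y + z)" "x + y = y + x" "0 + x = x" "- x + x = 0" "x - y = x + - y"
    "a *\<^sub>R (x + y) = a *\<^sub>R x + a *\<^sub>R y" "(a + b) *\<^sub>R x = a *\<^sub>R x + b *\<^sub>R x"
    "a *\<^sub>R b *\<^sub>R x = (a * b) *\<^sub>R x" "1 *\<^sub>R x = x"
    "c *\<^sub>C (x + y) = c *\<^sub>C x + c *\<^sub>C y" "(c + d) *\<^sub>C x = c *\<^sub>C x + d *\<^sub>C x"
    "c *\<^sub>C d *\<^sub>C x = (c * d) *\<^sub>C x" "a *\<^sub>R x = complex_of_real a *\<^sub>C x"
    by (auto intro!: eqI simp: minus_ell2_def algebra_simps)
  show "dist x y = norm (x - y)" by (fact dist_ell2_def)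
  show "sgn x = inverse (norm x) *\<^sub>R x" by (fact sgn_ell2_def)
  show "uniformity = (INF e\<in>{0 <..}. principal {(x :: 'a ell2, y). dist x y < e})"
    by (fact uniformity_ell2_def)
  show "open U = (\<forall>x\<in>U. eventually (\<lambda>(x', y). x' = x \<longrightarrow> y \<in> U) uniformity)" for U :: "'a ell2 set"
    by (fact open_ell2_def)
  show "norm x = sqrt (inner x x)" by (fact norm_ell2_def)
  show Re: "inner x y = Re (cinner x y)" for x y :: "'a ell2" by (fact inner_ell2_def)
  show add: "cinner (x + y) z = cinner x z + cinner y z" for x y z :: "'a ell2"
    unfolding cinner_ell2_def
    by (subst infsum_add[symmetric]) (simp_all add: ell2_prod_summable distrib_right)
  show scale: "cinner (c *\<^sub>C x) y = c * cinner x y" for c and x y :: "'a ell2"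
    unfolding cinner_ell2_def
    by (subst infsum_cmult_right'[symmetric]) (simp add: mult.assoc)
  show comm: "cinner x y = cnj (cinner y x)" for x y :: "'a ell2"
    unfolding cinner_ell2_def
    by (subst infsum_cnj[symmetric]) (simp add: mult.commute)
  have scR: "a *\<^sub>R x = complex_of_real a *\<^sub>C x" for a and x :: "'a ell2"
    by (auto intro!: eqI)
  show "inner x y = inner y x" by (simp only: Re, subst comm) simp
  show "inner (x + y) z = inner x z + inner y z" by (simp add: Re add)
  show "inner (a *\<^sub>R x) y = a * inner x y" by (simp add: Re scR scale)
  have sq: "inner x x = (\<Sum>\<^sub>\<infinity>i. (cmod (coords x i))\<^sup>2)"
  proof -
    have "cinner x x = (\<Sum>\<^sub>\<infinity>i. complex_of_real ((cmod (coords x i))\<^sup>2))"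
      unfolding cinner_ell2_def by (simp only: complex_norm_square)
    also have "\<dots> = complex_of_real (\<Sum>\<^sub>\<infinity>i. (cmod (coords x i))\<^sup>2)"
      by (intro infsumI has_sum_of_real has_sum_infsum coords_summable)
    finally show ?thesis by (simp add: Re)
  qed
  show "0 \<le> inner x x" unfolding sq by (rule infsum_nonneg) simp
  show "inner x x = 0 \<longleftrightarrow> x = 0"
  proof
    assume "inner x x = 0"
    then have "(cmod (coords x i))\<^sup>2 = 0" for i
      by (intro nonneg_infsum_le_0D[OF _ coords_summable]) (auto simp: sq)
    then show "x = 0" by (auto intro!: eqI)
  next
    assume "x = 0"
    then have "coords x i = 0" for i by simp
    then show "inner x x = 0" unfolding sq by simp
  qed
qed

end

lemma ell2_norm_sq: "(norm x)\<^sup>2 = (\<Sum>\<^sub>\<infinity>i. (cmod (coords x i))\<^sup>2)" for x :: "'i ell2"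
proof -
  have "cinner x x = (\<Sum>\<^sub>\<infinity>i. complex_of_real ((cmod (coords x i))\<^sup>2))"
    unfolding cinner_ell2_def by (simp only: complex_norm_square)
  also have "\<dots> = complex_of_real (\<Sum>\<^sub>\<infinity>i. (cmod (coords x i))\<^sup>2)"
    by (intro infsumI has_sum_of_real has_sum_infsum coords_summable)
  finally have "inner x x = (\<Sum>\<^sub>\<infinity>i. (cmod (coords x i))\<^sup>2)" by (simp add: inner_eq_Re_cinner)
  then show ?thesis by (simp add: power2_norm_eq_inner)
qed

lemma coords_diff: "coords (x - y) i = coords x i - coords y i"
  unfolding minus_ell2_def plus_ell2.rep_eq uminus_ell2.rep_eq by simp

lemma ell2_sum_le_norm:
  assumes "finite F"
  shows "(\<Sum>i\<in>F. (cmod (coords x i))\<^sup>2) \<le> (norm x)\<^sup>2"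
  unfolding ell2_norm_sq by (rule finite_sum_le_infsum[OF coords_summable assms]) auto

lemma ell2_coord_le_norm: "cmod (coords x i) \<le> norm x"
  using ell2_sum_le_norm[of "{i}" x] by (simp add: power2_le_iff_abs_le)

instance ell2 :: (type) chilbert_space
proof
  fix u :: "nat \<Rightarrow> 'a ell2"
  assume u: "Cauchy u"
  have "Cauchy (\<lambda>n. coords (u n) i)" for i
  proof (rule metric_CauchyI)
    fix e :: real assume "e > 0"
    then obtain N where N: "\<And>m n. m \<ge> N \<Longrightarrow> n \<ge> N \<Longrightarrow> dist (u m) (u n) < e"
      using u by (meson metric_CauchyD)
    have "dist (coords (u m) i) (coords (u n) i) < e" if "m \<ge> N" "n \<ge> N" for m n
      using ell2_coord_le_norm[of "u m - u n" i] N[OF that] by (simp add: coords_diff dist_norm)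
    then show "\<exists>N. \<forall>m\<ge>N. \<forall>n\<ge>N. dist (coords (u m) i) (coords (u n) i) < e" by blast
  qed
  then have "\<forall>i. \<exists>l. (\<lambda>n. coords (u n) i) \<longlonglongrightarrow> l"
    by (simp add: Cauchy_convergent_iff convergent_def)
  then obtain l where l: "\<And>i. (\<lambda>n. coords (u n) i) \<longlonglongrightarrow> l i" by metis
  have close: "\<exists>N. \<forall>n\<ge>N. \<forall>F. finite F \<longrightarrow> (\<Sum>i\<in>F. (cmod (coords (u n) i - l i))\<^sup>2) \<le> e\<^sup>2"
    if e: "e > 0" for e :: real
  proof -
    obtain N where N: "\<And>m n. m \<ge> N \<Longrightarrow> n \<ge> N \<Longrightarrow> dist (u m) (u n) < e"
      using u e by (meson metric_CauchyD)
    have "(\<Sum>i\<in>F. (cmod (coords (u n) i - l i))\<^sup>2) \<le> e\<^sup>2" if n: "n \<ge> N" and F: "finite F" for n F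
    proof (rule LIMSEQ_le_const2)
      show "(\<lambda>m. \<Sum>i\<in>F. (cmod (coords (u n) i - coords (u m) i))\<^sup>2)
          \<longlonglongrightarrow> (\<Sum>i\<in>F. (cmod (coords (u n) i - l i))\<^sup>2)"
        by (intro tendsto_intros l)
      have "(\<Sum>i\<in>F. (cmod (coords (u n) i - coords (u m) i))\<^sup>2) \<le> e\<^sup>2" if "m \<ge> N" for m
      proof -
        have "(\<Sum>i\<in>F. (cmod (coords (u n) i - coords (u m) i))\<^sup>2) \<le> (norm (u n - u m))\<^sup>2"
          using ell2_sum_le_norm[OF F, of "u n - u m"] by (simp add: coords_diff)
        also have "\<dots> \<le> e\<^sup>2"
          using N[OF n that] by (intro power_mono) (auto simp: dist_norm)
        finally show ?thesis .
      qed
      then show "\<exists>N. \<forall>m\<ge>N. (\<Sum>i\<in>F. (cmod (coords (u n) i - coords (u m) i))\<^sup>2) \<le> e\<^sup>2" by blast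
    qed
    then show ?thesis by blast
  qed
  obtain N where N: "\<And>F. finite F \<Longrightarrow> (\<Sum>i\<in>F. (cmod (coords (u N) i - l i))\<^sup>2) \<le> 1"
    using close[of 1] by auto
  have "(\<lambda>i. (cmod (coords (u N) i - l i))\<^sup>2) summable_on UNIV"
    by (rule nonneg_bdd_above_summable_on) (auto intro!: bdd_aboveI2[where M = 1] N)
  then obtain d where d: "coords d = (\<lambda>i. coords (u N) i - l i)"
    using Abs_ell2_inverse by (metis (mono_tags) mem_Collect_eq)
  define x where "x = u N - d"
  have x: "coords x i = l i" for i by (simp add: x_def coords_diff d)
  have "u \<longlonglongrightarrow> x"
  proof (rule metric_LIMSEQ_I)
    fix e :: real assume "e > 0"
    then obtain N where N: "\<And>n F. n \<ge> N \<Longrightarrow> finite F \<Longrightarrow> (\<Sum>i\<in>F. (cmod (coords (u n) i - l i))\<^sup>2) \<le> (e / 2)\<^sup>2"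
      using close[of "e / 2"] by (metis half_gt_zero_iff)
    have "dist (u n) x < e" if "n \<ge> N" for n
    proof -
      have "(norm (u n - x))\<^sup>2 \<le> (e / 2)\<^sup>2"
        unfolding ell2_norm_sq
        by (rule infsum_le_finite_sums[OF coords_summable]) (simp add: coords_diff x N[OF that])
      then have "norm (u n - x) \<le> e / 2"
        using \<open>e > 0\<close> by (simp add: power2_le_iff_abs_le)
      then show ?thesis using \<open>e > 0\<close> by (simp add: dist_norm)
    qed
    then show "\<exists>N. \<forall>n\<ge>N. dist (u n) x < e" by blast
  qed
  then show "convergent u" by (auto simp: convergent_def)
qed

section \<open>Noncommutative power series\<close>

text \<open>The free semigroup on \<open>CARD('n)\<close> generators is \<open>'n list\<close>; the empty word is its identity.
  A series is its family of coefficients.\<close>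

type_synonym 'n ncseries = "'n list \<Rightarrow> complex"

definition nc_one :: "'n ncseries" where
  "nc_one w = (if w = [] then 1 else 0)"

definition nc_var :: "'n \<Rightarrow> 'n ncseries" where
  "nc_var i w = (if w = [i] then 1 else 0)"

definition nc_mult :: "'n ncseries \<Rightarrow> 'n ncseries \<Rightarrow> 'n ncseries" where
  "nc_mult p q w = (\<Sum>k\<le>length w. p (take k w) * q (drop k w))"

definition nc_polys :: "'n ncseries set" where
  "nc_polys = {p. finite {w. p w \<noteq> 0}}"

fun nc_word :: "('n \<Rightarrow> 'n ncseries) \<Rightarrow> 'n list \<Rightarrow> 'n ncseries" where
  "nc_word f [] = nc_one"
| "nc_word f (i # \<alpha>) = nc_mult (f i) (nc_word f \<alpha>)"

text \<open>The series \<open>\<Sum>\<^sub>\<alpha> a\<^sub>\<alpha> f\<^sub>\<alpha>\<close>, summed coefficientwise. It is used when \<open>a\<close> is a polynomial or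
  \<open>f(0) = 0\<close>; then for each \<open>w\<close> only finitely many terms are nonzero.\<close>

definition nc_subst :: "'n ncseries \<Rightarrow> ('n \<Rightarrow> 'n ncseries) \<Rightarrow> 'n ncseries" where
  "nc_subst a f w = (\<Sum>\<^sub>\<infinity>\<alpha>. a \<alpha> * nc_word f \<alpha> w)"

text \<open>\<open>1 / limsup\<^sub>k (\<Sum>\<^bsub>|\<alpha>| = k\<^esub> |a\<^sub>\<alpha>|\<^sup>2)\<^bsup>1/2k\<^esup>\<close>\<close>

definition nc_radius :: "'n::finite ncseries \<Rightarrow> ereal" where
  "nc_radius a = conv_radius (\<lambda>k. sqrt (\<Sum>\<alpha> | length \<alpha> = k. (cmod (a \<alpha>))\<^sup>2))"

subsection \<open>Evaluation on operators\<close>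

fun word_op :: "('n \<Rightarrow> 'h \<Rightarrow> 'h) \<Rightarrow> 'n list \<Rightarrow> 'h \<Rightarrow> 'h" where
  "word_op X [] = id"
| "word_op X (i # \<alpha>) = X i \<circ> word_op X \<alpha>"

definition nc_partial ::
  "'n::finite ncseries \<Rightarrow> ('n \<Rightarrow> 'h::chilbert_space \<Rightarrow> 'h) \<Rightarrow> nat \<Rightarrow> 'h \<Rightarrow> 'h" where
  "nc_partial a X N v = (\<Sum>k<N. \<Sum>\<alpha> | length \<alpha> = k. a \<alpha> *\<^sub>C word_op X \<alpha> v)"

text \<open>The pointwise limit; it is also the limit in norm whenever the latter exists.\<close>

definition nc_eval ::
  "'n::finite ncseries \<Rightarrow> ('n \<Rightarrow> 'h::chilbert_space \<Rightarrow> 'h) \<Rightarrow> 'h \<Rightarrow> 'h" where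
  "nc_eval a X v = lim (\<lambda>N. nc_partial a X N v)"

definition sot_convergent ::
  "'n::finite ncseries \<Rightarrow> ('n \<Rightarrow> 'h::chilbert_space \<Rightarrow> 'h) \<Rightarrow> bool" where
  "sot_convergent a X \<longleftrightarrow> bounded_clinear (nc_eval a X) \<and>
     (\<forall>v. (\<lambda>N. nc_partial a X N v) \<longlonglongrightarrow> nc_eval a X v)"

definition norm_convergent ::
  "'n::finite ncseries \<Rightarrow> ('n \<Rightarrow> 'h::chilbert_space \<Rightarrow> 'h) \<Rightarrow> bool" where
  "norm_convergent a X \<longleftrightarrow> bounded_clinear (nc_eval a X) \<and>
     (\<lambda>N. onorm (\<lambda>v. nc_partial a X N v - nc_eval a X v)) \<longlonglongrightarrow> 0"

definition dilate :: "real \<Rightarrow> ('n \<Rightarrow> 'h::chilbert_space \<Rightarrow> 'h) \<Rightarrow> 'n \<Rightarrow> 'h \<Rightarrow> 'h" where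
  "dilate r X i v = r *\<^sub>R X i v"

definition rad_eval ::
  "'n::finite ncseries \<Rightarrow> ('n \<Rightarrow> 'h::chilbert_space \<Rightarrow> 'h) \<Rightarrow> 'h \<Rightarrow> 'h" where
  "rad_eval a X v = Lim (at_left 1) (\<lambda>r. nc_eval a (dilate r X) v)"

definition C_SOT ::
  "('n::finite \<Rightarrow> 'n ncseries) \<Rightarrow> ('n \<Rightarrow> 'h::chilbert_space \<Rightarrow> 'h) set" where
  "C_SOT f = {X. (\<forall>i. bounded_clinear (X i)) \<and> (\<forall>j. sot_convergent (f j) X)}"

definition C_rad ::
  "('n::finite \<Rightarrow> 'n ncseries) \<Rightarrow> ('n \<Rightarrow> 'h::chilbert_space \<Rightarrow> 'h) set" where
  "C_rad f = {X. (\<forall>i. bounded_clinear (X i)) \<and>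
     (\<exists>\<delta>\<in>{0<..<1}. \<forall>r\<in>{\<delta><..<1}. \<forall>j. norm_convergent (f j) (dilate r X)) \<and>
     (\<forall>j. bounded_clinear (rad_eval (f j) X) \<and>
       (\<forall>v. ((\<lambda>r. nc_eval (f j) (dilate r X) v) \<longlongrightarrow> rad_eval (f j) X v) (at_left 1)))}"

text \<open>\<open>\<Theta> j T\<close> is meant to say that the operator \<open>T\<close> is left multiplication by \<open>f\<^sub>j\<close>.\<close>

definition functional_calculus ::
  "('n::finite \<Rightarrow> 'n ncseries) \<Rightarrow> ('n \<Rightarrow> 'h::chilbert_space \<Rightarrow> 'h) \<Rightarrow>
   ('n \<Rightarrow> ('h \<Rightarrow> 'h) \<Rightarrow> bool) \<Rightarrow> bool" where
  "functional_calculus f X \<Theta> \<longleftrightarrow>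
     (X \<in> C_SOT f \<and> (\<forall>j. \<Theta> j (nc_eval (f j) X))) \<or>
     (X \<in> C_rad f \<and> (\<forall>j. \<Theta> j (rad_eval (f j) X)))"

subsection \<open>Free holomorphic functions\<close>

text \<open>The separable infinite-dimensional Hilbert space on which free holomorphic functions are
  represented is \<open>nat ell2\<close>.\<close>

type_synonym 'n op_tuple = "'n \<Rightarrow> nat ell2 \<Rightarrow> nat ell2"

definition op_ball :: "real \<Rightarrow> 'n::finite op_tuple set" where
  "op_ball \<gamma> = {X. (\<forall>i. bounded_clinear (X i)) \<and>
     sqrt (onorm (\<lambda>v. \<Sum>i\<in>UNIV. X i (cadj (X i) v))) < \<gamma>}"

definition free_holomorphic :: "real \<Rightarrow> 'n::finite ncseries \<Rightarrow> bool" where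
  "free_holomorphic \<gamma> a \<longleftrightarrow> ereal \<gamma> \<le> nc_radius a"

definition eval_tuple :: "('n::finite \<Rightarrow> 'n ncseries) \<Rightarrow> 'n op_tuple \<Rightarrow> 'n op_tuple" where
  "eval_tuple f X j = nc_eval (f j) X"

text \<open>Functions on the ball of radius \<open>\<gamma>\<close> are extended by zero.\<close>

definition on_ball ::
  "real \<Rightarrow> ('n::finite op_tuple \<Rightarrow> nat ell2 \<Rightarrow> nat ell2) \<Rightarrow> 'n op_tuple \<Rightarrow> nat ell2 \<Rightarrow> nat ell2" where
  "on_ball \<gamma> \<Phi> X = (if X \<in> op_ball \<gamma> then \<Phi> X else (\<lambda>_. 0))"

section \<open>The model property\<close>

text \<open>Via \<open>\<iota>\<close>, the Hilbert space \<open>'h\<close> is the set of all \<open>\<Phi> a\<close>, \<open>a\<close> square summable, with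
  \<open>\<langle>\<Phi> a, \<Phi> b\<rangle> = \<Sum>\<^sub>\<alpha> a\<^sub>\<alpha> b\<^sub>\<alpha>\<^sup>*\<close>. When \<open>\<Phi>\<close> is linear, so is \<open>\<iota>\<close>.\<close>

definition is_hilbert_space_of ::
  "('h::chilbert_space \<Rightarrow> 'v) \<Rightarrow> ('n list ell2 \<Rightarrow> 'v) \<Rightarrow> bool" where
  "is_hilbert_space_of \<iota> \<Phi> \<longleftrightarrow> inj \<iota> \<and> range \<iota> = range \<Phi> \<and>
     (\<forall>x y a b. \<iota> x = \<Phi> a \<longrightarrow> \<iota> y = \<Phi> b \<longrightarrow> cinner x y = cinner a b)"

text \<open>In each of the three cases the type \<open>'h\<close> carries the Hilbert space \<open>\<bbbH>\<^sup>2(f)\<close> and \<open>M\<close> is the tuple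
  of left multiplications by the indeterminates. In the polynomial case \<open>\<iota>\<close> is the embedding of
  the polynomials into the completion.\<close>

definition model_poly ::
  "('n::finite \<Rightarrow> 'n ncseries) \<Rightarrow> ('n \<Rightarrow> 'h::chilbert_space \<Rightarrow> 'h) \<Rightarrow> bool" where
  "model_poly f M \<longleftrightarrow>
     (\<forall>i. f i \<in> nc_polys) \<and>
     (\<exists>g. (\<forall>i. g i \<in> nc_polys) \<and>
          (\<forall>i. nc_subst (f i) g = nc_var i) \<and> (\<forall>i. nc_subst (g i) f = nc_var i)) \<and>
     (\<exists>\<iota>. (\<forall>p\<in>nc_polys. \<forall>q\<in>nc_polys. \<iota> (\<lambda>w. p w + q w) = \<iota> p + \<iota> q) \<and>
          (\<forall>c. \<forall>p\<in>nc_polys. \<iota> (\<lambda>w. c * p w) = c *\<^sub>C \<iota> p) \<and>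
          (\<forall>\<alpha> \<beta>. cinner (\<iota> (nc_word f \<alpha>)) (\<iota> (nc_word f \<beta>)) = (if \<alpha> = \<beta> then 1 else 0)) \<and>
          closure (\<iota> ` nc_polys) = UNIV \<and>
          (\<forall>i. bounded_clinear (M i) \<and> (\<forall>p\<in>nc_polys. M i (\<iota> p) = \<iota> (nc_mult (nc_var i) p))))"

definition model_series ::
  "('n::finite \<Rightarrow> 'n ncseries) \<Rightarrow> ('n \<Rightarrow> 'h::chilbert_space \<Rightarrow> 'h) \<Rightarrow> bool" where
  "model_series f M \<longleftrightarrow>
     (\<forall>i. f i [] = 0) \<and> (\<forall>i. nc_radius (f i) > 0) \<and>
     det (\<chi> i j. f i [j] :: complex^'n^'n) \<noteq> 0 \<and>
     (\<exists>\<iota>. is_hilbert_space_of \<iota> (\<lambda>a. nc_subst (coords a) f) \<and>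
          (\<forall>i. nc_var i \<in> range \<iota>) \<and>
          (\<forall>i. bounded_clinear (M i) \<and> (\<forall>x. \<iota> (M i x) = nc_mult (nc_var i) (\<iota> x))) \<and>
          functional_calculus f M (\<lambda>j T. \<forall>x. \<iota> (T x) = nc_mult (f j) (\<iota> x)))"

definition model_free_hol ::
  "('n::finite \<Rightarrow> 'n ncseries) \<Rightarrow> ('n \<Rightarrow> 'h::chilbert_space \<Rightarrow> 'h) \<Rightarrow> bool" where
  "model_free_hol f M \<longleftrightarrow>
     (\<exists>\<gamma>>0.
        (\<forall>i. free_holomorphic \<gamma> (f i)) \<and>
        (\<forall>X\<in>op_ball \<gamma>. eval_tuple f X \<in> op_ball 1) \<and>
        (\<forall>G. free_holomorphic 1 G \<and> G \<noteq> (\<lambda>_. 0) \<longrightarrow>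
             (\<exists>X\<in>op_ball \<gamma>. nc_eval G (eval_tuple f X) \<noteq> (\<lambda>_. 0))) \<and>
        (\<exists>\<iota>. is_hilbert_space_of \<iota> (\<lambda>a. on_ball \<gamma> (\<lambda>X. nc_eval (coords a) (eval_tuple f X))) \<and>
             (\<forall>i. on_ball \<gamma> (\<lambda>X. X i) \<in> range \<iota>) \<and>
             (\<forall>i. bounded_clinear (M i) \<and>
                  (\<forall>x. \<iota> (M i x) = on_ball \<gamma> (\<lambda>X. X i \<circ> \<iota> x X))) \<and>
             functional_calculus f M
               (\<lambda>j T. \<forall>x. \<iota> (T x) = on_ball \<gamma> (\<lambda>X. nc_eval (f j) X \<circ> \<iota> x X))))"

text \<open>\<open>f\<close> has the model property, \<open>'h\<close> is \<open>\<bbbH>\<^sup>2(f)\<close>, and \<open>M\<close> is the universal model.\<close>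

definition universal_model ::
  "('n::finite \<Rightarrow> 'n ncseries) \<Rightarrow> ('n \<Rightarrow> 'h::chilbert_space \<Rightarrow> 'h) \<Rightarrow> bool" where
  "universal_model f M \<longleftrightarrow> model_poly f M \<or> model_series f M \<or> model_free_hol f M"

end

theory Submission
  imports Defs
begin

text \<open>Only two features of the model matter: \<open>f\<^sub>\<alpha>\<close> is an orthonormal basis on which left
  multiplication by \<open>f\<^sub>j\<close> acts as a creation operator, and this multiplication is a strong limit of
  polynomials in \<open>M\<close>. By the latter, \<open>X\<close> also intertwines the compressions of the creation
  operators \<open>V\<^sub>j\<close>, \<open>W\<^sub>j\<close> on the two tensor products, which are pure row isometries.

  Commutant lifting is done on the adjoint side. Let \<open>Z = X\<^sup>*\<close>, defined on a subspace \<open>E\<close> invariant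
  under all \<open>W\<^sub>j\<^sup>*\<close>, and let \<open>\<rho> = \<parallel>X\<parallel>\<close>. On \<open>{x. \<forall>j. W\<^sub>j\<^sup>* x \<in> E}\<close> an extension of \<open>Z\<close> with
  \<open>V\<^sub>j\<^sup>* Z = Z W\<^sub>j\<^sup>*\<close> is determined up to its component in the defect space of \<open>V\<close>, and the bound
  \<open>\<rho>\<close> is kept iff that component is dominated by the positive semidefinite form
  \<open>\<rho>\<^sup>2 \<parallel>x\<parallel>\<^sup>2 - \<Sum>\<^sub>j \<parallel>Z W\<^sub>j\<^sup>* x\<parallel>\<^sup>2\<close>. An operator on a subspace dominated by such a form extends to the whole
  space with the same bound (project along the form), so no square roots or dilations are needed.
  Iterating exhausts a dense subspace because \<open>W\<close> is pure.

  Finally, the lift commutes with the model: against a vector of degree at most \<open>n\<close>,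
  multiplication by \<open>Z\<^sub>i = \<Sum> a\<^sub>\<alpha> f\<^sub>\<alpha>\<close> acts as the finite sum over \<open>|\<alpha>| \<le> n\<close>.\<close>

section \<open>Hilbert space preliminaries\<close>

text \<open>Passing to adjoints turns co-invariance into invariance: a lift of \<open>X\<close>
  amounts to an intertwining extension of \<open>X\<^sup>*\<close> from \<open>E2\<close> to the
  whole space, and the difficulty is to keep the norm while extending. Two obstacles shape the rest.
  \<open>X\<close> intertwines compressions of \<open>M\<close>, whereas the lifting needs a row
  isometry. Multiplication by \<open>f\<^sub>j\<close> is only a strong limit of polynomials in
  \<open>M\<close>, in the radial case a limit of limits, and such limits are carried through the
  tensor product with the identity by means of a uniform bound, which Banach-Steinhaus supplies.
  Conversely, commuting with the creation operators does not formally give commuting with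
  \<open>M\<close>, because the series of operators that represents multiplication by
  \<open>Z\<^sub>i\<close> may diverge. The way out is that the adjoint of the lift does not raise
  degrees, so both sides can be compared through the same finite sums. The three cases of the model
  property enter only through the interface \<open>fock_model\<close>.\<close>

lemma scaleC_zero_left [simp]: "0 *\<^sub>C x = (0 :: 'a::complex_inner)"
  using scaleC_add_left[of 0 0 x] by simp

lemma scaleC_zero_right [simp]: "c *\<^sub>C (0 :: 'a::complex_inner) = 0"
  using scaleC_add_right[of c 0 "0 :: 'a"] by simp

lemma scaleC_one [simp]: "1 *\<^sub>C x = (x :: 'a::complex_inner)"
  using scaleR_scaleC[of 1 x] by simp

lemma scaleC_minus1: "(- 1) *\<^sub>C x = - (x :: 'a::complex_inner)"
  using scaleR_scaleC[of "- 1" x] by simp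

lemma scaleC_minus_right: "c *\<^sub>C (- x) = - (c *\<^sub>C (x :: 'a::complex_inner))"
  using scaleC_add_right[of c x "- x"] by (simp add: eq_neg_iff_add_eq_0 add.commute)

lemma scaleC_diff_right: "c *\<^sub>C (x - y) = c *\<^sub>C x - c *\<^sub>C (y :: 'a::complex_inner)"
  using scaleC_add_right[of c x "- y"] by (simp add: scaleC_minus_right)

lemma scaleC_sum_right: "c *\<^sub>C (\<Sum>i\<in>I. g i) = (\<Sum>i\<in>I. c *\<^sub>C (g i :: 'a::complex_inner))"
  by (induction I rule: infinite_finite_induct) (auto simp: scaleC_add_right)

lemma cinner_scaleC_right: "cinner x (c *\<^sub>C y) = cnj c * cinner x (y :: 'a::complex_inner)"
  by (metis cinner_commute cinner_scaleC_left complex_cnj_mult)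

lemma cinner_add_right: "cinner x (y + z) = cinner x y + cinner x (z :: 'a::complex_inner)"
  by (metis cinner_commute cinner_add_left complex_cnj_add)

lemma cinner_self: "cinner x x = complex_of_real ((norm (x :: 'a::complex_inner))\<^sup>2)"
proof -
  have "cnj (cinner x x) = cinner x x" using cinner_commute[of x x] by simp
  then have "Im (cinner x x) = 0" by (simp add: complex_eq_iff)
  moreover have "Re (cinner x x) = (norm x)\<^sup>2"
    by (simp add: power2_norm_eq_inner inner_eq_Re_cinner)
  ultimately show ?thesis by (simp add: complex_eq_iff)
qed

lemma norm_scaleC [simp]: "norm (c *\<^sub>C x) = cmod c * norm (x :: 'a::complex_inner)"
proof -
  have "complex_of_real ((norm (c *\<^sub>C x))\<^sup>2) = complex_of_real ((cmod c * norm x)\<^sup>2)"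
  proof -
    have "cinner (c *\<^sub>C x) (c *\<^sub>C x) = (c * cnj c) * cinner x x"
      by (simp add: cinner_scaleC_left cinner_scaleC_right)
    then show ?thesis
      unfolding cinner_self complex_norm_square[symmetric]
      by (simp add: power_mult_distrib)
  qed
  then have "(norm (c *\<^sub>C x))\<^sup>2 = (cmod c * norm x)\<^sup>2" by (simp only: of_real_eq_iff)
  then show ?thesis by (simp add: power2_eq_iff_nonneg)
qed

lemma cinner_Cauchy_Schwarz: "cmod (cinner x y) \<le> norm x * norm (y :: 'a::complex_inner)"
proof (cases "cinner x y = 0")
  case False
  define w where "w = cinner x y"
  \<comment> \<open>A unimodular factor that rotates \<open>w\<close> onto the positive axis, so
    that the real Cauchy-Schwarz inequality applies.\<close>
  define u where "u = cnj w / of_real (cmod w)"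
  have w: "w \<noteq> 0" using False by (simp add: w_def)
  have "u * w = of_real (cmod w)"
  proof -
    have "cnj w * w = of_real (cmod w) * of_real (cmod w)"
      using complex_norm_square[of w] by (simp add: power2_eq_square mult.commute)
    then show ?thesis using w by (simp add: u_def)
  qed
  then have "cmod w = inner (u *\<^sub>C x) y"
    by (simp add: inner_eq_Re_cinner cinner_scaleC_left flip: w_def)
  also have "\<dots> \<le> norm (u *\<^sub>C x) * norm y" by (rule norm_cauchy_schwarz)
  also have "norm (u *\<^sub>C x) = norm x" using w by (simp add: u_def norm_divide)
  finally show ?thesis by (simp add: w_def)
next
  case True
  then show ?thesis by simp
qed

lemma bounded_bilinear_cinner: "bounded_bilinear (cinner :: 'a::complex_inner \<Rightarrow> 'a \<Rightarrow> complex)"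
proof
  fix x x' y y' :: 'a and r :: real
  show "cinner (x + x') y = cinner x y + cinner x' y" by (rule cinner_add_left)
  show "cinner x (y + y') = cinner x y + cinner x y'" by (rule cinner_add_right)
  show "cinner (r *\<^sub>R x) y = r *\<^sub>R cinner x y"
    by (simp add: scaleR_scaleC cinner_scaleC_left scaleR_conv_of_real)
  show "cinner x (r *\<^sub>R y) = r *\<^sub>R cinner x y"
    by (simp add: scaleR_scaleC cinner_scaleC_right scaleR_conv_of_real)
  show "\<exists>K. \<forall>x y. cmod (cinner x y) \<le> norm (x :: 'a) * norm y * K"
    using cinner_Cauchy_Schwarz by (intro exI[of _ 1]) auto
qed

interpretation cinner: bounded_bilinear "cinner :: 'a::complex_inner \<Rightarrow> 'a \<Rightarrow> complex"
  by (rule bounded_bilinear_cinner)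

lemma norm_plus_scaleC_sq:
  "(norm (x + c *\<^sub>C y))\<^sup>2 = (norm x)\<^sup>2 + 2 * Re (cnj c * cinner x y) + (cmod c)\<^sup>2 * (norm (y :: 'a::complex_inner))\<^sup>2"
proof -
  have "(norm (x + c *\<^sub>C y))\<^sup>2 = Re (cinner (x + c *\<^sub>C y) (x + c *\<^sub>C y))"
    by (simp only: cinner_self Re_complex_of_real)
  also have "cinner (x + c *\<^sub>C y) (x + c *\<^sub>C y) =
      cinner x x + cnj c * cinner x y + c * cinner y x + c * cnj c * cinner y y"
    by (simp add: cinner_add_left cinner_add_right cinner_scaleC_left cinner_scaleC_right
        distrib_left mult.assoc)
  also have "c * cinner y x = cnj (cnj c * cinner x y)"
    by (subst cinner_commute) simp
  also have "c * cnj c * cinner y y = of_real ((cmod c)\<^sup>2 * (norm y)\<^sup>2)"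
    unfolding cinner_self complex_norm_square[symmetric] by simp
  finally show ?thesis by (simp only: cinner_self plus_complex.sel Re_complex_of_real cnj.sel)
qed

lemma cinner_eqI: "(\<And>y. cinner x y = cinner x' y) \<Longrightarrow> x = (x' :: 'a::complex_inner)"
proof -
  assume "\<And>y. cinner x y = cinner x' y"
  then have "cinner (x - x') (x - x') = 0" by (simp add: cinner.diff_left)
  then show ?thesis by (simp add: cinner_self)
qed

subsection \<open>Complex linear maps and subspaces\<close>

lemma bounded_clinearI:
  assumes "\<And>x y. T (x + y) = T x + T y" "\<And>c x. T (c *\<^sub>C x) = c *\<^sub>C T x"
    and "\<And>x. norm (T x) \<le> B * norm x"
  shows "bounded_clinear T"
  unfolding bounded_clinear_def clinear_def
  using assms by (auto intro!: bounded_linear_intro[of T B] simp: scaleR_scaleC mult.commute)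

lemma bounded_clinear_add: "bounded_clinear T \<Longrightarrow> T (x + y) = T x + T y"
  and bounded_clinear_scaleC: "bounded_clinear T \<Longrightarrow> T (c *\<^sub>C x) = c *\<^sub>C T x"
  and bounded_clinear_bounded_linear: "bounded_clinear T \<Longrightarrow> bounded_linear T"
  by (simp_all add: bounded_clinear_def clinear_def)

lemma bounded_clinear_zero: "bounded_clinear T \<Longrightarrow> T 0 = 0"
  and bounded_clinear_diff: "bounded_clinear T \<Longrightarrow> T (x - y) = T x - T y"
  and bounded_clinear_sum: "bounded_clinear T \<Longrightarrow> T (\<Sum>i\<in>I. g i) = (\<Sum>i\<in>I. T (g i))"
  and bounded_clinear_tendsto:
    "bounded_clinear T \<Longrightarrow> (h \<longlongrightarrow> x) F \<Longrightarrow> ((\<lambda>n. T (h n)) \<longlongrightarrow> T x) F"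
  and bounded_clinear_onorm: "bounded_clinear T \<Longrightarrow> norm (T x) \<le> onorm T * norm x"
  by (auto dest!: bounded_clinear_bounded_linear intro: linear_0 linear_diff linear_sum
      bounded_linear.tendsto onorm simp: bounded_linear.linear)

lemma bounded_clinear_onorm_nonneg: "bounded_clinear T \<Longrightarrow> 0 \<le> onorm T"
  by (simp add: bounded_clinear_bounded_linear onorm_pos_le)

lemma bounded_clinear_id [intro]: "bounded_clinear (\<lambda>x. x)"
  by (rule bounded_clinearI[where B = 1]) auto

lemma bounded_clinear_comp:
  assumes "bounded_clinear S" "bounded_clinear T"
  shows "bounded_clinear (\<lambda>x. S (T x))"
  using assms bounded_linear_compose[of S T] by (simp add: bounded_clinear_def clinear_def)

lemma bounded_clinear_plus:
  assumes "bounded_clinear S" "bounded_clinear T"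
  shows "bounded_clinear (\<lambda>x. S x + T x)"
  using assms bounded_linear_add[of S T]
  by (simp add: bounded_clinear_def clinear_def scaleC_add_right)

lemma bounded_clinear_scaleC_fun:
  assumes "bounded_clinear T"
  shows "bounded_clinear (\<lambda>x. c *\<^sub>C T x)"
proof (rule bounded_clinearI)
  show "norm (c *\<^sub>C T x) \<le> (cmod c * onorm T) * norm x" for x
    using bounded_clinear_onorm[OF assms, of x] by (simp add: mult_left_mono mult.assoc)
qed (simp_all add: assms bounded_clinear_add bounded_clinear_scaleC scaleC_add_right scaleC_scaleC
    mult.commute)

lemma bounded_clinear_minus:
  assumes "bounded_clinear S" "bounded_clinear T"
  shows "bounded_clinear (\<lambda>x. S x - T x)"
  using bounded_clinear_plus[OF assms(1) bounded_clinear_scaleC_fun[OF assms(2), of "- 1"]]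
  by (simp add: scaleC_minus1)

lemma bounded_clinear_const_zero: "bounded_clinear (\<lambda>x. 0)"
  by (rule bounded_clinearI[where B = 0]) auto

lemma bounded_clinear_setsum:
  assumes "\<And>i. i \<in> I \<Longrightarrow> bounded_clinear (T i)"
  shows "bounded_clinear (\<lambda>x. \<Sum>i\<in>I. T i x)"
  using assms by (induction I rule: infinite_finite_induct)
    (auto intro: bounded_clinear_plus bounded_clinear_const_zero)

lemma csubspace_0: "csubspace E \<Longrightarrow> 0 \<in> E"
  and csubspace_add: "csubspace E \<Longrightarrow> x \<in> E \<Longrightarrow> y \<in> E \<Longrightarrow> x + y \<in> E"
  and csubspace_scaleC: "csubspace E \<Longrightarrow> x \<in> E \<Longrightarrow> c *\<^sub>C x \<in> E"
  by (auto simp: csubspace_def)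

lemma csubspace_diff: "csubspace E \<Longrightarrow> x \<in> E \<Longrightarrow> y \<in> E \<Longrightarrow> x - y \<in> E"
  using csubspace_add[of E x "(- 1) *\<^sub>C y"] csubspace_scaleC[of E y "- 1"]
  by (simp add: scaleC_minus1)

lemma csubspace_sum: "csubspace E \<Longrightarrow> (\<And>i. i \<in> I \<Longrightarrow> g i \<in> E) \<Longrightarrow> (\<Sum>i\<in>I. g i) \<in> E"
  by (induction I rule: infinite_finite_induct) (auto simp: csubspace_0 csubspace_add)

lemma csubspace_UNIV [simp]: "csubspace UNIV"
  by (simp add: csubspace_def)

lemma csubspace_cspan: "csubspace (cspan S)"
  unfolding cspan_def by (auto simp: csubspace_def)

lemma cspan_superset: "S \<subseteq> cspan S"
  unfolding cspan_def by auto

lemma cspan_minimal: "csubspace E \<Longrightarrow> S \<subseteq> E \<Longrightarrow> cspan S \<subseteq> E"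
  unfolding cspan_def by auto

section \<open>Orthogonal complements and total sets\<close>

definition ortho :: "'a::complex_inner set \<Rightarrow> 'a set" where
  "ortho S = {x. \<forall>s\<in>S. cinner x s = 0}"

lemma csubspace_ortho: "csubspace (ortho S)"
  by (auto simp: csubspace_def ortho_def cinner_add_left cinner_scaleC_left cinner.zero_left)

lemma closed_ortho: "closed (ortho S)"
proof -
  have "ortho S = (\<Inter>s\<in>S. {x. cinner x s = 0})" by (auto simp: ortho_def)
  moreover have "closed {x. cinner x s = 0}" for s :: 'a
    by (intro closed_Collect_eq continuous_intros cinner.continuous_on)
  ultimately show ?thesis by auto
qed

text \<open>In a Hilbert space this means that the span is dense. It is phrased by orthogonality
  because its typical use is to show that a vector, often a value of an adjoint, vanishes.\<close>

definition ctotal :: "'a::complex_inner set \<Rightarrow> bool" where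
  "ctotal S \<longleftrightarrow> ortho S = {0}"

lemma totalI: "(\<And>x. (\<And>s. s \<in> S \<Longrightarrow> cinner x s = 0) \<Longrightarrow> x = 0) \<Longrightarrow> ctotal S"
  by (auto simp: ctotal_def ortho_def cinner.zero_left)

lemma totalD: "ctotal S \<Longrightarrow> (\<And>s. s \<in> S \<Longrightarrow> cinner x s = 0) \<Longrightarrow> x = 0"
  by (auto simp: ctotal_def ortho_def)

lemma total_mono: "ctotal S \<Longrightarrow> S \<subseteq> S' \<Longrightarrow> ctotal S'"
  by (meson totalD totalI subsetD)

lemma cinner_zero_commute: "cinner x y = 0 \<longleftrightarrow> cinner y x = (0 :: complex)"
  by (subst cinner_commute) simp

text \<open>\<open>ortho {x}\<close> is a closed subspace containing \<open>S\<close>, hence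
  contains everything, \<open>x\<close> included.\<close>

lemma dense_imp_total:
  assumes "closure (cspan S) = UNIV"
  shows "ctotal S"
proof (rule totalI)
  fix x assume x: "\<And>s. s \<in> S \<Longrightarrow> cinner x s = 0"
  have "S \<subseteq> ortho {x}" using x by (auto simp: ortho_def cinner_zero_commute)
  then have "closure (cspan S) \<subseteq> ortho {x}"
    by (intro closure_minimal cspan_minimal csubspace_ortho closed_ortho)
  then have "x \<in> ortho {x}" using assms by auto
  then show "x = 0" by (simp add: ortho_def cinner_self)
qed

subsection \<open>Extending operators dominated by a positive semidefinite form\<close>

text \<open>The form may be degenerate: in the lifting step it has a null vector wherever the
  prescribed components already exhaust the norm bound.\<close>

locale semi_inner =
  fixes D :: "'a::complex_inner set" and Q :: "'a \<Rightarrow> 'a \<Rightarrow> complex"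
  assumes D: "csubspace D"
    and Q_add: "x \<in> D \<Longrightarrow> y \<in> D \<Longrightarrow> w \<in> D \<Longrightarrow> Q (x + y) w = Q x w + Q y w"
    and Q_scale: "x \<in> D \<Longrightarrow> w \<in> D \<Longrightarrow> Q (c *\<^sub>C x) w = c * Q x w"
    and Q_comm: "x \<in> D \<Longrightarrow> y \<in> D \<Longrightarrow> Q x y = cnj (Q y x)"
    and Q_nonneg: "x \<in> D \<Longrightarrow> 0 \<le> Re (Q x x)"
begin

definition q :: "'a \<Rightarrow> real" where "q x = Re (Q x x)"

lemma Q_add2: "x \<in> D \<Longrightarrow> y \<in> D \<Longrightarrow> w \<in> D \<Longrightarrow> Q w (x + y) = Q w x + Q w y"
  using Q_add[of x y w] Q_comm[of w "x + y"] Q_comm[of w x] Q_comm[of w y] csubspace_add[OF D]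
  by simp

lemma Q_scale2: "x \<in> D \<Longrightarrow> w \<in> D \<Longrightarrow> Q w (c *\<^sub>C x) = cnj c * Q w x"
  using Q_scale[of x w c] Q_comm[of w "c *\<^sub>C x"] Q_comm[of w x] csubspace_scaleC[OF D]
  by simp

lemma q_nonneg: "x \<in> D \<Longrightarrow> 0 \<le> q x"
  by (simp add: q_def Q_nonneg)

lemma q_plus:
  assumes "x \<in> D" "y \<in> D"
  shows "q (x + c *\<^sub>C y) = q x + 2 * Re (cnj c * Q x y) + (cmod c)\<^sup>2 * q y"
proof -
  have cy: "c *\<^sub>C y \<in> D" by (intro csubspace_scaleC D assms)
  have xy: "x + c *\<^sub>C y \<in> D" by (intro csubspace_add D assms cy)
  have "Q (x + c *\<^sub>C y) (x + c *\<^sub>C y) =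
      Q x x + cnj c * Q x y + cnj (cnj c * Q x y) + c * cnj c * Q y y"
    using assms cy xy Q_comm[of y x]
    by (simp add: Q_add Q_add2 Q_scale Q_scale2 algebra_simps)
  moreover have "Re (c * cnj c * Q y y) = (cmod c)\<^sup>2 * q y"
    unfolding complex_norm_square[symmetric] by (simp add: q_def)
  ultimately show ?thesis
    unfolding q_def by (simp only: plus_complex.sel cnj.sel)
qed

text \<open>An approximate orthogonal projection of \<open>x\<close> onto \<open>E\<close>: this condition is additive in \<open>x\<close> and
  makes \<open>y\<close> a Cauchy net for the form, so its completion is not needed.\<close>

definition approx :: "'a set \<Rightarrow> 'a \<Rightarrow> real \<Rightarrow> 'a \<Rightarrow> bool" where
  "approx E x \<epsilon> y \<longleftrightarrow> y \<in> E \<and> (\<forall>e\<in>E. cmod (Q (x - y) e) \<le> \<epsilon> * sqrt (q e))"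

text \<open>Testing \<open>c = - s * w\<close> with \<open>w = Q u e\<close> gives an inequality
  that is quadratic in the real parameter \<open>s\<close>, and the choice
  \<open>s = 1 / q e\<close> yields the estimate. If \<open>q e = 0\<close>, the quadratic term is
  absent and a large \<open>s\<close> forces \<open>w = 0\<close>.\<close>

lemma Q_small:
  assumes "u \<in> D" "e \<in> D" "0 \<le> \<epsilon>" and min: "\<And>c. q (u + c *\<^sub>C e) \<ge> q u - \<epsilon>\<^sup>2"
  shows "cmod (Q u e) \<le> \<epsilon> * sqrt (q e)"
proof -
  define w where "w = Q u e"
  have key: "2 * s * (cmod w)\<^sup>2 \<le> \<epsilon>\<^sup>2 + s\<^sup>2 * (cmod w)\<^sup>2 * q e" for s :: real
  proof -
    have "cnj (- of_real s * w) * Q u e = of_real (- s * (cmod w)\<^sup>2)"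
      using complex_norm_square[of w] by (simp add: w_def[symmetric] mult_ac)
    then have "Re (cnj (- of_real s * w) * Q u e) = - s * (cmod w)\<^sup>2"
      by (simp only: Re_complex_of_real)
    with min[of "- of_real s * w"] q_plus[OF assms(1,2), of "- of_real s * w"]
    show ?thesis by (simp add: norm_mult power_mult_distrib)
  qed
  have "(cmod w)\<^sup>2 \<le> \<epsilon>\<^sup>2 * q e"
  proof (cases "q e = 0")
    case True
    have "w = 0"
    proof (rule ccontr)
      assume "w \<noteq> 0"
      then show False
        using key[of "(\<epsilon>\<^sup>2 + 1) / (cmod w)\<^sup>2"] True zero_le_power2[of \<epsilon>] by simp
    qed
    then show ?thesis using True by simp
  next
    case False
    then have "q e > 0" using q_nonneg[OF assms(2)] by simp
    then show ?thesis
      using key[of "1 / q e"] by (simp add: field_simps power2_eq_square)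
  qed
  then have "cmod w \<le> sqrt (\<epsilon>\<^sup>2 * q e)" by (rule real_le_rsqrt)
  then show ?thesis using assms(3) by (simp add: w_def real_sqrt_mult)
qed

context
  fixes E
  assumes E: "csubspace E" and ED: "E \<subseteq> D"
begin

lemma ED': "x \<in> E \<Longrightarrow> x \<in> D" using ED by auto

lemma approx_self: "x \<in> E \<Longrightarrow> approx E x 0 x"
  using Q_scale[of 0 _ 0] csubspace_0[OF D] by (auto simp: approx_def ED')

text \<open>Any \<open>y\<close> in \<open>E\<close> for which \<open>q (x - y)\<close> exceeds its
  infimum by less than \<open>\<epsilon>\<^sup>2\<close> will do: moving it inside \<open>E\<close>
  cannot lower the value by more, so \<open>Q_small\<close> applies.\<close>

lemma approx_exists:
  assumes x: "x \<in> D" and "\<epsilon> > 0"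
  shows "\<exists>y. approx E x \<epsilon> y"
proof -
  define d where "d = (INF y\<in>E. q (x - y))"
  have bdd: "bdd_below ((\<lambda>y. q (x - y)) ` E)"
    by (rule bdd_belowI2[of _ 0]) (simp add: q_nonneg csubspace_diff[OF D x] ED')
  have ne: "E \<noteq> {}" using csubspace_0[OF E] by auto
  have "d < d + \<epsilon>\<^sup>2" using \<open>\<epsilon> > 0\<close> by simp
  then obtain y where y: "y \<in> E" "q (x - y) < d + \<epsilon>\<^sup>2"
    unfolding d_def using cINF_less_iff[OF ne bdd] by blast
  have "cmod (Q (x - y) e) \<le> \<epsilon> * sqrt (q e)" if "e \<in> E" for e
  proof (rule Q_small)
    show "x - y \<in> D" "e \<in> D" using csubspace_diff[OF D x] y(1) that by (auto simp: ED')
    show "0 \<le> \<epsilon>" using assms by simp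
    fix c
    have "y - c *\<^sub>C e \<in> E" by (intro csubspace_diff csubspace_scaleC E y that)
    then have "d \<le> q (x - (y - c *\<^sub>C e))" unfolding d_def by (rule cINF_lower[OF bdd])
    then show "q (x - y + c *\<^sub>C e) \<ge> q (x - y) - \<epsilon>\<^sup>2" using y(2) by (simp add: algebra_simps)
  qed
  then show ?thesis using y by (auto simp: approx_def)
qed

lemma approx_add:
  assumes "x \<in> D" "x' \<in> D" "approx E x \<epsilon> y" "approx E x' \<epsilon>' y'"
  shows "approx E (x + x') (\<epsilon> + \<epsilon>') (y + y')"
  unfolding approx_def
proof (intro conjI ballI)
  show "y + y' \<in> E" using assms by (auto simp: approx_def intro: csubspace_add E)
  fix e assume e: "e \<in> E"
  have eq: "x + x' - (y + y') = (x - y) + (x' - y')" by simp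
  have "Q (x + x' - (y + y')) e = Q (x - y) e + Q (x' - y') e"
    unfolding eq using Q_add[of "x - y" "x' - y'" e] assms e by (simp add: approx_def ED' csubspace_diff D)
  then show "cmod (Q (x + x' - (y + y')) e) \<le> (\<epsilon> + \<epsilon>') * sqrt (q e)"
    using norm_triangle_ineq[of "Q (x - y) e" "Q (x' - y') e"] assms(3,4) e
    by (force simp: approx_def distrib_right)
qed

lemma approx_scale:
  assumes "x \<in> D" "approx E x \<epsilon> y"
  shows "approx E (c *\<^sub>C x) (cmod c * \<epsilon>) (c *\<^sub>C y)"
  unfolding approx_def
proof (intro conjI ballI)
  show "c *\<^sub>C y \<in> E" using assms by (auto simp: approx_def intro: csubspace_scaleC E)
  fix e assume e: "e \<in> E"
  have "Q (c *\<^sub>C x - c *\<^sub>C y) e = c * Q (x - y) e"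
    using Q_scale[of "x - y" e c] assms e by (simp add: approx_def ED' csubspace_diff D scaleC_diff_right)
  then show "cmod (Q (c *\<^sub>C x - c *\<^sub>C y) e) \<le> (cmod c * \<epsilon>) * sqrt (q e)"
    using assms(2) e by (simp add: norm_mult mult.assoc approx_def mult_left_mono)
qed

text \<open>The difference \<open>y - y'\<close> lies in \<open>E\<close>, so both orthogonality
  estimates can be tested against it; then divide by its seminorm.\<close>

lemma approx_close:
  assumes "x \<in> D" "approx E x \<epsilon> y" "approx E x \<epsilon>' y'" "0 \<le> \<epsilon>" "0 \<le> \<epsilon>'"
  shows "sqrt (q (y - y')) \<le> \<epsilon> + \<epsilon>'"
proof -
  define e where "e = y - y'"
  have y: "y \<in> E" "y' \<in> E" using assms by (auto simp: approx_def)
  have e: "e \<in> E" using y by (simp add: e_def csubspace_diff E)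
  have e_eq: "e = (x - y') + (- 1) *\<^sub>C (x - y)" by (simp add: e_def scaleC_minus1)
  have in_D: "x - y' \<in> D" "x - y \<in> D" "(- 1) *\<^sub>C (x - y) \<in> D" "e \<in> D"
    using assms(1) y e by (auto intro!: csubspace_diff csubspace_scaleC D simp: ED')
  have "Q e e = Q (x - y') e - Q (x - y) e"
    by (subst e_eq) (simp only: Q_add[OF in_D(1,3,4)] Q_scale[OF in_D(2,4)], simp)
  then have "cmod (Q e e) \<le> \<epsilon>' * sqrt (q e) + \<epsilon> * sqrt (q e)"
    using norm_triangle_ineq4[of "Q (x - y') e" "Q (x - y) e"] assms(2,3) e
    by (force simp: approx_def)
  moreover have "q e \<le> cmod (Q e e)" unfolding q_def by (rule complex_Re_le_cmod)
  ultimately have "sqrt (q e) * sqrt (q e) \<le> (\<epsilon> + \<epsilon>') * sqrt (q e)"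
    using q_nonneg[of e] e by (simp add: ED' algebra_simps)
  then show ?thesis
    using q_nonneg[of e] e assms(4,5) mult_le_cancel_right_pos[of "sqrt (q e)" "sqrt (q e)" "\<epsilon> + \<epsilon>'"]
    unfolding e_def[symmetric] by (cases "q e = 0") (auto simp: ED' less_le)
qed

text \<open>An approximate Pythagoras: \<open>x - y\<close> is nearly orthogonal to
  \<open>y\<close>, so \<open>q x \<ge> q y - 2 * \<epsilon> * sqrt (q y)\<close>. The bound is the
  solution of this quadratic inequality for \<open>sqrt (q y)\<close>.\<close>

lemma approx_norm:
  assumes "x \<in> D" "approx E x \<epsilon> y" "0 \<le> \<epsilon>"
  shows "sqrt (q y) \<le> sqrt (q x) + 2 * \<epsilon>"
proof (rule ccontr)
  have y: "y \<in> E" using assms by (simp add: approx_def)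
  have xy: "x - y \<in> D" using assms(1) y by (simp add: csubspace_diff D ED')
  have "q x = q (x - y) + 2 * Re (Q (x - y) y) + q y"
    using q_plus[OF xy ED'[OF y], of 1] by simp
  moreover have "Re (Q (x - y) y) \<ge> - (\<epsilon> * sqrt (q y))"
    using assms(2) y abs_Re_le_cmod[of "Q (x - y) y"] unfolding approx_def by fastforce
  ultimately have 1: "q x \<ge> q y - 2 * \<epsilon> * sqrt (q y)" using q_nonneg[OF xy] by simp
  define a b where "a = sqrt (q y)" and "b = sqrt (q x)"
  have ab: "a * a = q y" "b * b = q x" "b \<ge> 0"
    using q_nonneg assms(1) y by (auto simp: a_def b_def ED')
  assume "\<not> ?thesis"
  then have "a > b + 2 * \<epsilon>" by (simp add: a_def b_def)
  then have "(a - b) * (a - 2 * \<epsilon>) > 0" "b * (a - 2 * \<epsilon> - b) \<ge> 0"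
    using \<open>b \<ge> 0\<close> assms(3) by (auto intro: mult_pos_pos mult_nonneg_nonneg)
  then have "a * (a - 2 * \<epsilon>) > b * b" by (simp add: algebra_simps)
  then show False using 1 ab by (simp add: algebra_simps flip: a_def)
qed

text \<open>Morally \<open>z'\<close> is \<open>z\<close> after the projection onto \<open>E\<close>
  for the form. That projection exists only in a completion, but \<open>z\<close> is a contraction
  for the seminorm and has a complete target, so the images of approximate projections converge. The
  last conclusion keeps the values of \<open>z'\<close> in any closed set that contains those of
  \<open>z\<close>.\<close>

theorem extension:
  fixes z :: "'a \<Rightarrow> 'b::chilbert_space"
  assumes z_add: "\<And>x y. x \<in> E \<Longrightarrow> y \<in> E \<Longrightarrow> z (x + y) = z x + z y"
    and z_scale: "\<And>c x. x \<in> E \<Longrightarrow> z (c *\<^sub>C x) = c *\<^sub>C z x"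
    and z_bound: "\<And>x. x \<in> E \<Longrightarrow> (norm (z x))\<^sup>2 \<le> Re (Q x x)"
  obtains z' where "\<And>x y. x \<in> D \<Longrightarrow> y \<in> D \<Longrightarrow> z' (x + y) = z' x + z' y"
    and "\<And>c x. x \<in> D \<Longrightarrow> z' (c *\<^sub>C x) = c *\<^sub>C z' x"
    and "\<And>x. x \<in> E \<Longrightarrow> z' x = z x"
    and "\<And>x. x \<in> D \<Longrightarrow> (norm (z' x))\<^sup>2 \<le> Re (Q x x)"
    and "\<And>x. x \<in> D \<Longrightarrow> z' x \<in> closure (z ` E)"
proof -
  have z_le: "norm (z x) \<le> sqrt (q x)" if "x \<in> E" for x
    using z_bound[OF that] by (simp add: q_def real_le_rsqrt)
  have z_diff: "z (x - y) = z x - z y" if "x \<in> E" "y \<in> E" for x y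
    using z_add[of x "(- 1) *\<^sub>C y"] z_scale[of y "- 1"] that csubspace_scaleC[OF E, of y "- 1"]
    by (simp add: scaleC_minus1)
  have close: "norm (z y - z y') \<le> \<epsilon> + \<epsilon>'"
    if "x \<in> D" "approx E x \<epsilon> y" "approx E x \<epsilon>' y'" "0 \<le> \<epsilon>" "0 \<le> \<epsilon>'" for x y y' \<epsilon> \<epsilon>'
    using approx_close[OF that] z_le[of "y - y'"] z_diff[of y y'] that(2,3)
    by (simp add: approx_def csubspace_diff E)
  define \<epsilon> where "\<epsilon> n = 1 / real (Suc n)" for n
  have \<epsilon>: "\<epsilon> n > 0" "\<epsilon> \<longlonglongrightarrow> 0" for n
    unfolding \<epsilon>_def using LIMSEQ_inverse_real_of_nat by (auto simp: inverse_eq_divide)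
  have "\<exists>Y. \<forall>x\<in>D. \<forall>n. approx E x (\<epsilon> n) (Y x n)"
    using approx_exists[OF _ \<epsilon>(1)] by metis
  then obtain Y where Y: "\<And>x n. x \<in> D \<Longrightarrow> approx E x (\<epsilon> n) (Y x n)" by blast
  have "\<exists>l. (\<lambda>n. z (Y x n)) \<longlonglongrightarrow> l" if "x \<in> D" for x
  proof -
    have "Cauchy (\<lambda>n. z (Y x n))"
    proof (rule metric_CauchyI)
      fix e :: real assume "e > 0"
      then obtain N where N: "\<And>n. n \<ge> N \<Longrightarrow> \<epsilon> n < e / 2"
        using order_tendstoD(2)[OF \<epsilon>(2), of "e / 2"] by (auto simp: eventually_sequentially)
      have "dist (z (Y x m)) (z (Y x n)) < e" if "m \<ge> N" "n \<ge> N" for m n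
        using close[OF \<open>x \<in> D\<close> Y Y, of m n] N[of m] N[of n] that \<epsilon>(1) \<open>x \<in> D\<close>
        by (smt (verit, best) dist_norm field_sum_of_halves)
      then show "\<exists>N. \<forall>m\<ge>N. \<forall>n\<ge>N. dist (z (Y x m)) (z (Y x n)) < e" by blast
    qed
    then show ?thesis by (simp add: Cauchy_convergent_iff convergent_def)
  qed
  then obtain z' where z': "\<And>x. x \<in> D \<Longrightarrow> (\<lambda>n. z (Y x n)) \<longlonglongrightarrow> z' x" by metis
  have z'_close: "norm (z' x - z y) \<le> \<delta>" if "x \<in> D" "approx E x \<delta> y" "0 \<le> \<delta>" for x y \<delta>
  proof (rule LIMSEQ_le)
    show "(\<lambda>n. norm (z (Y x n) - z y)) \<longlonglongrightarrow> norm (z' x - z y)"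
      by (intro tendsto_intros z' that)
    show "(\<lambda>n. \<epsilon> n + \<delta>) \<longlonglongrightarrow> \<delta>" using tendsto_add[OF \<epsilon>(2) tendsto_const[of \<delta>]] by simp
    show "\<exists>N. \<forall>n\<ge>N. norm (z (Y x n) - z y) \<le> \<epsilon> n + \<delta>"
      using close[OF that(1) Y that(2) _ that(3)] that(1) \<epsilon>(1) by (metis less_imp_le)
  qed
  \<comment> \<open>The limit can be computed from any approximations whose errors tend to 0. So
    sums and multiples of the chosen ones serve for sums and multiples, which gives
    linearity.\<close>
  have lim_unique: "z' x = l"
    if "x \<in> D" "\<And>n. approx E x (\<delta> n) (y n)" "\<And>n. 0 \<le> \<delta> n" "\<delta> \<longlonglongrightarrow> 0" "(\<lambda>n. z (y n)) \<longlonglongrightarrow> l" for x y \<delta> l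
  proof -
    have "(\<lambda>n. z' x - z (y n)) \<longlonglongrightarrow> 0"
      by (rule Lim_null_comparison[OF _ that(4)]) (use z'_close[OF that(1) that(2) that(3)] in auto)
    then have "(\<lambda>n. z' x - (z' x - z (y n))) \<longlonglongrightarrow> z' x - 0" by (intro tendsto_intros)
    then have "(\<lambda>n. z (y n)) \<longlonglongrightarrow> z' x" by simp
    then show ?thesis using that(5) LIMSEQ_unique by blast
  qed
  show ?thesis
  proof
    fix x assume x: "x \<in> D"
    show "z' (c *\<^sub>C x) = c *\<^sub>C z' x" for c
    proof (rule lim_unique[where \<delta> = "\<lambda>n. cmod c * \<epsilon> n"])
      show "approx E (c *\<^sub>C x) (cmod c * \<epsilon> n) (c *\<^sub>C Y x n)" for n by (intro approx_scale x Y)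
      have "(\<lambda>n. c *\<^sub>C z (Y x n)) \<longlonglongrightarrow> c *\<^sub>C z' x"
        by (intro bounded_clinear_tendsto[OF bounded_clinear_scaleC_fun[OF bounded_clinear_id]] z' x)
      then show "(\<lambda>n. z (c *\<^sub>C Y x n)) \<longlonglongrightarrow> c *\<^sub>C z' x"
        using Y[OF x] by (simp add: z_scale approx_def)
      show "(\<lambda>n. cmod c * \<epsilon> n) \<longlonglongrightarrow> 0" using tendsto_mult_left[OF \<epsilon>(2)] by simp
    qed (use \<epsilon>(1) in \<open>auto intro!: csubspace_scaleC D x mult_nonneg_nonneg less_imp_le[OF \<epsilon>(1)]\<close>)
    show "z' (x + y) = z' x + z' y" if y: "y \<in> D" for y
    proof (rule lim_unique[where \<delta> = "\<lambda>n. \<epsilon> n + \<epsilon> n"])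
      show "approx E (x + y) (\<epsilon> n + \<epsilon> n) (Y x n + Y y n)" for n by (intro approx_add x y Y)
      show "(\<lambda>n. z (Y x n + Y y n)) \<longlonglongrightarrow> z' x + z' y"
        using Y[OF x] Y[OF y] tendsto_add[OF z'[OF x] z'[OF y]] by (simp add: z_add approx_def)
      show "(\<lambda>n. \<epsilon> n + \<epsilon> n) \<longlonglongrightarrow> 0" using tendsto_add[OF \<epsilon>(2) \<epsilon>(2)] by simp
    qed (use \<epsilon>(1) in \<open>auto intro: csubspace_add D x y add_nonneg_nonneg less_imp_le\<close>)
    show "z' x \<in> closure (z ` E)"
      unfolding closure_sequential
      using z'[OF x] Y[OF x] by (intro exI[of _ "\<lambda>n. z (Y x n)"]) (auto simp: approx_def)
    have "norm (z' x) \<le> sqrt (q x)"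
    proof (rule LIMSEQ_le)
      show "(\<lambda>n. norm (z (Y x n))) \<longlonglongrightarrow> norm (z' x)" by (intro tendsto_norm z' x)
      show "(\<lambda>n. sqrt (q x) + 2 * \<epsilon> n) \<longlonglongrightarrow> sqrt (q x)"
        using tendsto_add[OF tendsto_const tendsto_mult_left[OF \<epsilon>(2), of 2]] by simp
      show "\<exists>N. \<forall>n\<ge>N. norm (z (Y x n)) \<le> sqrt (q x) + 2 * \<epsilon> n"
        using approx_norm[OF x Y[OF x]] z_le Y[OF x] \<epsilon>(1) unfolding approx_def
        by (meson less_imp_le order_trans)
    qed
    then show "(norm (z' x))\<^sup>2 \<le> Re (Q x x)"
      using power_mono[of "norm (z' x)" "sqrt (q x)" 2] q_nonneg[OF x] by (simp add: q_def)
  next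
    fix x assume "x \<in> E"
    then show "z' x = z x" using z'_close[OF ED' approx_self, of x] by simp
  qed
qed

end

end

lemma semi_inner_cinner:
  assumes "0 \<le> B"
  shows "semi_inner UNIV (\<lambda>x y :: 'a::complex_inner. of_real B * cinner x y)"
proof
  fix x y :: 'a
  show "of_real B * cinner x y = cnj (of_real B * cinner y x)" by (subst cinner_commute) simp
  show "0 \<le> Re (of_real B * cinner x x)" using assms by (simp add: cinner_self)
qed (simp_all add: cinner_add_left cinner_scaleC_left distrib_left)

text \<open>The form is \<open>B\<^sup>2\<close> times the inner product. This covers extension by
  continuity from a dense subspace, and also, with the identity for \<open>z\<close>, the
  construction of projections.\<close>

lemma bounded_extension:
  fixes z :: "'a::complex_inner \<Rightarrow> 'b::chilbert_space"
  assumes E: "csubspace E" and B: "0 \<le> B"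
    and z: "\<And>x y. x \<in> E \<Longrightarrow> y \<in> E \<Longrightarrow> z (x + y) = z x + z y"
      "\<And>c x. x \<in> E \<Longrightarrow> z (c *\<^sub>C x) = c *\<^sub>C z x"
      "\<And>x. x \<in> E \<Longrightarrow> norm (z x) \<le> B * norm x"
  obtains z' where "bounded_clinear z'" and "\<And>x. x \<in> E \<Longrightarrow> z' x = z x"
    and "\<And>x. norm (z' x) \<le> B * norm x" and "\<And>x. z' x \<in> closure (z ` E)"
proof -
  interpret semi_inner UNIV "\<lambda>x y :: 'a. of_real (B\<^sup>2) * cinner x y"
    by (rule semi_inner_cinner) simp
  have *: "Re (of_real (B\<^sup>2) * cinner x x) = (B * norm x)\<^sup>2" for x :: 'a
    by (simp add: cinner_self power_mult_distrib flip: of_real_power)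
  have bd: "(norm (z x))\<^sup>2 \<le> Re (of_real (B\<^sup>2) * cinner x x)" if "x \<in> E" for x
    unfolding * using z(3)[OF that] by (simp add: power_mono)
  show ?thesis
  proof (rule extension[OF E subset_UNIV z(1,2) bd])
    fix z' :: "'a \<Rightarrow> 'b"
    assume z': "\<And>x y. x \<in> UNIV \<Longrightarrow> y \<in> UNIV \<Longrightarrow> z' (x + y) = z' x + z' y"
      "\<And>c x. x \<in> UNIV \<Longrightarrow> z' (c *\<^sub>C x) = c *\<^sub>C z' x"
      "\<And>x. x \<in> E \<Longrightarrow> z' x = z x"
      "\<And>x. x \<in> UNIV \<Longrightarrow> (norm (z' x))\<^sup>2 \<le> Re (of_real (B\<^sup>2) * cinner x x)"
      "\<And>x. x \<in> UNIV \<Longrightarrow> z' x \<in> closure (z ` E)"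
    have le: "norm (z' x) \<le> B * norm x" for x
      using z'(4)[of x] B unfolding * by (simp add: power2_le_iff_abs_le)
    have "bounded_clinear z'" by (rule bounded_clinearI[OF z'(1,2) le]) auto
    then show ?thesis by (rule that) (use z' le in auto)
  qed
qed

subsection \<open>Projections and adjoints\<close>

text \<open>A contractive idempotent is an orthogonal projection: for \<open>e\<close> in its range
  and \<open>u\<close> in its kernel, \<open>norm e \<le> norm (e + c *\<^sub>C u)\<close> for all
  \<open>c\<close>, which forces orthogonality.\<close>

lemma projection_exists:
  fixes E :: "'a::chilbert_space set"
  assumes "csubspace E" "closed E"
  obtains P where "bounded_clinear P" "\<And>x. norm (P x) \<le> norm x" "\<And>x. P x \<in> E"
    "\<And>x e. e \<in> E \<Longrightarrow> cinner (x - P x) e = 0"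
proof -
  obtain P where P: "bounded_clinear P" "\<And>x. x \<in> E \<Longrightarrow> P x = x" "\<And>x. norm (P x) \<le> norm x"
    "\<And>x. P x \<in> E"
    using bounded_extension[OF assms(1), of 1 "\<lambda>x. x"] assms(2) by (auto simp: closure_closed)
  have "cinner (x - P x) e = 0" if e: "e \<in> E" for x e
  proof -
    define u where "u = x - P x"
    define w where "w = cinner e u"
    have Pu: "P u = 0" by (simp add: u_def P bounded_clinear_diff[OF P(1)])
    have pos: "0 \<le> 2 * Re (cnj c * w) + (cmod c)\<^sup>2 * (norm u)\<^sup>2" for c
    proof -
      have "P (e + c *\<^sub>C u) = e" using e
        by (simp add: P bounded_clinear_add[OF P(1)] bounded_clinear_scaleC[OF P(1)] Pu)
      then have "norm e \<le> norm (e + c *\<^sub>C u)" using P(3) by metis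
      then have "(norm e)\<^sup>2 \<le> (norm (e + c *\<^sub>C u))\<^sup>2" by (simp add: power_mono)
      then show ?thesis by (simp add: norm_plus_scaleC_sq w_def)
    qed
    \<comment> \<open>Small enough for the linear term in \<open>c = - s * w\<close> to beat the
      quadratic one; the added 1 covers \<open>u = 0\<close>.\<close>
    define s where "s = 1 / ((norm u)\<^sup>2 + 1)"
    have s: "s > 0" "s * (norm u)\<^sup>2 < 1"
      by (auto simp: s_def divide_simps add_pos_nonneg add_nonneg_pos)
    have "cnj (- of_real s * w) * w = of_real (- s * (cmod w)\<^sup>2)"
      using complex_norm_square[of w] by (simp add: mult_ac)
    then have "Re (cnj (- of_real s * w) * w) = - s * (cmod w)\<^sup>2" by (simp only: Re_complex_of_real)
    then have "0 \<le> s * (cmod w)\<^sup>2 * (s * (norm u)\<^sup>2 - 2)"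
      using pos[of "- of_real s * w"]
      by (simp only: norm_mult norm_minus_cancel norm_of_real power_mult_distrib power2_abs)
        (simp add: algebra_simps power2_eq_square[of s])
    moreover have "s * (cmod w)\<^sup>2 * (s * (norm u)\<^sup>2 - 2) < 0" if "w \<noteq> 0"
      using s that by (intro mult_pos_neg) auto
    ultimately have "w = 0" by force
    then show ?thesis by (subst cinner_zero_commute) (simp add: w_def u_def)
  qed
  with P show ?thesis using that by blast
qed

lemma proj_eqI:
  assumes "csubspace E" "y \<in> E" "\<And>z. z \<in> E \<Longrightarrow> cinner (x - y) z = 0"
  shows "proj E x = y"
  unfolding proj_def
proof (rule the_equality)
  show "y \<in> E \<and> (\<forall>z\<in>E. cinner (x - y) z = 0)" using assms by auto
  fix y' assume y': "y' \<in> E \<and> (\<forall>z\<in>E. cinner (x - y') z = 0)"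
  have d: "y - y' \<in> E" using assms(1,2) y' by (simp add: csubspace_diff)
  have "cinner (y - y') (y - y') = cinner (x - y') (y - y') - cinner (x - y) (y - y')"
    by (simp add: cinner.diff_left)
  also have "\<dots> = 0" using assms(3)[OF d] y' d by simp
  finally show "y' = y" by (simp add: cinner_self)
qed

lemma
  fixes E :: "'a::chilbert_space set"
  assumes "csubspace E" "closed E"
  shows proj_in: "proj E x \<in> E"
    and proj_orth: "e \<in> E \<Longrightarrow> cinner (x - proj E x) e = 0"
    and bounded_clinear_proj: "bounded_clinear (proj E)"
    and norm_proj_le: "norm (proj E x) \<le> norm x"
    and proj_ident: "x \<in> E \<Longrightarrow> proj E x = x"
proof -
  obtain P where P: "bounded_clinear P" "\<And>x. norm (P x) \<le> norm x" "\<And>x. P x \<in> E"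
    "\<And>x e. e \<in> E \<Longrightarrow> cinner (x - P x) e = 0"
    using projection_exists[OF assms] by blast
  have "proj E = P" by (intro ext proj_eqI assms P)
  with P show "proj E x \<in> E" "e \<in> E \<Longrightarrow> cinner (x - proj E x) e = 0" "bounded_clinear (proj E)"
    "norm (proj E x) \<le> norm x" by auto
  show "x \<in> E \<Longrightarrow> proj E x = x" by (rule proj_eqI) (auto simp: assms cinner.zero_left)
qed

lemma proj_ortho_zero:
  fixes E :: "'a::chilbert_space set"
  assumes "csubspace E" "x \<in> ortho E"
  shows "proj E x = 0"
  using assms by (intro proj_eqI) (auto simp: csubspace_0 ortho_def)

lemma ortho_ortho:
  fixes E :: "'a::chilbert_space set"
  assumes "csubspace E" "closed E" "\<And>y. y \<in> ortho E \<Longrightarrow> cinner x y = 0"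
  shows "x \<in> E"
proof -
  have o: "x - proj E x \<in> ortho E" using proj_orth[OF assms(1,2)] by (simp add: ortho_def)
  have "cinner (proj E x) (x - proj E x) = 0"
    using o proj_in[OF assms(1,2)] by (subst cinner_zero_commute) (simp add: ortho_def)
  then have "cinner (x - proj E x) (x - proj E x) = 0"
    using assms(3)[OF o] by (simp add: cinner.diff_left)
  then show ?thesis using proj_in[OF assms(1,2), of x] by (simp add: cinner_self)
qed

lemma riesz:
  fixes \<phi> :: "'a::chilbert_space \<Rightarrow> complex"
  assumes add: "\<And>x y. \<phi> (x + y) = \<phi> x + \<phi> y" and scale: "\<And>c x. \<phi> (c *\<^sub>C x) = c * \<phi> x"
    and bound: "\<And>x. cmod (\<phi> x) \<le> B * norm x"
  shows "\<exists>z. \<forall>x. \<phi> x = cinner x z"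
proof (cases "\<forall>x. \<phi> x = 0")
  case True
  then show ?thesis by (intro exI[of _ 0]) (simp add: cinner.zero_right)
next
  case False
  then obtain x0 where x0: "\<phi> x0 \<noteq> 0" by blast
  define N where "N = {x. \<phi> x = 0}"
  have N: "csubspace N" using add scale scale[of 0 0] by (auto simp: csubspace_def N_def)
  have "bounded_linear \<phi>"
    using add bound scale by (intro bounded_linear_intro[of _ B])
      (auto simp: scaleR_scaleC scaleR_conv_of_real mult.commute)
  then have cN: "closed N" unfolding N_def
    by (intro closed_Collect_eq continuous_intros linear_continuous_on)
  define u where "u = x0 - proj N x0"
  have diff: "\<phi> (x - y) = \<phi> x - \<phi> y" for x y
    using add[of x "(- 1) *\<^sub>C y"] scale[of "- 1" y] by (simp add: scaleC_minus1)
  have u: "\<phi> u = \<phi> x0" using proj_in[OF N cN, of x0] by (simp add: u_def diff N_def)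
  have orth: "cinner e u = 0" if "e \<in> N" for e
    using proj_orth[OF N cN that, of x0] by (subst cinner_zero_commute) (simp add: u_def)
  have nu: "norm u \<noteq> 0" using u x0 scale[of 0 0] by auto
  have "\<phi> x = cinner x ((cnj (\<phi> u) / of_real ((norm u)\<^sup>2)) *\<^sub>C u)" for x
  proof -
    have "x - (\<phi> x / \<phi> u) *\<^sub>C u \<in> N" using x0 u by (simp add: N_def diff scale)
    from orth[OF this] have "cinner x u = (\<phi> x / \<phi> u) * of_real ((norm u)\<^sup>2)"
      by (simp add: cinner.diff_left cinner_scaleC_left cinner_self)
    then show ?thesis using x0 u nu by (simp add: cinner_scaleC_right)
  qed
  then show ?thesis by blast
qed

lemma adj_on_eqI:
  assumes "csubspace E" "z \<in> E" "\<And>x. x \<in> E \<Longrightarrow> cinner (X x) y = cinner x z"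
  shows "adj_on E X y = z"
  unfolding adj_on_def
proof (rule the_equality)
  show "z \<in> E \<and> (\<forall>x\<in>E. cinner (X x) y = cinner x z)" using assms by auto
  fix z' assume z': "z' \<in> E \<and> (\<forall>x\<in>E. cinner (X x) y = cinner x z')"
  have "z - z' \<in> E" using assms(1,2) z' by (simp add: csubspace_diff)
  then have "cinner (z - z') (z - z') = 0"
    using assms(3) z' by (simp add: cinner.diff_right)
  then show "z' = z" by (simp add: cinner_self)
qed

lemma cinner_cadj:
  fixes T :: "'a::chilbert_space \<Rightarrow> 'b::complex_inner"
  assumes T: "bounded_clinear T"
  shows "cinner (T x) y = cinner x (cadj T y)"
proof -
  have "\<exists>z. \<forall>x. cinner (T x) y = cinner x z"
  proof (rule riesz)
    show "cmod (cinner (T x) y) \<le> (onorm T * norm y) * norm x" for x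
    proof -
      have "cmod (cinner (T x) y) \<le> norm (T x) * norm y" by (rule cinner_Cauchy_Schwarz)
      also have "\<dots> \<le> (onorm T * norm x) * norm y"
        by (intro mult_right_mono bounded_clinear_onorm T) simp
      finally show ?thesis by (simp add: mult_ac)
    qed
  qed (simp_all add: bounded_clinear_add[OF T] bounded_clinear_scaleC[OF T] cinner_add_left cinner_scaleC_left)
  then obtain z where z: "\<And>x. cinner (T x) y = cinner x z" by blast
  have "cadj T y = z" by (rule adj_on_eqI) (auto simp: z)
  then show ?thesis by (simp add: z)
qed

lemma cinner_cadj':
  fixes T :: "'a::chilbert_space \<Rightarrow> 'b::complex_inner"
  assumes "bounded_clinear T"
  shows "cinner (cadj T y) x = cinner y (T x)"
  using cinner_cadj[OF assms, of x y] by (metis cinner_commute)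

lemma cadj_eqI:
  fixes T :: "'a::chilbert_space \<Rightarrow> 'b::complex_inner"
  assumes "\<And>x y. cinner (T x) y = cinner x (S y)"
  shows "cadj T = S"
  by (intro ext adj_on_eqI) (auto simp: assms)

lemma
  fixes T :: "'a::chilbert_space \<Rightarrow> 'b::complex_inner"
  assumes T: "bounded_clinear T"
  shows bounded_clinear_cadj: "bounded_clinear (cadj T)"
    and norm_cadj_le: "0 \<le> B \<Longrightarrow> (\<And>x. norm (T x) \<le> B * norm x) \<Longrightarrow> norm (cadj T y) \<le> B * norm y"
proof -
  have le: "norm (cadj T y) \<le> B * norm y"
    if "0 \<le> B" and B: "\<And>x. norm (T x) \<le> B * norm x" for B y
  proof (cases "cadj T y = 0")
    case False
    have "norm (cadj T y) * norm (cadj T y) = cmod (cinner (T (cadj T y)) y)"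
      unfolding cinner_cadj[OF T] cinner_self norm_of_real by (simp add: power2_eq_square)
    also have "\<dots> \<le> norm (T (cadj T y)) * norm y" by (rule cinner_Cauchy_Schwarz)
    also have "\<dots> \<le> (B * norm (cadj T y)) * norm y" by (intro mult_right_mono B) simp
    finally have "norm (cadj T y) * norm (cadj T y) \<le> (B * norm y) * norm (cadj T y)"
      by (simp add: mult_ac)
    then show ?thesis using False by simp
  qed (use that in simp)
  show "bounded_clinear (cadj T)"
  proof (rule bounded_clinearI)
    show "cadj T (x + y) = cadj T x + cadj T y" for x y
      by (rule cinner_eqI) (simp add: cinner_cadj'[OF T] cinner_add_left)
    show "cadj T (c *\<^sub>C x) = c *\<^sub>C cadj T x" for c x
      by (rule cinner_eqI) (simp add: cinner_cadj'[OF T] cinner_scaleC_left)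
    show "norm (cadj T y) \<le> onorm T * norm y" for y
      by (rule le) (simp_all add: bounded_clinear_onorm_nonneg bounded_clinear_onorm T)
  qed
  show "0 \<le> B \<Longrightarrow> (\<And>x. norm (T x) \<le> B * norm x) \<Longrightarrow> norm (cadj T y) \<le> B * norm y"
    by (rule le)
qed

text \<open>The adjoint of the difference takes values orthogonal to \<open>G\<close>, hence is
  0.\<close>

lemma bounded_clinear_eq_on_total:
  fixes S T :: "'a::chilbert_space \<Rightarrow> 'b::complex_inner"
  assumes "bounded_clinear S" "bounded_clinear T" "ctotal G" "\<And>g. g \<in> G \<Longrightarrow> S g = T g"
  shows "S = T"
proof
  fix x
  have D: "bounded_clinear (\<lambda>x. S x - T x)" by (intro bounded_clinear_minus assms)
  have "cadj (\<lambda>x. S x - T x) y = 0" for y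
  proof (rule totalD[OF assms(3)])
    fix g assume "g \<in> G"
    then show "cinner (cadj (\<lambda>x. S x - T x) y) g = 0"
      unfolding cinner_cadj'[OF D] using assms(4) by (simp add: cinner.zero_right)
  qed
  then have "cinner (S x - T x) (S x - T x) = 0"
    using cinner_cadj[OF D] by (simp add: cinner.zero_right)
  then show "S x = T x" by (simp add: cinner_self)
qed

text \<open>The projection of \<open>v\<close> onto \<open>ortho S'\<close> is orthogonal to
  \<open>S'\<close> by construction, and to \<open>S\<close> because \<open>v\<close> is and
  \<open>S\<close> lies in \<open>ortho S'\<close>. So it vanishes, and \<open>v\<close> is
  orthogonal to all of \<open>ortho S'\<close>.\<close>

lemma ortho_split:
  fixes u v :: "'a::chilbert_space"
  assumes "ctotal (S \<union> S')" "\<And>s s'. s \<in> S \<Longrightarrow> s' \<in> S' \<Longrightarrow> cinner s s' = 0"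
    and u: "u \<in> ortho S'" and v: "v \<in> ortho S"
  shows "cinner u v = 0"
proof -
  note C = csubspace_ortho[of S'] closed_ortho[of S']
  define p where "p = proj (ortho S') v"
  have p: "p \<in> ortho S'" "\<And>e. e \<in> ortho S' \<Longrightarrow> cinner (v - p) e = 0"
    unfolding p_def using proj_in[OF C] proj_orth[OF C] by auto
  have "p = 0"
  proof (rule totalD[OF assms(1)])
    fix s assume "s \<in> S \<union> S'"
    then show "cinner p s = 0"
    proof
      assume s: "s \<in> S"
      then have "s \<in> ortho S'" using assms(2) by (auto simp: ortho_def)
      then have "cinner (v - p) s = 0" by (rule p)
      moreover have "cinner v s = 0" using v s by (auto simp: ortho_def)
      ultimately show ?thesis by (simp add: cinner.diff_left)
    next
      assume "s \<in> S'" then show ?thesis using p(1) by (auto simp: ortho_def)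
    qed
  qed
  then have "cinner v u = 0" using p(2)[OF u] by simp
  then show ?thesis by (subst cinner_zero_commute)
qed

section \<open>Commutant lifting for row isometries\<close>

locale row_isometry =
  fixes V :: "'n::finite \<Rightarrow> 'a::chilbert_space \<Rightarrow> 'a"
  assumes V_bounded: "bounded_clinear (V i)"
    and V_cinner: "cinner (V i x) (V j y) = (if i = j then cinner x y else 0)"
begin

abbreviation A :: "'n \<Rightarrow> 'a \<Rightarrow> 'a" where
  "A i \<equiv> cadj (V i)"

lemma A_bounded: "bounded_clinear (A i)"
  by (intro bounded_clinear_cadj V_bounded)

lemma A_V: "A i (V j x) = (if i = j then x else 0)"
  by (rule cinner_eqI) (simp add: cinner_cadj'[OF V_bounded] V_cinner cinner.zero_left)

text \<open>The projection onto the defect space, which is the joint kernel of the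
  \<open>A i\<close>; for creation operators it gives the vacuum component.\<close>

definition vac :: "'a \<Rightarrow> 'a" where
  "vac x = x - (\<Sum>i\<in>UNIV. V i (A i x))"

lemma bounded_clinear_vac: "bounded_clinear vac"
proof -
  have "bounded_clinear (\<lambda>x. x - (\<Sum>i\<in>UNIV. V i (A i x)))"
    by (intro bounded_clinear_minus bounded_clinear_setsum bounded_clinear_comp[OF V_bounded]
        A_bounded bounded_clinear_id)
  then show ?thesis by (simp add: vac_def[abs_def])
qed

lemma A_sum: "A i (\<Sum>j\<in>UNIV. V j (w j)) = w i"
  by (simp add: bounded_clinear_sum[OF A_bounded] A_V)

lemma A_vac: "A i (vac x) = 0"
  by (simp add: vac_def bounded_clinear_diff[OF A_bounded] A_sum)

text \<open>The two parts are orthogonal. Hence a norm bound on a lift amounts to a bound on its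
  defect component by what the other components leave.\<close>

lemma norm_vac_split:
  assumes "\<And>i. A i v = 0"
  shows "(norm (v + (\<Sum>i\<in>UNIV. V i (w i))))\<^sup>2 = (norm v)\<^sup>2 + (\<Sum>i\<in>UNIV. (norm (w i))\<^sup>2)"
proof -
  define s where "s = (\<Sum>i\<in>UNIV. V i (w i))"
  have vs: "cinner s v = 0"
    by (simp add: s_def cinner.sum_left cinner_cadj[OF V_bounded] assms cinner.zero_right)
  have "cinner s s = (\<Sum>i\<in>UNIV. cinner (w i) (w i))"
    unfolding s_def by (simp add: cinner.sum_left cinner_cadj[OF V_bounded] A_sum)
  then have "complex_of_real ((norm s)\<^sup>2) = complex_of_real (\<Sum>i\<in>UNIV. (norm (w i))\<^sup>2)"
    by (simp only: cinner_self of_real_sum)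
  then have "(norm s)\<^sup>2 = (\<Sum>i\<in>UNIV. (norm (w i))\<^sup>2)" by (simp only: of_real_eq_iff)
  moreover have "(norm (v + s))\<^sup>2 = (norm v)\<^sup>2 + (norm s)\<^sup>2"
    using norm_plus_scaleC_sq[of v 1 s] vs cinner_zero_commute[of v s] by simp
  ultimately show ?thesis by (simp add: s_def)
qed

lemma vac_decomp: "vac x + (\<Sum>i\<in>UNIV. V i (A i x)) = x"
  by (simp add: vac_def)

lemma norm_decomp: "(norm x)\<^sup>2 = (norm (vac x))\<^sup>2 + (\<Sum>i\<in>UNIV. (norm (A i x))\<^sup>2)"
  using norm_vac_split[of "vac x" "\<lambda>i. A i x"] by (simp add: A_vac vac_decomp)

definition pre :: "'a set \<Rightarrow> 'a set" where
  "pre E = {x. \<forall>i. A i x \<in> E}"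

text \<open>The vectors killed by all words of length \<open>n\<close> in the \<open>A i\<close>.
  Written as an iterate of \<open>pre\<close>, it is contained by monotonicity in the same iterate
  applied to any subspace.\<close>

definition nilp :: "nat \<Rightarrow> 'a set" where
  "nilp n = (pre ^^ n) {0}"

lemma csubspace_pre: "csubspace E \<Longrightarrow> csubspace (pre E)"
  by (simp add: csubspace_def pre_def bounded_clinear_add[OF A_bounded]
      bounded_clinear_scaleC[OF A_bounded] bounded_clinear_zero[OF A_bounded])

lemma pre_mono: "E \<subseteq> E' \<Longrightarrow> pre E \<subseteq> pre E'"
  by (auto simp: pre_def)

end

locale row_pair = V: row_isometry V + W: row_isometry W
  for V :: "'n::finite \<Rightarrow> 'a::chilbert_space \<Rightarrow> 'a" and W :: "'n \<Rightarrow> 'b::chilbert_space \<Rightarrow> 'b" +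
  fixes \<rho> :: real
  assumes \<rho>: "0 \<le> \<rho>"
begin

text \<open>\<open>Z\<close> stands for the restriction to \<open>E\<close> of the adjoint of a
  lift. Its values outside \<open>E\<close> carry no meaning, and an extension step may replace
  them.\<close>

definition partial_lift :: "'b set \<Rightarrow> ('b \<Rightarrow> 'a) \<Rightarrow> bool" where
  "partial_lift E Z \<longleftrightarrow> csubspace E \<and> (\<forall>i. \<forall>x\<in>E. W.A i x \<in> E) \<and>
     (\<forall>x\<in>E. \<forall>y\<in>E. Z (x + y) = Z x + Z y) \<and> (\<forall>c. \<forall>x\<in>E. Z (c *\<^sub>C x) = c *\<^sub>C Z x) \<and>
     (\<forall>x\<in>E. norm (Z x) \<le> \<rho> * norm x) \<and> (\<forall>i. \<forall>x\<in>E. V.A i (Z x) = Z (W.A i x))"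

text \<open>One step of the extension: on \<open>pre E\<close> all components of the image except the one in the
  defect space of \<open>V\<close> are prescribed, and that one is dominated on \<open>E\<close> by what the bound leaves.\<close>

lemma partial_lift_step:
  assumes lift: "partial_lift E Z"
  shows "\<exists>Z'. partial_lift (W.pre E) Z' \<and> (\<forall>x\<in>E. Z' x = Z x)"
proof -
  have E: "csubspace E" and inv: "\<And>i x. x \<in> E \<Longrightarrow> W.A i x \<in> E"
    and add: "\<And>x y. x \<in> E \<Longrightarrow> y \<in> E \<Longrightarrow> Z (x + y) = Z x + Z y"
    and scale: "\<And>c x. x \<in> E \<Longrightarrow> Z (c *\<^sub>C x) = c *\<^sub>C Z x"
    and bound: "\<And>x. x \<in> E \<Longrightarrow> norm (Z x) \<le> \<rho> * norm x"
    and twine: "\<And>i x. x \<in> E \<Longrightarrow> V.A i (Z x) = Z (W.A i x)"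
    using lift by (auto simp: partial_lift_def)
  have pE: "csubspace (W.pre E)" by (intro W.csubspace_pre E)
  have preD: "W.A i x \<in> E" if "x \<in> W.pre E" for i x using that by (simp add: W.pre_def)
  have Epre: "E \<subseteq> W.pre E" using inv by (auto simp: W.pre_def)
  define Q where
    "Q x y = of_real (\<rho>\<^sup>2) * cinner x y - (\<Sum>i\<in>UNIV. cinner (Z (W.A i x)) (Z (W.A i y)))" for x y
  note W_lin = bounded_clinear_add[OF W.A_bounded] bounded_clinear_scaleC[OF W.A_bounded]
  have Q_self: "Re (Q x x) = (\<rho> * norm x)\<^sup>2 - (\<Sum>i\<in>UNIV. (norm (Z (W.A i x)))\<^sup>2)" for x
    unfolding Q_def cinner_self
    by (simp add: power_mult_distrib flip: of_real_power of_real_mult of_real_sum)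
  \<comment> \<open>The bound on \<open>E\<close>, together with the fact that the
    \<open>W.A i\<close> form a column contraction.\<close>
  have Q_pos: "0 \<le> Re (Q x x)" if "x \<in> W.pre E" for x
  proof -
    have "(\<Sum>i\<in>UNIV. (norm (Z (W.A i x)))\<^sup>2) \<le> (\<Sum>i\<in>UNIV. (\<rho> * norm (W.A i x))\<^sup>2)"
      by (intro sum_mono power_mono bound preD that) simp
    also have "\<dots> = \<rho>\<^sup>2 * (\<Sum>i\<in>UNIV. (norm (W.A i x))\<^sup>2)"
      by (simp add: power_mult_distrib sum_distrib_left)
    also have "\<dots> \<le> \<rho>\<^sup>2 * (norm x)\<^sup>2"
      using W.norm_decomp[of x] by (intro mult_left_mono) auto
    finally show ?thesis by (simp add: Q_self power_mult_distrib)
  qed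
  interpret Q: semi_inner "W.pre E" Q
  proof
    show "csubspace (W.pre E)" by (rule pE)
    show "Q (x + y) w = Q x w + Q y w" if "x \<in> W.pre E" "y \<in> W.pre E" for x y w
      using that by (simp add: Q_def W_lin add preD cinner_add_left sum.distrib algebra_simps)
    show "Q (c *\<^sub>C x) w = c * Q x w" if "x \<in> W.pre E" for c x w
      using that by (simp add: Q_def W_lin scale preD cinner_scaleC_left sum_distrib_left algebra_simps)
    show "Q x y = cnj (Q y x)" for x y
      by (simp add: Q_def flip: cinner_commute[of x y] cinner_commute[of "Z (W.A _ x)" "Z (W.A _ y)"])
  qed (rule Q_pos)
  define z where "z x = V.vac (Z x)" for x
  note vac_lin = bounded_clinear_add[OF V.bounded_clinear_vac] bounded_clinear_scaleC[OF V.bounded_clinear_vac]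
  \<comment> \<open>On \<open>E\<close> the components of \<open>Z x\<close> outside the defect
    space are exactly the prescribed ones, by \<open>twine\<close>; so its defect component fits
    into what \<open>Q\<close> leaves.\<close>
  have z_bound: "(norm (z x))\<^sup>2 \<le> Re (Q x x)" if "x \<in> E" for x
  proof -
    have "(norm (Z x))\<^sup>2 \<le> (\<rho> * norm x)\<^sup>2" by (intro power_mono bound that) simp
    then show ?thesis
      using V.norm_decomp[of "Z x"] by (simp add: Q_self z_def twine that)
  qed
  have z_lin: "z (x + y) = z x + z y" "z (c *\<^sub>C x) = c *\<^sub>C z x" if "x \<in> E" "y \<in> E" for x y c
    using that by (simp_all add: z_def add scale vac_lin)
  show ?thesis
  proof (rule Q.extension[OF E Epre z_lin(1) z_lin(2) z_bound])
    fix z' :: "'b \<Rightarrow> 'a"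
    assume z'_add: "\<And>x y. x \<in> W.pre E \<Longrightarrow> y \<in> W.pre E \<Longrightarrow> z' (x + y) = z' x + z' y"
      and z'_scale: "\<And>c x. x \<in> W.pre E \<Longrightarrow> z' (c *\<^sub>C x) = c *\<^sub>C z' x"
      and z'_ext: "\<And>x. x \<in> E \<Longrightarrow> z' x = z x"
      and z'_bound: "\<And>x. x \<in> W.pre E \<Longrightarrow> (norm (z' x))\<^sup>2 \<le> Re (Q x x)"
      and z'_cl: "\<And>x. x \<in> W.pre E \<Longrightarrow> z' x \<in> closure (z ` E)"
    \<comment> \<open>The extension stays in the closure of a set of defect vectors, and the kernel
      of \<open>V.A i\<close> is closed.\<close>
    have A_z': "V.A i (z' x) = 0" if "x \<in> W.pre E" for i x
    proof -
      have "closed {y. V.A i y = 0}"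
        by (intro closed_Collect_eq linear_continuous_on continuous_on_const
            bounded_clinear_bounded_linear V.A_bounded)
      then have "closure (z ` E) \<subseteq> {y. V.A i y = 0}"
        by (intro closure_minimal) (auto simp: z_def V.A_vac)
      then show ?thesis using z'_cl[OF that] by auto
    qed
    define Z' where "Z' x = z' x + (\<Sum>i\<in>UNIV. V i (Z (W.A i x)))" for x
    have ext: "Z' x = Z x" if "x \<in> E" for x
      using V.vac_decomp[of "Z x"] that by (simp add: Z'_def z'_ext z_def twine)
    have "partial_lift (W.pre E) Z'"
      unfolding partial_lift_def
    proof (intro conjI allI ballI)
      show "csubspace (W.pre E)" by (rule pE)
      fix x assume x: "x \<in> W.pre E"
      show "W.A i x \<in> W.pre E" for i using preD[OF x] Epre by auto
      show "Z' (x + y) = Z' x + Z' y" if y: "y \<in> W.pre E" for y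
        using x y by (simp add: Z'_def z'_add W_lin add preD bounded_clinear_add[OF V.V_bounded] sum.distrib)
      show "Z' (c *\<^sub>C x) = c *\<^sub>C Z' x" for c
        using x by (simp add: Z'_def z'_scale W_lin scale preD bounded_clinear_scaleC[OF V.V_bounded]
            scaleC_add_right scaleC_sum_right)
      have "(norm (Z' x))\<^sup>2 = (norm (z' x))\<^sup>2 + (\<Sum>i\<in>UNIV. (norm (Z (W.A i x)))\<^sup>2)"
        unfolding Z'_def by (rule V.norm_vac_split[OF A_z'[OF x]])
      also have "\<dots> \<le> (\<rho> * norm x)\<^sup>2" using z'_bound[OF x] by (simp add: Q_self)
      finally show "norm (Z' x) \<le> \<rho> * norm x"
        using \<rho> by (simp add: power2_le_iff_abs_le)
      \<comment> \<open>Applying \<open>V.A i\<close> to the definition leaves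
        \<open>Z (W.A i x)\<close>, and at this point of \<open>E\<close> the maps \<open>Z\<close>
        and \<open>Z'\<close> agree.\<close>
      show "V.A i (Z' x) = Z' (W.A i x)" for i
        using ext[OF preD[OF x]]
        by (simp add: Z'_def bounded_clinear_add[OF V.A_bounded] A_z'[OF x] V.A_sum)
    qed
    then show ?thesis using ext by blast
  qed
qed

theorem commutant_lifting:
  assumes lift: "partial_lift E Z" and pure: "ctotal (\<Union>n. W.nilp n)"
  obtains Z' where "bounded_clinear Z'" "\<And>x. norm (Z' x) \<le> \<rho> * norm x"
    "\<And>x. x \<in> E \<Longrightarrow> Z' x = Z x" "\<And>i x. V.A i (Z' x) = Z' (W.A i x)"
proof -
  define En where "En n = (W.pre ^^ n) E" for n
  have En_Suc: "En (Suc n) = W.pre (En n)" for n by (simp add: En_def)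
  \<comment> \<open>The clause for \<open>n = 0\<close> is part of the invariant so that the choice
    of the sequence remembers its starting map.\<close>
  have "\<exists>Zs. \<forall>n. partial_lift (En n) (Zs n) \<and> (n = 0 \<longrightarrow> Zs n = Z) \<and> (\<forall>x\<in>En n. Zs (Suc n) x = Zs n x)"
  proof -
    have "\<exists>Zs. \<forall>n. (partial_lift (En n) (Zs n) \<and> (n = 0 \<longrightarrow> Zs n = Z)) \<and> (\<forall>x\<in>En n. Zs (Suc n) x = Zs n x)"
    proof (rule dependent_nat_choice)
      show "\<exists>x. partial_lift (En 0) x \<and> (0 = (0 :: nat) \<longrightarrow> x = Z)" using lift by (simp add: En_def)
      fix Y n assume "partial_lift (En n) Y \<and> (n = 0 \<longrightarrow> Y = Z)"
      then show "\<exists>Z'. (partial_lift (En (Suc n)) Z' \<and> (Suc n = 0 \<longrightarrow> Z' = Z)) \<and> (\<forall>x\<in>En n. Z' x = Y x)"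
        using partial_lift_step[of "En n" Y] by (auto simp: En_Suc)
    qed
    then show ?thesis by auto
  qed
  then obtain Zs where Zs: "\<And>n. partial_lift (En n) (Zs n)" "Zs 0 = Z"
    "\<And>n x. x \<in> En n \<Longrightarrow> Zs (Suc n) x = Zs n x" by blast
  have "En n \<subseteq> En (Suc n)" for n
    using Zs(1)[of n] by (auto simp: En_Suc W.pre_def partial_lift_def)
  then have mono: "m \<le> n \<Longrightarrow> En m \<subseteq> En n" for m n by (rule lift_Suc_mono_le)
  have coh: "Zs n x = Zs m x" if "m \<le> n" "x \<in> En m" for m n x
    using that(1)
  proof (induction n rule: dec_induct)
    case (step n)
    then have "x \<in> En n" using mono[of m n] that(2) by auto
    then show ?case using Zs(3) step by simp
  qed simp
  define D where "D = (\<Union>n. En n)"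
  \<comment> \<open>The least index is just a way to pick one: by \<open>coh\<close>, every
    admissible index gives the same value.\<close>
  define Z0 where "Z0 x = Zs (LEAST n. x \<in> En n) x" for x
  have Z0: "Z0 x = Zs n x" if "x \<in> En n" for x n
    unfolding Z0_def by (rule coh[symmetric]) (use that in \<open>auto intro: Least_le LeastI\<close>)
  have common: "\<exists>n. x \<in> En n \<and> y \<in> En n" if "x \<in> D" "y \<in> D" for x y
    using that mono by (metis D_def UN_iff max.cobounded1 max.cobounded2 subsetD)
  have inv: "W.A i x \<in> En n" if "x \<in> En n" for i x n
    using Zs(1)[of n] that by (auto simp: partial_lift_def)
  have lin: "x + y \<in> En n" "c *\<^sub>C x \<in> En n" "Zs n (x + y) = Zs n x + Zs n y"
    "Zs n (c *\<^sub>C x) = c *\<^sub>C Zs n x" if "x \<in> En n" "y \<in> En n" for x y n c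
    using Zs(1)[of n] that by (auto simp: partial_lift_def csubspace_def)
  have bd: "norm (Zs n x) \<le> \<rho> * norm x" "V.A i (Zs n x) = Zs n (W.A i x)" if "x \<in> En n" for x n i
    using Zs(1)[of n] that by (auto simp: partial_lift_def)
  have D: "csubspace D"
    unfolding csubspace_def
  proof (intro conjI ballI allI)
    show "0 \<in> D" using Zs(1)[of 0] by (auto simp: partial_lift_def csubspace_def D_def)
    show "x + y \<in> D" if "x \<in> D" "y \<in> D" for x y using common[OF that] lin(1) by (auto simp: D_def)
    show "c *\<^sub>C x \<in> D" if "x \<in> D" for c x
      using that unfolding D_def by (blast intro: lin(2))
  qed
  have ZD: "Z0 (x + y) = Z0 x + Z0 y" if "x \<in> D" "y \<in> D" for x y
    using common[OF that] lin(1,3) Z0 by metis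
  have ZD2: "Z0 (c *\<^sub>C x) = c *\<^sub>C Z0 x" "norm (Z0 x) \<le> \<rho> * norm x" "V.A i (Z0 x) = Z0 (W.A i x)"
    "W.A i x \<in> D" if x: "x \<in> D" for x c i
  proof -
    obtain n where n: "x \<in> En n" using x by (auto simp: D_def)
    show "Z0 (c *\<^sub>C x) = c *\<^sub>C Z0 x" "norm (Z0 x) \<le> \<rho> * norm x" "V.A i (Z0 x) = Z0 (W.A i x)" "W.A i x \<in> D"
      using Z0[OF n] Z0[OF lin(2)[OF n n, of c]] Z0[OF inv[OF n, of i]] lin(4)[OF n n] bd[OF n] inv[OF n]
      by (auto simp: D_def)
  qed
  obtain Z' where Z': "bounded_clinear Z'" "\<And>x. x \<in> D \<Longrightarrow> Z' x = Z0 x" "\<And>x. norm (Z' x) \<le> \<rho> * norm x"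
    using bounded_extension[OF D \<rho> ZD ZD2(1,2)] by metis
  have nilp: "W.nilp n \<subseteq> En n" for n
  proof (induction n)
    case 0 show ?case using Zs(1)[of 0] by (simp add: W.nilp_def En_def partial_lift_def csubspace_def)
  next
    case (Suc n) then show ?case using W.pre_mono[OF Suc] by (simp add: W.nilp_def En_def)
  qed
  have totD: "ctotal D" by (rule total_mono[OF pure]) (use nilp in \<open>auto simp: D_def\<close>)
  have "(\<lambda>x. V.A i (Z' x)) = (\<lambda>x. Z' (W.A i x))" for i
  proof (rule bounded_clinear_eq_on_total[OF _ _ totD])
    show "bounded_clinear (\<lambda>x. V.A i (Z' x))" by (rule bounded_clinear_comp[OF V.A_bounded Z'(1)])
    show "bounded_clinear (\<lambda>x. Z' (W.A i x))" by (rule bounded_clinear_comp[OF Z'(1) W.A_bounded])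
    show "V.A i (Z' x) = Z' (W.A i x)" if "x \<in> D" for x
      using ZD2(3,4)[OF that] Z'(2)[OF that] Z'(2) by metis
  qed
  then have "V.A i (Z' x) = Z' (W.A i x)" for i x by meson
  moreover have "Z' x = Z x" if "x \<in> E" for x
  proof -
    have "x \<in> En 0" using that by (simp add: En_def)
    then show ?thesis using Z0[of x 0] Z'(2)[of x] Zs(2) by (auto simp: D_def)
  qed
  ultimately show ?thesis using Z' that by blast
qed

end

section \<open>Tensor products of operators with the identity\<close>

definition orthonormal :: "'k::complex_inner set \<Rightarrow> bool" where
  "orthonormal U \<longleftrightarrow> (\<forall>u\<in>U. \<forall>v\<in>U. cinner u v = (if u = v then 1 else 0))"

text \<open>One Gram-Schmidt step that keeps the vectors already present: at most one new unit
  vector is added.\<close>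

lemma orthonormal_extend:
  fixes k :: "'k::complex_inner"
  assumes U: "finite U" "orthonormal U"
  obtains U' c where "finite U'" "orthonormal U'" "U \<subseteq> U'" "k = (\<Sum>u\<in>U'. c u *\<^sub>C u)"
proof -
  define r where "r = k - (\<Sum>u\<in>U. cinner k u *\<^sub>C u)"
  have r: "cinner r v = 0" if v: "v \<in> U" for v
  proof -
    have "(\<Sum>u\<in>U. cinner k u * cinner u v) = (\<Sum>u\<in>U. if u = v then cinner k u else 0)"
      using U(2) v by (intro sum.cong) (auto simp: orthonormal_def)
    then show ?thesis using U(1) v
      by (simp add: r_def cinner.diff_left cinner.sum_left cinner_scaleC_left)
  qed
  show ?thesis
  proof (cases "r = 0")
    case True
    then show ?thesis using that[of U "\<lambda>u. cinner k u"] U by (simp add: r_def)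
  next
    case False
    define v where "v = of_real (1 / norm r) *\<^sub>C r"
    have vu: "cinner v u = 0" "cinner u v = 0" if "u \<in> U" for u
      using r[OF that] cinner_zero_commute[of r u]
      by (simp_all add: v_def cinner_scaleC_left cinner_scaleC_right)
    have vv: "cinner v v = 1"
      using False by (simp add: cinner_self norm_divide v_def)
    then have nv: "v \<notin> U" using vu(1)[of v] by auto
    have rv: "r = of_real (norm r) *\<^sub>C v" using False by (simp add: v_def scaleC_scaleC)
    show ?thesis
    proof (rule that[of "insert v U" "\<lambda>u. if u = v then of_real (norm r) else cinner k u"])
      show "orthonormal (insert v U)" using U(2) vu vv by (auto simp: orthonormal_def)
      have "(\<Sum>u\<in>insert v U. (if u = v then of_real (norm r) else cinner k u) *\<^sub>C u) =
          r + (\<Sum>u\<in>U. (if u = v then of_real (norm r) else cinner k u) *\<^sub>C u)"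
        using nv U(1) rv by simp
      also have "(\<Sum>u\<in>U. (if u = v then of_real (norm r) else cinner k u) *\<^sub>C u) = (\<Sum>u\<in>U. cinner k u *\<^sub>C u)"
        using nv by (intro sum.cong) auto
      finally show "k = (\<Sum>u\<in>insert v U. (if u = v then of_real (norm r) else cinner k u) *\<^sub>C u)"
        by (simp add: r_def)
    qed (use U in auto)
  qed
qed

locale tensor =
  fixes t :: "'h::chilbert_space \<Rightarrow> 'k::chilbert_space \<Rightarrow> 't::chilbert_space"
  assumes hilbert_tensor: "hilbert_tensor t"
begin

lemma t_add_right: "t x (k + l) = t x k + t x l"
  and t_scale_right: "t x (c *\<^sub>C k) = c *\<^sub>C t x k"
  and t_add_left: "t (x + y) k = t x k + t y k"
  and t_scale_left: "t (c *\<^sub>C x) k = c *\<^sub>C t x k"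
  and t_cinner: "cinner (t x k) (t y l) = cinner x y * cinner k l"
  using hilbert_tensor by (auto simp: hilbert_tensor_def clinear_def)

lemma t_zero_left [simp]: "t 0 k = 0"
  using t_scale_left[of 0 0 k] by simp

lemma t_diff_left: "t (x - y) k = t x k - t y k"
  using t_add_left[of x "(- 1) *\<^sub>C y" k] t_scale_left[of "- 1" y k] by (simp add: scaleC_minus1)

lemma t_sum_right: "t x (\<Sum>i\<in>I. g i) = (\<Sum>i\<in>I. t x (g i))"
  using t_scale_right[of x 0 0]
  by (induction I rule: infinite_finite_induct) (auto simp: t_add_right)

lemma norm_t: "norm (t x k) = norm x * norm k"
proof -
  have "complex_of_real ((norm (t x k))\<^sup>2) = complex_of_real ((norm x * norm k)\<^sup>2)"
    using t_cinner[of x k x k] by (simp only: cinner_self of_real_mult power_mult_distrib)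
  then have "(norm (t x k))\<^sup>2 = (norm x * norm k)\<^sup>2" by (simp only: of_real_eq_iff)
  then show ?thesis by (simp add: power2_eq_iff_nonneg)
qed

lemma dense_t: "closure (cspan {t x k | x k. True}) = UNIV"
  using hilbert_tensor by (simp add: hilbert_tensor_def)

lemma total_t: "ctotal {t x k | x k. True}"
  by (rule dense_imp_total[OF dense_t])

text \<open>For fixed \<open>v\<close> and \<open>k\<close>, the functional
  \<open>cinner (t x k) v\<close> of \<open>x\<close> is represented by a vector orthogonal to
  \<open>G\<close>, hence is 0. So \<open>v\<close> is orthogonal to all elementary tensors.\<close>

lemma total_t_basis:
  assumes "ctotal G"
  shows "ctotal {t x k | x k. x \<in> G}"
proof (rule totalI)
  fix v assume v: "\<And>s. s \<in> {t x k | x k. x \<in> G} \<Longrightarrow> cinner v s = 0"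
  have "cinner v (t x k) = 0" for x k
  proof -
    have "\<exists>z. \<forall>x. cinner (t x k) v = cinner x z"
    proof (rule riesz)
      show "cmod (cinner (t x k) v) \<le> (norm k * norm v) * norm x" for x
        using cinner_Cauchy_Schwarz[of "t x k" v] by (simp add: norm_t mult_ac)
    qed (simp_all add: t_add_left t_scale_left cinner_add_left cinner_scaleC_left)
    then obtain z where z: "\<And>x. cinner (t x k) v = cinner x z" by blast
    have "z = 0"
    proof (rule totalD[OF assms])
      fix g assume "g \<in> G"
      then have "cinner (t g k) v = 0" using v cinner_zero_commute by blast
      then show "cinner z g = 0" by (subst cinner_zero_commute) (simp add: z)
    qed
    then have "cinner (t x k) v = 0" using z by (simp add: cinner.zero_right)
    then show ?thesis by (subst cinner_zero_commute)
  qed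
  then show "v = 0" by (intro totalD[OF total_t]) auto
qed

text \<open>Lists represent algebraic tensors, so that the action of \<open>A\<close> on the left
  factors can be written down before it is known to depend only on the vector represented.\<close>

definition comb :: "('h \<Rightarrow> 'h) \<Rightarrow> ('h \<times> 'k) list \<Rightarrow> 't" where
  "comb A ps = sum_list (map (\<lambda>(x, k). t (A x) k) ps)"

text \<open>Orthonormalising the right-hand factors reduces the estimate of \<open>A \<otimes> I\<close> to one of \<open>A\<close>.\<close>

lemma comb_orthonormal:
  "\<exists>U y. finite U \<and> orthonormal U \<and> (\<forall>A. clinear A \<longrightarrow> comb A ps = (\<Sum>u\<in>U. t (A (y u)) u))"
proof (induction ps)
  case Nil
  then show ?case by (intro exI[of _ "{}"]) (auto simp: comb_def orthonormal_def)
next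
  case (Cons p ps)
  obtain x k where p: "p = (x, k)" by (cases p)
  obtain U y where U: "finite U" "orthonormal U"
    "\<And>A. clinear A \<Longrightarrow> comb A ps = (\<Sum>u\<in>U. t (A (y u)) u)" using Cons by blast
  obtain U' c where U': "finite U'" "orthonormal U'" "U \<subseteq> U'" "k = (\<Sum>u\<in>U'. c u *\<^sub>C u)"
    using orthonormal_extend[OF U(1,2)] by blast
  define y' where "y' u = (if u \<in> U then y u else 0) + c u *\<^sub>C x" for u
  have "comb A (p # ps) = (\<Sum>u\<in>U'. t (A (y' u)) u)" if A: "clinear A" for A
  proof -
    have A_lin: "A (x + y) = A x + A y" "A (c *\<^sub>C x) = c *\<^sub>C A x" for x y c
      using A by (auto simp: clinear_def)
    have A0: "A 0 = 0" using A_lin(2)[of 0 0] by simp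
    have "(\<Sum>u\<in>U'. t (A (y' u)) u) =
        (\<Sum>u\<in>U'. t (A (if u \<in> U then y u else 0)) u) + (\<Sum>u\<in>U'. t (A x) (c u *\<^sub>C u))"
      by (simp add: y'_def A_lin t_add_left t_scale_left t_scale_right sum.distrib)
    also have "(\<Sum>u\<in>U'. t (A x) (c u *\<^sub>C u)) = t (A x) k" by (simp only: U'(4) t_sum_right)
    also have "(\<Sum>u\<in>U'. t (A (if u \<in> U then y u else 0)) u) = (\<Sum>u\<in>U. t (A (y u)) u)"
      using U' by (intro sum.mono_neutral_cong_right) (auto simp: A0)
    finally show ?thesis by (simp add: p comb_def flip: U(3)[OF A])
  qed
  then show ?case using U' by blast
qed

text \<open>In \<open>comb_orthonormal\<close> the same \<open>U\<close> and \<open>y\<close> serve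
  for \<open>A\<close> and for the identity. So both squared norms are sums over the same
  orthonormal right-hand factors and can be compared term by term.\<close>

lemma norm_comb_le:
  assumes A: "bounded_clinear A" "\<And>x. norm (A x) \<le> B * norm x" and B: "0 \<le> B"
  shows "norm (comb A ps) \<le> B * norm (comb (\<lambda>x. x) ps)"
proof -
  obtain U y where U: "finite U" "orthonormal U"
    "\<And>A. clinear A \<Longrightarrow> comb A ps = (\<Sum>u\<in>U. t (A (y u)) u)" using comb_orthonormal[of ps] by blast
  have sq: "(norm (\<Sum>u\<in>U. t (w u) u))\<^sup>2 = (\<Sum>u\<in>U. (norm (w u))\<^sup>2)" for w
  proof -
    have "cinner (\<Sum>u\<in>U. t (w u) u) (\<Sum>v\<in>U. t (w v) v) =
        (\<Sum>u\<in>U. \<Sum>v\<in>U. if v = u then cinner (w u) (w u) else 0)"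
      unfolding cinner.sum_left cinner.sum_right t_cinner
      using U(2) by (intro sum.cong) (auto simp: orthonormal_def)
    also have "\<dots> = (\<Sum>u\<in>U. cinner (w u) (w u))" using U(1) by simp
    finally have "complex_of_real ((norm (\<Sum>u\<in>U. t (w u) u))\<^sup>2) = complex_of_real (\<Sum>u\<in>U. (norm (w u))\<^sup>2)"
      by (simp only: cinner_self of_real_sum)
    then show ?thesis by (simp only: of_real_eq_iff)
  qed
  have "(norm (comb A ps))\<^sup>2 = (\<Sum>u\<in>U. (norm (A (y u)))\<^sup>2)"
    using U(3)[of A] A(1) by (simp add: sq bounded_clinear_def)
  also have "\<dots> \<le> (\<Sum>u\<in>U. (B * norm (y u))\<^sup>2)" by (intro sum_mono power_mono A) simp
  also have "\<dots> = (B * norm (comb (\<lambda>x. x) ps))\<^sup>2"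
    using U(3)[of "\<lambda>x. x"] by (simp add: sq clinear_def power_mult_distrib sum_distrib_left)
  finally show ?thesis using B by (simp add: power2_le_iff_abs_le)
qed

lemma comb_append: "comb A (ps @ qs) = comb A ps + comb A qs"
  by (simp add: comb_def)

lemma comb_scale:
  assumes "clinear A"
  shows "comb A (map (\<lambda>(x, k). (c *\<^sub>C x, k)) ps) = c *\<^sub>C comb A ps"
  using assms by (induction ps) (auto simp: comb_def clinear_def t_scale_left scaleC_add_right)

lemma tensor_extension:
  assumes A: "bounded_clinear A" and bd: "\<And>x. norm (A x) \<le> B * norm x" and B: "0 \<le> B"
  obtains T where "bounded_clinear T" "\<And>x k. T (t x k) = t (A x) k" "\<And>x. norm (T x) \<le> B * norm x"
proof -
  define E where "E = range (comb (\<lambda>x. x))"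
  have lin: "clinear A" "clinear (\<lambda>x :: 'h. x)" using A by (auto simp: bounded_clinear_def clinear_def)
  have wd: "comb A ps = comb A qs" if "comb (\<lambda>x. x) ps = comb (\<lambda>x. x) qs" for ps qs
  proof -
    \<comment> \<open>A list for the difference of the two representations: it represents 0, so the
      norm estimate makes its image 0 as well.\<close>
    let ?r = "ps @ map (\<lambda>(x, k). ((- 1) *\<^sub>C x, k)) qs"
    have "comb A' ?r = comb A' ps - comb A' qs" if "clinear A'" for A'
      using comb_scale[OF that, of "- 1" qs] by (simp add: comb_append scaleC_minus1)
    from this[OF lin(1)] this[OF lin(2)] norm_comb_le[OF A bd B, of ?r] that show ?thesis by simp
  qed
  define z where "z v = comb A (SOME ps. v = comb (\<lambda>x. x) ps)" for v
  have z: "z (comb (\<lambda>x. x) ps) = comb A ps" for ps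
  proof -
    have "comb (\<lambda>x. x) ps = comb (\<lambda>x. x) (SOME qs. comb (\<lambda>x. x) ps = comb (\<lambda>x. x) qs)"
      by (rule someI[of _ ps]) simp
    then show ?thesis unfolding z_def by (rule wd[symmetric])
  qed
  have E: "csubspace E"
    unfolding csubspace_def
  proof (intro conjI ballI allI)
    show "0 \<in> E" unfolding E_def by (rule range_eqI[of _ _ "[]"]) (simp add: comb_def)
    show "v + w \<in> E" if "v \<in> E" "w \<in> E" for v w
      using that unfolding E_def by (auto simp: comb_append[symmetric])
    show "c *\<^sub>C v \<in> E" if "v \<in> E" for c v
      using that unfolding E_def by (auto simp: comb_scale[OF lin(2), symmetric])
  qed
  have zadd: "z (v + w) = z v + z w" if "v \<in> E" "w \<in> E" for v w
    using that unfolding E_def by (auto simp: z comb_append[symmetric])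
  have zscale: "z (c *\<^sub>C v) = c *\<^sub>C z v" if "v \<in> E" for c v
    using that unfolding E_def by (auto simp: z comb_scale[OF lin(2), symmetric] comb_scale[OF lin(1)])
  have zbd: "norm (z v) \<le> B * norm v" if "v \<in> E" for v
    using that norm_comb_le[OF A bd B] unfolding E_def by (auto simp: z)
  have elem: "t x k \<in> E" "z (t x k) = t (A x) k" for x k
    using z[of "[(x, k)]"] unfolding E_def by (auto simp: comb_def intro!: range_eqI[of _ _ "[(x, k)]"])
  show ?thesis
  proof (rule bounded_extension[OF E B zadd zscale zbd])
    fix T :: "'t \<Rightarrow> 't"
    assume "bounded_clinear T" "\<And>x. x \<in> E \<Longrightarrow> T x = z x" "\<And>x. norm (T x) \<le> B * norm x"
    then show thesis by (intro that[of T]) (simp_all add: elem)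
  qed
qed

lemma tensor_eqI:
  fixes T T' :: "'t \<Rightarrow> 'c::complex_inner"
  assumes "bounded_clinear T" "bounded_clinear T'" "\<And>x k. T (t x k) = T' (t x k)"
  shows "T = T'"
  by (rule bounded_clinear_eq_on_total[OF assms(1,2) total_t]) (auto simp: assms(3))

lemma tensor_id_eqI:
  assumes "bounded_clinear T" "\<And>x k. T (t x k) = t (A x) k"
  shows "tensor_id t A = T"
  unfolding tensor_id_def
  by (rule the_equality) (auto simp: assms intro!: tensor_eqI)

context
  fixes A :: "'h \<Rightarrow> 'h" assumes A: "bounded_clinear A"
begin

lemma tensor_id_bounded: "bounded_clinear (tensor_id t A)"
  and tensor_id_t: "tensor_id t A (t x k) = t (A x) k"
  and norm_tensor_id_le: "(\<And>x. norm (A x) \<le> B * norm x) \<Longrightarrow> 0 \<le> B \<Longrightarrow> norm (tensor_id t A v) \<le> B * norm v"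
proof -
  obtain T where T: "bounded_clinear T" "\<And>x k. T (t x k) = t (A x) k"
    using tensor_extension[OF A bounded_clinear_onorm[OF A] bounded_clinear_onorm_nonneg[OF A]] by metis
  then show "bounded_clinear (tensor_id t A)" "tensor_id t A (t x k) = t (A x) k"
    using tensor_id_eqI[OF T] by auto
  assume bd: "\<And>x. norm (A x) \<le> B * norm x" and B: "0 \<le> B"
  show "norm (tensor_id t A v) \<le> B * norm v"
  proof (rule tensor_extension[OF A bd B])
    fix T assume "bounded_clinear T" "\<And>x k. T (t x k) = t (A x) k" "\<And>x. norm (T x) \<le> B * norm x"
    then show ?thesis using tensor_id_eqI by metis
  qed
qed

end

lemma tensor_id_ident: "tensor_id t (\<lambda>x. x) = (\<lambda>x. x)"
  by (rule tensor_id_eqI) auto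

lemma
  assumes A: "bounded_clinear A" and B: "bounded_clinear B"
  shows tensor_id_comp: "tensor_id t (\<lambda>x. A (B x)) = (\<lambda>x. tensor_id t A (tensor_id t B x))"
    and tensor_id_plus: "tensor_id t (\<lambda>x. A x + B x) = (\<lambda>x. tensor_id t A x + tensor_id t B x)"
    and tensor_id_scaleC: "tensor_id t (\<lambda>x. c *\<^sub>C A x) = (\<lambda>x. c *\<^sub>C tensor_id t A x)"
  by (rule tensor_id_eqI; simp add: assms bounded_clinear_comp bounded_clinear_plus
      bounded_clinear_scaleC_fun tensor_id_bounded tensor_id_t t_add_left t_scale_left)+

text \<open>The vectors at which convergence holds form a subspace that contains the elementary
  tensors, hence is dense. The uniform bound then gives convergence everywhere.\<close>

lemma tensor_id_tendsto:
  assumes An: "\<And>n. bounded_clinear (An n)" and A: "bounded_clinear A"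
    and bd: "\<And>n x. norm (An n x) \<le> B * norm x" and B: "0 \<le> B"
    and lim: "\<And>x. (\<lambda>n. An n x) \<longlonglongrightarrow> A x"
  shows "(\<lambda>n. tensor_id t (An n) v) \<longlonglongrightarrow> tensor_id t A v"
proof -
  let ?D = "\<lambda>n v. tensor_id t (An n) v - tensor_id t A v"
  define C where "C = {v. (\<lambda>n. ?D n v) \<longlonglongrightarrow> 0}"
  have bdA: "norm (A x) \<le> B * norm x" for x
    by (rule LIMSEQ_le_const2[OF tendsto_norm[OF lim]]) (use bd in auto)
  have D_bd: "norm (?D n v) \<le> 2 * B * norm v" for n v
    using norm_triangle_ineq4[of "tensor_id t (An n) v" "tensor_id t A v"]
      norm_tensor_id_le[OF An bd B, of n v] norm_tensor_id_le[OF A bdA B, of v] by simp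
  have D_lin: "?D n (v + w) = ?D n v + ?D n w" "?D n (c *\<^sub>C v) = c *\<^sub>C ?D n v"
    "?D n (v - w) = ?D n v - ?D n w" for n v w c
    by (simp_all add: bounded_clinear_add[OF tensor_id_bounded] bounded_clinear_scaleC[OF tensor_id_bounded]
        bounded_clinear_diff[OF tensor_id_bounded] An A scaleC_diff_right)
  have C: "csubspace C"
    unfolding csubspace_def
  proof (intro conjI ballI allI)
    show "0 \<in> C" using bounded_clinear_zero[OF tensor_id_bounded] An A by (simp add: C_def)
    show "v + w \<in> C" if "v \<in> C" "w \<in> C" for v w
      using that tendsto_add[of "\<lambda>n. ?D n v" 0 sequentially "\<lambda>n. ?D n w" 0] unfolding C_def mem_Collect_eq D_lin by simp
    show "c *\<^sub>C v \<in> C" if "v \<in> C" for c v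
      using that bounded_clinear_tendsto[OF bounded_clinear_scaleC_fun[OF bounded_clinear_id], of "\<lambda>n. ?D n v" 0 sequentially c]
      unfolding C_def mem_Collect_eq D_lin by simp
  qed
  have elem: "t x k \<in> C" for x k
  proof -
    have "(\<lambda>n. norm (An n x - A x) * norm k) \<longlonglongrightarrow> 0 * norm k"
      using lim[of x] by (intro tendsto_mult tendsto_const) (simp add: LIM_zero tendsto_norm_zero)
    then have "(\<lambda>n. norm (?D n (t x k))) \<longlonglongrightarrow> 0"
      by (simp add: tensor_id_t An A norm_t flip: t_diff_left)
    then show ?thesis unfolding C_def mem_Collect_eq by (rule tendsto_norm_zero_cancel)
  qed
  have "cspan {t x k | x k. True} \<subseteq> C" using elem by (intro cspan_minimal C) auto
  then have dense: "closure C = UNIV" using dense_t closure_mono by blast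
  have "v \<in> C"
    unfolding C_def mem_Collect_eq
  proof (rule metric_LIMSEQ_I)
    fix \<epsilon> :: real assume "\<epsilon> > 0"
    \<comment> \<open>\<open>2 * B\<close> bounds the operators \<open>?D n\<close>, and the added 1
      keeps the denominator positive if \<open>B = 0\<close>.\<close>
    define \<delta> where "\<delta> = \<epsilon> / (2 * (2 * B + 1))"
    have "\<delta> > 0" using \<open>\<epsilon> > 0\<close> B by (simp add: \<delta>_def)
    then obtain w where w: "w \<in> C" "dist w v < \<delta>"
      using dense closure_approachable[of v C] by auto
    have "\<exists>N. \<forall>n\<ge>N. norm (?D n w - 0) < \<epsilon> / 2"
      by (rule LIMSEQ_D) (use w(1) \<open>\<epsilon> > 0\<close> in \<open>auto simp: C_def\<close>)
    then obtain N where N: "\<And>n. n \<ge> N \<Longrightarrow> norm (?D n w) < \<epsilon> / 2" by auto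
    have "dist (?D n v) 0 < \<epsilon>" if "n \<ge> N" for n
    proof -
      have "norm (?D n (v - w)) \<le> 2 * B * norm (v - w)" by (rule D_bd)
      also have "\<dots> \<le> (2 * B + 1) * \<delta>"
        using w(2) B by (intro mult_mono) (auto simp: dist_norm norm_minus_commute)
      also have "\<dots> = \<epsilon> / 2" using B by (simp add: \<delta>_def field_simps)
      finally have "norm (?D n v - ?D n w) \<le> \<epsilon> / 2" by (simp only: D_lin)
      then show ?thesis
        using N[OF that] norm_triangle_sub[of "?D n v" "?D n w"] by simp
    qed
    then show "\<exists>N. \<forall>n\<ge>N. dist (?D n v) 0 < \<epsilon>" by blast
  qed
  then show ?thesis by (simp add: C_def LIM_zero_iff)
qed

end

text \<open>Banach-Steinhaus: the closed sets \<open>F m\<close> cover the complete space, so by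
  Baire one of them contains a ball.\<close>

lemma uniform_boundedness:
  fixes T :: "nat \<Rightarrow> 'a::chilbert_space \<Rightarrow> 'b::complex_inner"
  assumes T: "\<And>n. bounded_clinear (T n)" and conv: "\<And>x. convergent (\<lambda>n. T n x)"
  obtains B where "0 \<le> B" "\<And>n x. norm (T n x) \<le> B * norm x"
proof -
  define F where "F m = {x. \<forall>n. norm (T n x) \<le> real m}" for m
  have clF: "closed (F m)" for m
  proof -
    have "F m = (\<Inter>n. {x. norm (T n x) \<le> real m})" by (auto simp: F_def)
    moreover have "closed {x. norm (T n x) \<le> real m}" for n
      by (intro closed_Collect_le continuous_on_norm linear_continuous_on continuous_on_const
          bounded_clinear_bounded_linear T)
    ultimately show ?thesis by auto
  qed
  have "(\<Union>m. F m) = UNIV"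
  proof (intro set_eqI iffI UNIV_I)
    fix x
    obtain K where K: "\<And>n. norm (T n x) \<le> K"
      using convergent_imp_Bseq[OF conv[of x]] by (auto simp: Bseq_def)
    obtain m where "K \<le> real m" using real_arch_simple by blast
    then have "x \<in> F m" using K order_trans by (auto simp: F_def)
    then show "x \<in> (\<Union>m. F m)" by blast
  qed
  moreover have "(euclidean :: 'a topology) interior_of (\<Union>(range F)) = {}"
    if "\<And>m. interior (F m) = {}"
    by (rule Baire_category_alt) (use that clF in \<open>auto simp: completely_metrizable_space_euclidean\<close>)
  ultimately obtain m x0 where "x0 \<in> interior (F m)" by auto
  then obtain r where r: "r > 0" "cball x0 r \<subseteq> F m" using mem_interior_cball by blast
  \<comment> \<open>The points \<open>x0\<close> and \<open>x0 + s *\<^sub>R x\<close> of the ball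
    are at distance \<open>r\<close>, and \<open>T n\<close> is bounded by \<open>m\<close> at
    both.\<close>
  define B where "B = 2 * real m / r"
  have "norm (T n x) \<le> B * norm x" for n x
  proof (cases "x = 0")
    case True
    then show ?thesis by (simp add: bounded_clinear_zero[OF T])
  next
    case False
    define s where "s = r / norm x"
    have s: "s > 0" using False r by (simp add: s_def)
    have "x0 + s *\<^sub>R x \<in> F m" "x0 \<in> F m" using r s False by (auto simp: s_def dist_norm intro!: subsetD[OF r(2)])
    then have "norm (T n (x0 + s *\<^sub>R x) - T n x0) \<le> 2 * real m"
      using norm_triangle_ineq4[of "T n (x0 + s *\<^sub>R x)" "T n x0"] by (auto simp: F_def) (smt (verit, best))
    moreover have "T n (x0 + s *\<^sub>R x) - T n x0 = s *\<^sub>R T n x"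
      using bounded_clinear_bounded_linear[OF T, of n]
      by (simp add: bounded_clinear_add[OF T] linear_cmul bounded_linear.linear)
    ultimately have "s * norm (T n x) \<le> 2 * real m" using s by simp
    then show ?thesis using False r by (simp add: s_def B_def field_simps)
  qed
  moreover have "0 \<le> B" using r by (simp add: B_def)
  ultimately show ?thesis using that by blast
qed

text \<open>Moving \<open>R\<close> to the other side turns the identity into an equality of two
  operators, which can be tested on \<open>G\<close>.\<close>

lemma cinner_eq_on_total:
  fixes P R :: "'a::chilbert_space \<Rightarrow> 'b::chilbert_space" and T :: "'a \<Rightarrow> 'a"
  assumes "bounded_clinear P" "bounded_clinear R" "bounded_clinear T" and G: "ctotal G"
    and eq: "\<And>g h. g \<in> G \<Longrightarrow> h \<in> G \<Longrightarrow> cinner (P g) (R h) = cinner (T g) h"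
  shows "cinner (P x) (R y) = cinner (T x) y"
proof -
  have "(\<lambda>x. cadj R (P x)) = T"
  proof (rule bounded_clinear_eq_on_total[OF _ assms(3) G])
    show "bounded_clinear (\<lambda>x. cadj R (P x))"
      by (intro bounded_clinear_comp[OF bounded_clinear_cadj] assms)
    fix g assume g: "g \<in> G"
    have "cadj R (P g) - T g = 0"
      by (rule totalD[OF G])
        (simp add: cinner.diff_left cinner_cadj'[OF assms(2)] eq[OF g])
    then show "cadj R (P g) = T g" by simp
  qed
  then have "cadj R (P x) = T x" by meson
  then show ?thesis using cinner_cadj'[OF assms(2), of "P x" y] by simp
qed

section \<open>Operators generated by the universal model\<close>

text \<open>Limits may be nested because the radial calculus takes a strong limit, as
  \<open>r\<close> tends to 1, of operators that are themselves limits of polynomials. A relation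
  preserved by these rules passes from \<open>M\<close> to multiplication by
  \<open>f\<^sub>j\<close>.\<close>

inductive_set opalg :: "('n \<Rightarrow> 'h::chilbert_space \<Rightarrow> 'h) \<Rightarrow> ('h \<Rightarrow> 'h) set"
  for M :: "'n \<Rightarrow> 'h::chilbert_space \<Rightarrow> 'h" where
  ident: "(\<lambda>x. x) \<in> opalg M"
| mult: "T \<in> opalg M \<Longrightarrow> (\<lambda>x. M i (T x)) \<in> opalg M"
| plus: "S \<in> opalg M \<Longrightarrow> T \<in> opalg M \<Longrightarrow> (\<lambda>x. S x + T x) \<in> opalg M"
| scale: "T \<in> opalg M \<Longrightarrow> (\<lambda>x. c *\<^sub>C T x) \<in> opalg M"
| limit: "(\<And>n. T n \<in> opalg M) \<Longrightarrow> bounded_clinear L \<Longrightarrow> (\<And>v. (\<lambda>n :: nat. T n v) \<longlonglongrightarrow> L v) \<Longrightarrow>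
    L \<in> opalg M"

lemma opalg_bounded:
  assumes "T \<in> opalg M" "\<And>i. bounded_clinear (M i)"
  shows "bounded_clinear T"
  using assms
  by (induction rule: opalg.induct)
    (auto intro: bounded_clinear_comp bounded_clinear_plus bounded_clinear_scaleC_fun)

lemma bounded_clinear_if_zero: "bounded_clinear (\<lambda>x. if P then x else 0)"
  by (cases P) (auto simp: bounded_clinear_id bounded_clinear_const_zero)

lemma opalg_setsum: "(\<And>i. i \<in> I \<Longrightarrow> T i \<in> opalg M) \<Longrightarrow> (\<lambda>x. \<Sum>i\<in>I. T i x) \<in> opalg M"
proof (induction I rule: infinite_finite_induct)
  case (insert i I)
  then show ?case using opalg.plus[of "T i" M "\<lambda>x. \<Sum>i\<in>I. T i x"] by simp
qed (use opalg.scale[OF opalg.ident, of 0 M] in auto)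

lemma (in tensor) tensor_id_limit:
  assumes "\<And>n. bounded_clinear (T n)" "bounded_clinear L" "\<And>v. (\<lambda>n :: nat. T n v) \<longlonglongrightarrow> L v"
  shows "(\<lambda>n. tensor_id t (T n) v) \<longlonglongrightarrow> tensor_id t L v"
proof -
  have "convergent (\<lambda>n. T n x)" for x using assms(3) by (auto simp: convergent_def)
  then show ?thesis
  proof (rule uniform_boundedness[OF assms(1)])
    fix B assume "0 \<le> B" "\<And>n x. norm (T n x) \<le> B * norm x"
    then show ?thesis by (intro tensor_id_tendsto[OF assms(1,2) _ _ assms(3)])
  qed
qed

text \<open>Co-invariance is used as invariance of the orthogonal complement: in this form it
  survives products and sums, and also strong limits, since the complement is closed.\<close>

lemma (in tensor) opalg_ortho:
  assumes T: "T \<in> opalg M" and M: "\<And>i. bounded_clinear (M i)"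
    and inv: "\<And>i x. x \<in> ortho E \<Longrightarrow> tensor_id t (M i) x \<in> ortho E"
  shows "x \<in> ortho E \<Longrightarrow> tensor_id t T x \<in> ortho E"
  using T
proof (induction arbitrary: x rule: opalg.induct)
  case ident
  then show ?case by (simp add: tensor_id_ident)
next
  case (mult T i)
  then show ?case using opalg_bounded[OF mult.hyps M] by (simp add: tensor_id_comp M inv)
next
  case (plus S T)
  then show ?case using opalg_bounded[OF plus.hyps(1) M] opalg_bounded[OF plus.hyps(2) M]
    by (simp add: tensor_id_plus csubspace_add[OF csubspace_ortho])
next
  case (scale T c)
  then show ?case using opalg_bounded[OF scale.hyps M]
    by (simp add: tensor_id_scaleC[OF _ bounded_clinear_id] csubspace_scaleC[OF csubspace_ortho])
next
  case (limit T L)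
  show ?case
  proof (rule closed_sequentially[OF closed_ortho])
    show "(\<lambda>n. tensor_id t (T n) x) \<longlonglongrightarrow> tensor_id t L x"
      by (intro tensor_id_limit limit.hyps opalg_bounded[OF limit.hyps(1) M])
  qed (use limit in auto)
qed

text \<open>A relation between compressions to \<open>E\<close> is an intertwining relation modulo
  \<open>ortho E\<close>.\<close>

lemma opalg_intertwine:
  fixes t1 :: "'h::chilbert_space \<Rightarrow> 'k1::chilbert_space \<Rightarrow> 't1::chilbert_space"
    and t2 :: "'h \<Rightarrow> 'k2::chilbert_space \<Rightarrow> 't2::chilbert_space"
  assumes t: "tensor t1" "tensor t2"
    and T: "T \<in> opalg M" and M: "\<And>i. bounded_clinear (M i)" and X: "bounded_clinear X"
    and inv: "\<And>i x. x \<in> ortho E \<Longrightarrow> tensor_id t2 (M i) x \<in> ortho E"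
    and twine: "\<And>i x. X (tensor_id t1 (M i) x) - tensor_id t2 (M i) (X x) \<in> ortho E"
  shows "X (tensor_id t1 T x) - tensor_id t2 T (X x) \<in> ortho E"
proof -
  interpret t1: tensor t1 by (rule t)
  interpret t2: tensor t2 by (rule t)
  have bd: "bounded_clinear T" if "T \<in> opalg M" for T
    by (rule opalg_bounded[OF that M])
  note O = csubspace_add[OF csubspace_ortho] csubspace_scaleC[OF csubspace_ortho]
  show ?thesis
    using T
  proof (induction arbitrary: x rule: opalg.induct)
    case ident
    then show ?case by (simp add: t1.tensor_id_ident t2.tensor_id_ident csubspace_0[OF csubspace_ortho])
  next
    case (mult T i)
    have T: "bounded_clinear T" by (rule opalg_bounded[OF mult.hyps M])
    let ?d = "X (tensor_id t1 T x) - tensor_id t2 T (X x)"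
    \<comment> \<open>The commutator rule
      \<open>X M T - M T X = (X M - M X) T + M (X T - T X)\<close>; its last term is why
      \<open>ortho E\<close> has to be invariant under \<open>M\<close>.\<close>
    have "X (tensor_id t1 (M i) (tensor_id t1 T x)) - tensor_id t2 (M i) (X (tensor_id t1 T x))
        + tensor_id t2 (M i) ?d \<in> ortho E"
      by (intro O twine inv mult.IH)
    then show ?case
      by (simp add: t1.tensor_id_comp t2.tensor_id_comp T M bounded_clinear_diff[OF t2.tensor_id_bounded])
  next
    case (plus S T)
    show ?case
      using O(1)[OF plus.IH(1)[of x] plus.IH(2)[of x]]
      by (simp add: t1.tensor_id_plus t2.tensor_id_plus bd plus.hyps bounded_clinear_add[OF X] algebra_simps)
  next
    case (scale T c)
    have "bounded_clinear T" by (rule opalg_bounded[OF scale.hyps M])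
    then show ?case
      using O(2)[OF scale.IH[of x], of c]
      by (simp add: t1.tensor_id_scaleC[OF _ bounded_clinear_id] t2.tensor_id_scaleC[OF _ bounded_clinear_id]
          bounded_clinear_scaleC[OF X] scaleC_diff_right)
  next
    case (limit T L)
    show ?case
    proof (rule closed_sequentially[OF closed_ortho])
      show "(\<lambda>n. X (tensor_id t1 (T n) x) - tensor_id t2 (T n) (X x)) \<longlonglongrightarrow>
          X (tensor_id t1 L x) - tensor_id t2 L (X x)"
        by (intro tendsto_diff bounded_clinear_tendsto[OF X] t1.tensor_id_limit t2.tensor_id_limit
            limit.hyps bd)
    qed (use limit in auto)
  qed
qed

section \<open>Lifting for the universal model\<close>

lemma finite_words: "finite {\<alpha> :: 'n::finite list. length \<alpha> \<le> n}"
  using finite_lists_length_le[of "UNIV :: 'n set" n] by simp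

text \<open>The part of the model property that is used: \<open>e \<alpha>\<close> is \<open>f\<^sub>\<alpha>\<close>, \<open>S j\<close> is left multiplication by
  \<open>f\<^sub>j\<close>, and \<open>a i\<close> is the coefficient family of \<open>Z\<^sub>i\<close>.\<close>

locale fock_model =
  fixes M :: "'n::finite \<Rightarrow> 'h::chilbert_space \<Rightarrow> 'h" and e :: "'n list \<Rightarrow> 'h"
    and S :: "'n \<Rightarrow> 'h \<Rightarrow> 'h" and a :: "'n \<Rightarrow> 'n list \<Rightarrow> complex"
  assumes M_bounded: "bounded_clinear (M i)"
    and e_orth: "cinner (e \<alpha>) (e \<beta>) = (if \<alpha> = \<beta> then 1 else 0)"
    and e_total: "ctotal (range e)"
    and S_opalg: "S j \<in> opalg M"
    and S_e: "S j (e \<alpha>) = e (j # \<alpha>)"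
    and M_e: "length \<gamma> \<le> n \<Longrightarrow>
      cinner (M i (e \<delta>)) (e \<gamma>) = (\<Sum>\<alpha> | length \<alpha> \<le> n. if \<alpha> @ \<delta> = \<gamma> then a i \<alpha> else 0)"
begin

lemma S_bounded: "bounded_clinear (S j)"
  by (rule opalg_bounded[OF S_opalg M_bounded])

lemma S_cinner: "cinner (S i x) (S j y) = (if i = j then cinner x y else 0)"
proof -
  have "cinner (S i x) (S j y) = cinner (if i = j then x else 0) y"
    by (rule cinner_eq_on_total[OF S_bounded S_bounded _ e_total])
      (auto simp: S_e e_orth cinner.zero_left bounded_clinear_if_zero)
  then show ?thesis by (simp add: cinner.zero_left)
qed

end

locale fock_tensor = fock_model M e S a + tensor t
  for M :: "'n::finite \<Rightarrow> 'h::chilbert_space \<Rightarrow> 'h" and e S a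
    and t :: "'h \<Rightarrow> 'k::chilbert_space \<Rightarrow> 't::chilbert_space"
begin

abbreviation V :: "'n \<Rightarrow> 't \<Rightarrow> 't" where "V j \<equiv> tensor_id t (S j)"
abbreviation N :: "'n \<Rightarrow> 't \<Rightarrow> 't" where "N i \<equiv> tensor_id t (M i)"

lemma N_bounded: "bounded_clinear (N i)"
  by (rule tensor_id_bounded[OF M_bounded])

lemma V_t: "V j (t (e \<beta>) k) = t (e (j # \<beta>)) k"
  by (simp add: tensor_id_t[OF S_bounded] S_e)

sublocale row_isometry V
proof
  show bd: "bounded_clinear (V i)" for i by (rule tensor_id_bounded[OF S_bounded])
  show "cinner (V i x) (V j y) = (if i = j then cinner x y else 0)" for i j x y
  proof -
    have "cinner (V i x) (V j y) = cinner (if i = j then x else 0) y"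
      by (rule cinner_eq_on_total[OF bd bd _ total_t])
        (auto simp: tensor_id_t S_bounded t_cinner S_cinner cinner.zero_left bounded_clinear_if_zero)
    then show ?thesis by (simp add: cinner.zero_left)
  qed
qed

lemma total_te: "ctotal {t (e \<beta>) k | \<beta> k. True}"
  by (rule total_mono[OF total_t_basis[OF e_total]]) auto

lemma te_cinner: "cinner (t (e \<alpha>) k) (t (e \<beta>) l) = (if \<alpha> = \<beta> then cinner k l else 0)"
  by (simp add: t_cinner e_orth)

lemma csubspace_nilp: "csubspace (nilp n)"
  by (induction n) (auto simp: nilp_def intro: csubspace_pre, simp add: csubspace_def)

text \<open>\<open>A i\<close> strips a matching first letter and otherwise gives 0. The empty word
  still takes one step to be killed, hence the \<open>Suc\<close>.\<close>

lemma te_nilp: "t (e \<beta>) k \<in> nilp (Suc (length \<beta>))"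
proof (induction \<beta>)
  case Nil
  have "A i (t (e []) k) = 0" for i
    by (rule totalD[OF total_te]) (auto simp: cinner_cadj'[OF V_bounded] V_t te_cinner)
  then show ?case by (simp add: nilp_def pre_def)
next
  case (Cons j \<beta>)
  have "A i (t (e (j # \<beta>)) k) \<in> nilp (Suc (length \<beta>))" for i
    using Cons csubspace_0[OF csubspace_nilp] A_V[of i j "t (e \<beta>) k"] by (simp add: V_t)
  moreover have "nilp (Suc (Suc (length \<beta>))) = pre (nilp (Suc (length \<beta>)))" by (simp add: nilp_def)
  ultimately show ?case by (simp add: pre_def)
qed

lemma pure: "ctotal (\<Union>n. nilp n)"
  by (rule total_mono[OF total_te]) (use te_nilp in blast)

lemma word_op_V_bounded: "bounded_clinear (word_op V \<alpha>)"
  by (induction \<alpha>) (auto simp: id_def comp_def intro: bounded_clinear_comp[OF V_bounded])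

lemma word_op_V_t: "word_op V \<alpha> (t (e \<beta>) k) = t (e (\<alpha> @ \<beta>)) k"
  by (induction \<alpha>) (auto simp: V_t)

text \<open>The vectors of degree at most \<open>n\<close>. Orthogonality to the higher tensors is
  the form that can be checked for values of an adjoint.\<close>

definition low :: "nat \<Rightarrow> 't set" where
  "low n = ortho {t (e \<gamma>) k | \<gamma> k. n < length \<gamma>}"

lemma te_low: "length \<gamma> \<le> n \<Longrightarrow> t (e \<gamma>) k \<in> low n"
  by (auto simp: low_def ortho_def te_cinner)

text \<open>Against vectors of degree at most \<open>n\<close>, the operator \<open>N i\<close> acts as the polynomial
  \<open>\<Sum> a\<^sub>\<alpha> V\<^sub>\<alpha>\<close>, although this series itself need not converge.\<close>

lemma N_low:
  assumes u: "u \<in> low n"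
  shows "cinner (N i x) u = (\<Sum>\<alpha> | length \<alpha> \<le> n. a i \<alpha> * cinner (word_op V \<alpha> x) u)"
proof -
  define L where "L x = N i x - (\<Sum>\<alpha> | length \<alpha> \<le> n. a i \<alpha> *\<^sub>C word_op V \<alpha> x)" for x
  have L: "bounded_clinear L"
    unfolding L_def
    by (intro bounded_clinear_minus N_bounded bounded_clinear_setsum bounded_clinear_scaleC_fun
        word_op_V_bounded)
  have zero: "cinner (L x) (t (e \<gamma>) k) = 0" if \<gamma>: "length \<gamma> \<le> n" for x \<gamma> k
  proof -
    have "cadj L (t (e \<gamma>) k) = 0"
    proof (rule totalD[OF total_te])
      fix s assume "s \<in> {t (e \<beta>) k | \<beta> k. True}"
      then obtain \<delta> l where s: "s = t (e \<delta>) l" by blast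
      have "cinner (L s) (t (e \<gamma>) k) = 0"
        by (simp add: L_def s cinner.diff_left cinner.sum_left cinner_scaleC_left tensor_id_t M_bounded
            t_cinner word_op_V_t M_e[OF \<gamma>] e_orth sum_distrib_right)
          (intro sum.cong, auto)
      then show "cinner (cadj L (t (e \<gamma>) k)) s = 0"
        unfolding cinner_cadj'[OF L] by (subst cinner_zero_commute)
    qed
    then show ?thesis unfolding cinner_cadj[OF L] by (simp add: cinner.zero_right)
  qed
  \<comment> \<open>\<open>L x\<close> has no components of degree at most \<open>n\<close>, and
    \<open>u\<close> has no others.\<close>
  have "cinner u (L x) = 0"
  proof (rule ortho_split)
    show "ctotal ({t (e \<gamma>) k | \<gamma> k. length \<gamma> \<le> n} \<union> {t (e \<gamma>) k | \<gamma> k. n < length \<gamma>})"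
      by (rule total_mono[OF total_te]) (use linorder_not_le in blast)
    show "u \<in> ortho {t (e \<gamma>) k | \<gamma> k. n < length \<gamma>}" using u by (simp add: low_def)
    show "L x \<in> ortho {t (e \<gamma>) k | \<gamma> k. length \<gamma> \<le> n}" using zero by (auto simp: ortho_def)
  qed (auto simp: te_cinner)
  then have "cinner (L x) u = 0" by (subst cinner_zero_commute)
  then show ?thesis
    by (simp add: L_def cinner.diff_left cinner.sum_left cinner_scaleC_left)
qed

end

locale fock_tensor_pair = T1: fock_tensor M e S a t1 + T2: fock_tensor M e S a t2
  for M :: "'n::finite \<Rightarrow> 'h::chilbert_space \<Rightarrow> 'h" and e S a
    and t1 :: "'h \<Rightarrow> 'k1::chilbert_space \<Rightarrow> 't1::chilbert_space"
    and t2 :: "'h \<Rightarrow> 'k2::chilbert_space \<Rightarrow> 't2::chilbert_space"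
begin

text \<open>The adjoint of \<open>Y\<close> does not raise degrees: from a word longer than
  \<open>n\<close> one can split off \<open>n + 1\<close> letters and move them across
  \<open>Y\<close>, and a vector of degree at most \<open>n\<close> is orthogonal to the range of
  the resulting operator. So, tested against a basis tensor, both sides become the same finite sum
  over words in \<open>V\<close>.\<close>

lemma commute_N:
  assumes Y: "bounded_clinear Y" and YV: "\<And>j x. Y (T1.V j x) = T2.V j (Y x)"
  shows "Y (T1.N i x) = T2.N i (Y x)"
proof -
  have Yw: "Y (word_op T1.V \<alpha> x) = word_op T2.V \<alpha> (Y x)" for \<alpha> x
    by (induction \<alpha>) (auto simp: YV)
  have low: "cadj Y y \<in> T1.low n" if y: "y \<in> T2.low n" for y n
    unfolding T1.low_def ortho_def
  proof (clarify)
    fix \<gamma> :: "'n list" and k assume \<gamma>: "n < length \<gamma>"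
    define \<alpha> where "\<alpha> = take (Suc n) \<gamma>"
    have \<alpha>: "length \<alpha> = Suc n" "\<gamma> = \<alpha> @ drop (Suc n) \<gamma>" using \<gamma> by (auto simp: \<alpha>_def)
    have "cadj (word_op T2.V \<alpha>) y = 0"
    proof (rule totalD[OF T2.total_te])
      fix s assume "s \<in> {t2 (e \<beta>) k | \<beta> k. True}"
      then obtain \<delta> l where s: "s = t2 (e \<delta>) l" by blast
      have "word_op T2.V \<alpha> s \<in> {t2 (e \<gamma>) k | \<gamma> k. n < length \<gamma>}"
        using \<alpha>(1) by (auto simp: s T2.word_op_V_t intro!: exI[of _ "\<alpha> @ \<delta>"])
      then show "cinner (cadj (word_op T2.V \<alpha>) y) s = 0"
        using y unfolding cinner_cadj'[OF T2.word_op_V_bounded] T2.low_def ortho_def by blast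
    qed
    then have "cinner y (word_op T2.V \<alpha> z) = 0" for z
      using cinner_cadj'[OF T2.word_op_V_bounded, of \<alpha> y z] by (simp add: cinner.zero_left)
    moreover have "t1 (e \<gamma>) k = word_op T1.V \<alpha> (t1 (e (drop (Suc n) \<gamma>)) k)"
      using \<alpha>(2) by (simp add: T1.word_op_V_t)
    ultimately show "cinner (cadj Y y) (t1 (e \<gamma>) k) = 0"
      by (simp add: cinner_cadj'[OF Y] Yw)
  qed
  have "Y (T1.N i x) - T2.N i (Y x) = 0"
  proof (rule totalD[OF T2.total_te])
    fix s assume "s \<in> {t2 (e \<beta>) k | \<beta> k. True}"
    then obtain \<gamma> l where s: "s = t2 (e \<gamma>) l" by blast
    define n where "n = length \<gamma>"
    have s_low: "s \<in> T2.low n" by (simp add: s n_def T2.te_low)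
    have "cinner (Y (T1.N i x)) s = cinner (T1.N i x) (cadj Y s)" by (rule cinner_cadj[OF Y])
    also have "\<dots> = (\<Sum>\<alpha> | length \<alpha> \<le> n. a i \<alpha> * cinner (word_op T1.V \<alpha> x) (cadj Y s))"
      by (rule T1.N_low[OF low[OF s_low]])
    also have "\<dots> = (\<Sum>\<alpha> | length \<alpha> \<le> n. a i \<alpha> * cinner (word_op T2.V \<alpha> (Y x)) s)"
      by (simp add: cinner_cadj[OF Y, symmetric] Yw)
    also have "\<dots> = cinner (T2.N i (Y x)) s" by (rule T2.N_low[OF s_low, symmetric])
    finally show "cinner (Y (T1.N i x) - T2.N i (Y x)) s = 0" by (simp add: cinner.diff_left)
  qed
  then show ?thesis by simp
qed

text \<open>\<open>X\<close> is first extended by 0 on \<open>ortho E1\<close>. The extension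
  intertwines the \<open>M i\<close> modulo \<open>ortho E2\<close>, and this passes to the
  \<open>V j\<close>; taking adjoints then gives the initial partial lift on
  \<open>E2\<close>.\<close>

theorem lifting:
  assumes E1: "csubspace E1" "closed E1" and co1: "\<And>i. coinvariant (T1.N i) E1"
    and E2: "csubspace E2" "closed E2" and co2: "\<And>i. coinvariant (T2.N i) E2"
    and X: "bounded_op_on E1 E2 X"
    and twine: "\<And>i x. x \<in> E1 \<Longrightarrow> X (proj E1 (T1.N i x)) = proj E2 (T2.N i (X x))"
  shows "\<exists>Y. bounded_clinear Y \<and> (\<forall>i. Y \<circ> T1.N i = T2.N i \<circ> Y) \<and> cadj Y ` E2 \<subseteq> E1 \<and>
    (\<forall>y\<in>E2. cadj Y y = adj_on E1 X y) \<and> onorm Y = onorm_on E1 X"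
proof -
  define \<rho> where "\<rho> = onorm_on E1 X"
  obtain B where B: "\<And>x. x \<in> E1 \<Longrightarrow> norm (X x) \<le> B * norm x"
    using X unfolding bounded_op_on_def by blast
  have X_in: "X x \<in> E2" if "x \<in> E1" for x using X that by (auto simp: bounded_op_on_def)
  have bdd: "bdd_above ((\<lambda>x. norm (X x) / norm x) ` E1)"
  proof (rule bdd_aboveI2)
    \<comment> \<open>\<open>B\<close> may be negative if \<open>E1\<close> is trivial. The quotient
      at 0 is 0 by the convention for division, which also yields \<open>0 \<le> \<rho>\<close>
      below.\<close>
    show "norm (X x) / norm x \<le> \<bar>B\<bar>" if "x \<in> E1" for x
    proof (cases "x = 0")
      case False
      have "norm (X x) \<le> \<bar>B\<bar> * norm x"
        by (rule order_trans[OF B[OF that]]) (simp add: mult_right_mono)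
      then show ?thesis using False by (simp add: divide_le_eq)
    qed simp
  qed
  have X_le: "norm (X x) \<le> \<rho> * norm x" if "x \<in> E1" for x
  proof (cases "x = 0")
    case False
    have "norm (X x) / norm x \<le> \<rho>" unfolding \<rho>_def onorm_on_def by (rule cSUP_upper[OF that bdd])
    then show ?thesis using False by (simp add: divide_le_eq)
  qed (use B[OF that] in simp)
  have \<rho>: "0 \<le> \<rho>"
    using cSUP_upper[OF csubspace_0[OF E1(1)] bdd] by (simp add: \<rho>_def onorm_on_def)
  define Xt where "Xt x = X (proj E1 x)" for x
  note pE1 = proj_in[OF E1] norm_proj_le[OF E1] bounded_clinear_proj[OF E1]
  have Xt_bd: "norm (Xt x) \<le> \<rho> * norm x" for x
    using order_trans[OF X_le[OF pE1(1)] mult_left_mono[OF pE1(2) \<rho>]] by (simp add: Xt_def)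
  have Xt: "bounded_clinear Xt"
  proof (rule bounded_clinearI[OF _ _ Xt_bd])
    show "Xt (x + y) = Xt x + Xt y" "Xt (c *\<^sub>C x) = c *\<^sub>C Xt x" for x y c
      using X pE1 by (auto simp: Xt_def bounded_clinear_add[OF pE1(3)] bounded_clinear_scaleC[OF pE1(3)] bounded_op_on_def)
  qed
  have Xt_E1: "Xt x = X x" if "x \<in> E1" for x by (simp add: Xt_def proj_ident[OF E1 that])
  have Xt_ortho: "Xt x = 0" if "x \<in> ortho E1" for x
    using that Xt_E1[OF csubspace_0[OF E1(1)]] bounded_clinear_zero[OF Xt]
    by (simp add: Xt_def proj_ortho_zero[OF E1(1)])
  have inv1: "T1.N i x \<in> ortho E1" if "x \<in> ortho E1" for i x
    using that co1[of i] by (auto simp: ortho_def coinvariant_def cinner_cadj[OF T1.N_bounded])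
  have inv2: "T2.N i x \<in> ortho E2" if "x \<in> ortho E2" for i x
    using that co2[of i] by (auto simp: ortho_def coinvariant_def cinner_cadj[OF T2.N_bounded])
  have proj_diff1: "x - proj E1 x \<in> ortho E1" for x using proj_orth[OF E1] by (simp add: ortho_def)
  have Xt_twine: "Xt (T1.N i x) - T2.N i (Xt x) \<in> ortho E2" for i x
  proof -
    let ?p = "proj E1 x"
    \<comment> \<open>The part of \<open>x\<close> in \<open>ortho E1\<close> stays there under
      \<open>T1.N i\<close> and is killed by \<open>Xt\<close>.\<close>
    have "Xt (T1.N i x) = Xt (T1.N i ?p)"
      using Xt_ortho[OF inv1[OF proj_diff1], of i x]
      by (simp add: bounded_clinear_diff[OF T1.N_bounded] bounded_clinear_diff[OF Xt])
    also have "\<dots> = proj E2 (T2.N i (Xt x))"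
      using twine[OF pE1(1)] by (simp add: Xt_def)
    finally have "T2.N i (Xt x) - Xt (T1.N i x) \<in> ortho E2"
      using proj_orth[OF E2] by (simp add: ortho_def)
    then show ?thesis using csubspace_scaleC[OF csubspace_ortho, of "T2.N i (Xt x) - Xt (T1.N i x)" E2 "- 1"]
      by (simp add: scaleC_minus1)
  qed
  have V_inv2: "T2.V j x \<in> ortho E2" if "x \<in> ortho E2" for j x
    by (rule T2.opalg_ortho[OF T1.S_opalg T1.M_bounded inv2 that])
  have V_twine: "Xt (T1.V j x) - T2.V j (Xt x) \<in> ortho E2" for j x
    by (rule opalg_intertwine[OF T1.tensor_axioms T2.tensor_axioms T1.S_opalg T1.M_bounded Xt inv2 Xt_twine])
  interpret row_pair T1.V T2.V \<rho>
    by (intro row_pair.intro row_pair_axioms.intro T1.row_isometry_axioms T2.row_isometry_axioms \<rho>)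
  have A_inv: "T2.A i y \<in> E2" if y: "y \<in> E2" for i y
  proof (rule ortho_ortho[OF E2])
    fix z assume "z \<in> ortho E2"
    then have "cinner (T2.V i z) y = 0" using V_inv2[of z i] y by (simp add: ortho_def)
    then show "cinner (T2.A i y) z = 0"
      unfolding cinner_cadj'[OF T2.V_bounded] by (subst cinner_zero_commute)
  qed
  have "partial_lift E2 (cadj Xt)"
    unfolding partial_lift_def
  proof (intro conjI allI ballI)
    note Z = bounded_clinear_cadj[OF Xt]
    fix y assume y: "y \<in> E2"
    show "T2.A i y \<in> E2" for i by (rule A_inv[OF y])
    show "cadj Xt (y + y') = cadj Xt y + cadj Xt y'" for y' by (rule bounded_clinear_add[OF Z])
    show "cadj Xt (c *\<^sub>C y) = c *\<^sub>C cadj Xt y" for c by (rule bounded_clinear_scaleC[OF Z])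
    show "norm (cadj Xt y) \<le> \<rho> * norm y" by (rule norm_cadj_le[OF Xt \<rho> Xt_bd])
    show "T1.A i (cadj Xt y) = cadj Xt (T2.A i y)" for i
    proof (rule cinner_eqI)
      fix x
      \<comment> \<open>The error in the intertwining relation lies in \<open>ortho E2\<close>, so
        \<open>y\<close> does not see it.\<close>
      have "cinner (Xt (T1.V i x) - T2.V i (Xt x)) y = 0" using V_twine y by (simp add: ortho_def)
      then have "cinner y (Xt (T1.V i x) - T2.V i (Xt x)) = 0" by (subst cinner_zero_commute)
      then show "cinner (T1.A i (cadj Xt y)) x = cinner (cadj Xt (T2.A i y)) x"
        by (simp add: cinner_cadj'[OF T1.V_bounded] cinner_cadj'[OF T2.V_bounded] cinner_cadj'[OF Xt]
            cinner.diff_right)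
    qed
  qed (rule E2)
  then obtain Z where Z: "bounded_clinear Z" "\<And>x. norm (Z x) \<le> \<rho> * norm x"
    "\<And>y. y \<in> E2 \<Longrightarrow> Z y = cadj Xt y" "\<And>i x. T1.A i (Z x) = Z (T2.A i x)"
    using commutant_lifting[OF _ T2.pure] by blast
  define Y where "Y = cadj Z"
  have Y: "bounded_clinear Y" "\<And>x. norm (Y x) \<le> \<rho> * norm x"
    unfolding Y_def using bounded_clinear_cadj[OF Z(1)] norm_cadj_le[OF Z(1) \<rho> Z(2)] by auto
  have cadj_Y: "cadj Y = Z"
    by (rule cadj_eqI) (simp add: Y_def cinner_cadj'[OF Z(1)])
  have YV: "Y (T1.V j x) = T2.V j (Y x)" for j x
    by (rule cinner_eqI)
      (simp add: Y_def cinner_cadj'[OF Z(1)] cinner_cadj[OF T1.V_bounded] cinner_cadj[OF T2.V_bounded] Z(4))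
  have Z_E2: "Z y \<in> E1" "adj_on E1 X y = Z y" if y: "y \<in> E2" for y
  proof -
    show Zy: "Z y \<in> E1"
    proof (rule ortho_ortho[OF E1])
      fix x assume "x \<in> ortho E1"
      then show "cinner (Z y) x = 0"
        by (simp add: Z(3)[OF y] cinner_cadj'[OF Xt] Xt_ortho cinner.zero_right)
    qed
    show "adj_on E1 X y = Z y"
      by (rule adj_on_eqI[OF E1(1) Zy]) (simp add: Z(3)[OF y] cinner_cadj[OF Xt, symmetric] Xt_E1)
  qed
  have "onorm Y \<le> \<rho>" by (rule onorm_bound[OF \<rho> Y(2)])
  moreover have "\<rho> \<le> onorm Y"
    unfolding \<rho>_def onorm_on_def
  proof (rule cSUP_least)
    show "E1 \<noteq> {}" using csubspace_0[OF E1(1)] by auto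
    fix x assume x: "x \<in> E1"
    \<comment> \<open>So \<open>X x\<close> is the projection of \<open>Y x\<close> onto
      \<open>E2\<close> and cannot be longer; the choice \<open>y = X x\<close> shows it.\<close>
    have "cinner (X x) y = cinner (Y x) y" if "y \<in> E2" for y
      by (simp add: Y_def cinner_cadj'[OF Z(1)] Z(3)[OF that] cinner_cadj[OF Xt, symmetric] Xt_E1[OF x])
    then have "cinner (X x) (X x) = cinner (Y x) (X x)" using X_in[OF x] by blast
    moreover have "cmod (cinner (X x) (X x)) = norm (X x) * norm (X x)"
      unfolding cinner_self norm_of_real by (simp add: power2_eq_square)
    ultimately have "norm (X x) * norm (X x) \<le> norm (Y x) * norm (X x)"
      using cinner_Cauchy_Schwarz[of "Y x" "X x"] by simp
    then have "norm (X x) \<le> norm (Y x)" by (cases "X x = 0") auto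
    also have "\<dots> \<le> onorm Y * norm x" by (rule bounded_clinear_onorm[OF Y(1)])
    finally show "norm (X x) / norm x \<le> onorm Y"
      using bounded_clinear_onorm_nonneg[OF Y(1)] by (cases "x = 0") (simp_all add: divide_le_eq)
  qed
  ultimately have "onorm Y = onorm_on E1 X" by (simp add: \<rho>_def)
  then show ?thesis
    using Y(1) Z_E2 cadj_Y commute_N[OF Y(1) YV] by (intro exI[of _ Y]) (auto simp: comp_def)
qed

end

section \<open>Noncommutative power series\<close>

lemma nc_mult_Nil: "nc_mult p q [] = p [] * q []"
  by (simp add: nc_mult_def)

text \<open>The splitting with empty left part is separated; the others form a product with the left
  derivative of \<open>p\<close>. This gives inductions on words.\<close>

lemma nc_mult_Cons: "nc_mult p q (x # w) = p [] * q (x # w) + nc_mult (\<lambda>u. p (x # u)) q w"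
  unfolding nc_mult_def length_Cons by (subst sum.atMost_Suc_shift) simp

lemma nc_mult_sum_left:
  "nc_mult (\<lambda>w. \<Sum>i\<in>I. c i * p i w) q w = (\<Sum>i\<in>I. c i * nc_mult (p i) q w)"
  unfolding nc_mult_def sum_distrib_left sum_distrib_right
  by (subst sum.swap) (simp add: mult_ac)

lemma nc_mult_add_left: "nc_mult (\<lambda>w. p w + r w) q w = nc_mult p q w + nc_mult r q w"
  by (simp add: nc_mult_def distrib_right sum.distrib)

lemma nc_mult_cmult_left: "nc_mult (\<lambda>w. c * p w) q w = c * nc_mult p q w"
  by (simp add: nc_mult_def sum_distrib_left mult.assoc)

lemma nc_mult_assoc: "nc_mult (nc_mult p q) r = nc_mult p (nc_mult q r)"
proof
  show "nc_mult (nc_mult p q) r w = nc_mult p (nc_mult q r) w" for w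
  proof (induction w arbitrary: p)
    case (Cons x w)
    then show ?case
      by (simp add: nc_mult_Cons nc_mult_Nil nc_mult_add_left nc_mult_cmult_left algebra_simps)
  qed (simp add: nc_mult_Nil)
qed

lemma nc_mult_one_left: "nc_mult nc_one p = p"
proof
  show "nc_mult nc_one p w = p w" for w
    by (cases w) (simp_all add: nc_mult_Nil nc_mult_Cons nc_one_def, simp add: nc_mult_def)
qed

lemma nc_word_append: "nc_word f (\<alpha> @ \<beta>) = nc_mult (nc_word f \<alpha>) (nc_word f \<beta>)"
  by (induction \<alpha>) (simp_all add: nc_mult_one_left nc_mult_assoc)

lemma nc_mult_var_left: "nc_mult (nc_var i) p (x # w) = (if x = i then p w else 0)"
  by (simp add: nc_mult_Cons nc_var_def)
    (auto simp: nc_mult_one_left[unfolded nc_one_def[abs_def]] nc_mult_def)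

lemma nc_word_var: "nc_word nc_var u = (\<lambda>w. if w = u then 1 else 0)"
proof (induction u)
  case (Cons i u)
  show ?case
  proof
    show "nc_word nc_var (i # u) w = (if w = i # u then 1 else 0)" for w
    proof (cases w)
      case Nil
      then show ?thesis by (simp add: nc_mult_Nil nc_var_def)
    qed (simp add: nc_mult_var_left Cons.IH)
  qed
qed (auto simp: nc_one_def)

text \<open>If \<open>a\<close> is the coefficient family of a series in the
  \<open>f\<^sub>\<alpha>\<close>, this is that of its product with \<open>f\<^sub>\<beta>\<close>
  on the right, which appends \<open>\<beta>\<close> to every index.\<close>

definition shift :: "'n list \<Rightarrow> 'n ncseries \<Rightarrow> 'n ncseries" where
  "shift \<beta> a \<gamma> = (if \<gamma> \<in> range (\<lambda>\<alpha>. \<alpha> @ \<beta>) then a (take (length \<gamma> - length \<beta>) \<gamma>) else 0)"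

lemma shift_append [simp]: "shift \<beta> a (\<alpha> @ \<beta>) = a \<alpha>"
  by (simp add: shift_def)

lemma shift_eq_0: "(\<And>\<alpha>. \<gamma> \<noteq> \<alpha> @ \<beta>) \<Longrightarrow> shift \<beta> a \<gamma> = 0"
  by (auto simp: shift_def)

text \<open>At most one \<open>\<alpha>\<close> contributes, and it is no longer than
  \<open>\<gamma>\<close>, so the cutoff does not lose it.\<close>

lemma shift_sum:
  fixes \<gamma> :: "'n::finite list"
  assumes "length \<gamma> \<le> n"
  shows "(\<Sum>\<alpha> | length \<alpha> \<le> n. if \<alpha> @ \<delta> = \<gamma> then a \<alpha> else 0) = shift \<delta> a \<gamma>"
proof (cases "\<exists>\<alpha>. \<gamma> = \<alpha> @ \<delta>")
  case True
  then obtain \<alpha> where \<alpha>: "\<gamma> = \<alpha> @ \<delta>" by blast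
  have "(\<Sum>\<alpha>' | length \<alpha>' \<le> n. if \<alpha>' @ \<delta> = \<gamma> then a \<alpha>' else 0) =
      (\<Sum>\<alpha>' | length \<alpha>' \<le> n. if \<alpha>' = \<alpha> then a \<alpha>' else 0)"
    by (simp add: \<alpha>)
  also have "\<dots> = a \<alpha>" using assms by (subst sum.delta) (auto simp: finite_words \<alpha>)
  finally show ?thesis by (simp add: \<alpha>)
next
  case False
  then have "shift \<delta> a \<gamma> = 0" by (intro shift_eq_0) auto
  moreover have "(\<Sum>\<alpha> | length \<alpha> \<le> n. if \<alpha> @ \<delta> = \<gamma> then a \<alpha> else 0) = 0"
    using False by (intro sum.neutral) auto
  ultimately show ?thesis by simp
qed

section \<open>The polynomial case\<close>

lemma nc_polys_mult:
  assumes "p \<in> nc_polys" "q \<in> nc_polys"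
  shows "nc_mult p q \<in> nc_polys"
proof -
  have "{w. nc_mult p q w \<noteq> 0} \<subseteq> (\<lambda>(u, v). u @ v) ` ({u. p u \<noteq> 0} \<times> {v. q v \<noteq> 0})"
  proof
    fix w assume "w \<in> {w. nc_mult p q w \<noteq> 0}"
    then have "(\<Sum>k\<le>length w. p (take k w) * q (drop k w)) \<noteq> 0" by (simp add: nc_mult_def)
    then obtain k where "p (take k w) * q (drop k w) \<noteq> 0"
      by (rule sum.not_neutral_contains_not_neutral)
    then have "(take k w, drop k w) \<in> {u. p u \<noteq> 0} \<times> {v. q v \<noteq> 0}" by auto
    then show "w \<in> (\<lambda>(u, v). u @ v) ` ({u. p u \<noteq> 0} \<times> {v. q v \<noteq> 0})"
      by (rule rev_image_eqI) simp
  qed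
  then show ?thesis using assms unfolding nc_polys_def by (auto intro: finite_subset)
qed

lemma nc_polys_one: "nc_one \<in> nc_polys"
  and nc_polys_var: "nc_var i \<in> nc_polys"
  by (simp_all add: nc_polys_def nc_one_def nc_var_def)

lemma nc_polys_word: "(\<And>i. f i \<in> nc_polys) \<Longrightarrow> nc_word f \<alpha> \<in> nc_polys"
  by (induction \<alpha>) (auto intro: nc_polys_mult nc_polys_one)

lemma nc_polys_zero: "(\<lambda>w. 0) \<in> nc_polys"
  and nc_polys_add: "p \<in> nc_polys \<Longrightarrow> q \<in> nc_polys \<Longrightarrow> (\<lambda>w. p w + q w) \<in> nc_polys"
  and nc_polys_cmult: "p \<in> nc_polys \<Longrightarrow> (\<lambda>w. c * p w) \<in> nc_polys"
proof -
  show "(\<lambda>w. 0) \<in> nc_polys" by (simp add: nc_polys_def)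
  show "(\<lambda>w. p w + q w) \<in> nc_polys" if "p \<in> nc_polys" "q \<in> nc_polys"
  proof -
    have "{w. p w + q w \<noteq> 0} \<subseteq> {w. p w \<noteq> 0} \<union> {w. q w \<noteq> 0}" by auto
    then show ?thesis using that unfolding nc_polys_def by (auto dest: finite_subset)
  qed
  show "(\<lambda>w. c * p w) \<in> nc_polys" if "p \<in> nc_polys"
    using that unfolding nc_polys_def by (auto elim!: rev_finite_subset)
qed

lemma poly_expand:
  assumes "p \<in> nc_polys"
  shows "p = (\<lambda>w. \<Sum>u | p u \<noteq> 0. p u * nc_word nc_var u w)"
proof
  fix w
  have fin: "finite {u. p u \<noteq> 0}" using assms by (simp add: nc_polys_def)
  have "(\<Sum>u | p u \<noteq> 0. p u * nc_word nc_var u w) = (\<Sum>u | p u \<noteq> 0. if u = w then p u else 0)"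
    by (intro sum.cong) (auto simp: nc_word_var)
  also have "\<dots> = p w" using fin by (simp add: sum.delta)
  finally show "p w = (\<Sum>u | p u \<noteq> 0. p u * nc_word nc_var u w)" by simp
qed

lemma word_op_opalg: "word_op M \<alpha> \<in> opalg M"
  by (induction \<alpha>) (auto simp: id_def comp_def intro: opalg.ident opalg.mult)

text \<open>The inverse tuple supplies the coefficients: \<open>Z\<^sub>i\<close> is
  \<open>g\<^sub>i\<close> evaluated at \<open>f\<close>, a finite combination of the
  \<open>f\<^sub>\<alpha>\<close>. In turn \<open>f\<^sub>j\<close> is a polynomial in the
  indeterminates, so \<open>S j\<close> is the same polynomial in \<open>M\<close>.\<close>

lemma model_poly_fock:
  fixes f :: "'n::finite \<Rightarrow> 'n ncseries" and M :: "'n \<Rightarrow> 'h::chilbert_space \<Rightarrow> 'h"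
  assumes "model_poly f M"
  shows "\<exists>e S a. fock_model M e S a"
proof -
  obtain g \<iota> where model: "\<forall>i. f i \<in> nc_polys" "\<forall>i. g i \<in> nc_polys" "\<forall>i. nc_subst (g i) f = nc_var i"
    "\<forall>p\<in>nc_polys. \<forall>q\<in>nc_polys. \<iota> (\<lambda>w. p w + q w) = \<iota> p + \<iota> q"
    "\<forall>c. \<forall>p\<in>nc_polys. \<iota> (\<lambda>w. c * p w) = c *\<^sub>C \<iota> p"
    "\<forall>\<alpha> \<beta>. cinner (\<iota> (nc_word f \<alpha>)) (\<iota> (nc_word f \<beta>)) = (if \<alpha> = \<beta> then 1 else 0)"
    and dense: "closure (\<iota> ` nc_polys) = UNIV"
    and M': "\<forall>i. bounded_clinear (M i) \<and> (\<forall>p\<in>nc_polys. M i (\<iota> p) = \<iota> (nc_mult (nc_var i) p))"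
    using assms unfolding model_poly_def by (elim conjE exE) (rule that)
  note f = model(1)[rule_format] and g = model(2)[rule_format] and gf = model(3)[rule_format]
    and add = model(4)[rule_format] and scale = model(5)[rule_format] and orth = model(6)[rule_format]
  have M: "bounded_clinear (M i)" for i using M' by blast
  have M_iota: "M i (\<iota> p) = \<iota> (nc_mult (nc_var i) p)" if "p \<in> nc_polys" for i p using M' that by blast
  note word = nc_polys_word[OF f]
  note vword = nc_polys_word[of nc_var, OF nc_polys_var]
  have \<iota>_sum: "\<iota> (\<lambda>w. \<Sum>i\<in>I. c i * p i w) = (\<Sum>i\<in>I. c i *\<^sub>C \<iota> (p i)) \<and> (\<lambda>w. \<Sum>i\<in>I. c i * p i w) \<in> nc_polys"
    if "finite I" "\<And>i. p i \<in> nc_polys" for I :: "'n list set" and c p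
    using that(1)
  proof (induction I)
    case empty
    show ?case using scale[of "\<lambda>w. 0" 0] by (simp add: nc_polys_zero)
  next
    case (insert i I)
    then show ?case
      using add[of "\<lambda>w. c i * p i w" "\<lambda>w. \<Sum>i\<in>I. c i * p i w"] nc_polys_cmult[OF that(2)]
        nc_polys_add[of "\<lambda>w. c i * p i w" "\<lambda>w. \<Sum>i\<in>I. c i * p i w"]
      by (simp add: scale that(2))
  qed
  define e where "e \<alpha> = \<iota> (nc_word f \<alpha>)" for \<alpha>
  define G where "G i = {\<alpha>. g i \<alpha> \<noteq> 0}" for i
  have G: "finite (G i)" for i using g by (simp add: nc_polys_def G_def)
  have var: "nc_var i = (\<lambda>w. \<Sum>\<alpha>\<in>G i. g i \<alpha> * nc_word f \<alpha> w)" for i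
  proof
    fix w
    have "nc_var i w = (\<Sum>\<^sub>\<infinity>\<alpha>. g i \<alpha> * nc_word f \<alpha> w)" by (simp add: nc_subst_def flip: gf)
    also have "\<dots> = (\<Sum>\<^sub>\<infinity>\<alpha>\<in>G i. g i \<alpha> * nc_word f \<alpha> w)"
      by (rule infsum_cong_neutral) (auto simp: G_def)
    finally show "nc_var i w = (\<Sum>\<alpha>\<in>G i. g i \<alpha> * nc_word f \<alpha> w)" using G by simp
  qed
  have M_e: "M i (e \<beta>) = (\<Sum>\<alpha>\<in>G i. g i \<alpha> *\<^sub>C e (\<alpha> @ \<beta>))" for i \<beta>
  proof -
    have "nc_mult (nc_var i) (nc_word f \<beta>) = (\<lambda>w. \<Sum>\<alpha>\<in>G i. g i \<alpha> * nc_word f (\<alpha> @ \<beta>) w)"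
      by (subst var) (simp add: nc_mult_sum_left[abs_def] nc_word_append)
    then show ?thesis using \<iota>_sum[where I = "G i" and c = "g i" and p = "\<lambda>\<alpha>. nc_word f (\<alpha> @ \<beta>)", OF G word]
      by (simp add: e_def M_iota word)
  qed
  define S where "S j x = (\<Sum>\<alpha> | f j \<alpha> \<noteq> 0. f j \<alpha> *\<^sub>C word_op M \<alpha> x)" for j x
  have S_opalg: "S j \<in> opalg M" for j
    unfolding S_def[abs_def] by (intro opalg_setsum opalg.scale word_op_opalg)
  have word_iota: "word_op M \<alpha> (\<iota> q) = \<iota> (nc_mult (nc_word nc_var \<alpha>) q)" if "q \<in> nc_polys" for \<alpha> q
    by (induction \<alpha>)
      (use that in \<open>auto simp: nc_mult_one_left nc_mult_assoc M_iota nc_polys_mult vword\<close>)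
  have S_e: "S j (e \<alpha>) = e (j # \<alpha>)" for j \<alpha>
  proof -
    have fin: "finite {\<beta>. f j \<beta> \<noteq> 0}" using f by (simp add: nc_polys_def)
    have "nc_mult (f j) (nc_word f \<alpha>) =
        (\<lambda>w. \<Sum>\<beta> | f j \<beta> \<noteq> 0. f j \<beta> * nc_mult (nc_word nc_var \<beta>) (nc_word f \<alpha>) w)"
      by (subst poly_expand[OF f]) (simp add: nc_mult_sum_left[abs_def])
    then have "e (j # \<alpha>) = (\<Sum>\<beta> | f j \<beta> \<noteq> 0. f j \<beta> *\<^sub>C \<iota> (nc_mult (nc_word nc_var \<beta>) (nc_word f \<alpha>)))"
      using \<iota>_sum[where c = "f j" and p = "\<lambda>\<beta>. nc_mult (nc_word nc_var \<beta>) (nc_word f \<alpha>)", OF fin]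
      by (simp add: e_def nc_polys_mult vword word)
    then show ?thesis by (simp add: S_def e_def word_iota word)
  qed
  \<comment> \<open>Totality: this span contains the image of 1 and is invariant under the
    \<open>M i\<close>, hence contains the images of all monomials.\<close>
  let ?K = "cspan (range e)"
  note K = csubspace_cspan[of "range e"]
  have e_K: "e \<alpha> \<in> ?K" for \<alpha> using cspan_superset[of "range e"] by auto
  have M_K: "M i x \<in> ?K" if "x \<in> ?K" for i x
  proof -
    have "csubspace {x. M i x \<in> ?K}"
      using K by (auto simp: csubspace_def bounded_clinear_add[OF M] bounded_clinear_scaleC[OF M] bounded_clinear_zero[OF M])
    moreover have "range e \<subseteq> {x. M i x \<in> ?K}"
      by (auto simp: M_e intro!: csubspace_sum[OF K] csubspace_scaleC[OF K] e_K)
    ultimately show ?thesis using that cspan_minimal[of "{x. M i x \<in> ?K}"] by blast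
  qed
  have mono_K: "\<iota> (nc_word nc_var u) \<in> ?K" for u
  proof (induction u)
    case Nil
    have "\<iota> nc_one = e []" by (simp add: e_def)
    then show ?case using e_K by simp
  next
    case (Cons i u)
    then show ?case using M_K[OF Cons, of i] by (simp add: M_iota vword)
  qed
  have "\<iota> p \<in> ?K" if p: "p \<in> nc_polys" for p
  proof -
    have fin: "finite {u. p u \<noteq> 0}" using p by (simp add: nc_polys_def)
    show ?thesis
      by (subst poly_expand[OF p])
        (auto simp: \<iota>_sum[OF fin vword] intro!: csubspace_sum[OF K] csubspace_scaleC[OF K] mono_K)
  qed
  then have "closure ?K = UNIV" using closure_mono[of "\<iota> ` nc_polys" ?K] dense by auto
  then have tot: "ctotal (range e)" by (rule dense_imp_total)
  have "fock_model M e S g"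
  proof
    fix i \<delta> \<gamma> n assume n: "length (\<gamma> :: 'n list) \<le> n"
    have "cinner (M i (e \<delta>)) (e \<gamma>) = (\<Sum>\<alpha>\<in>G i. if \<alpha> @ \<delta> = \<gamma> then g i \<alpha> else 0)"
      unfolding M_e cinner.sum_left cinner_scaleC_left unfolding e_def orth by (intro sum.cong) auto
    also have "\<dots> = (\<Sum>\<alpha> | length \<alpha> \<le> n. if \<alpha> @ \<delta> = \<gamma> then g i \<alpha> else 0)"
      using n by (intro sum.mono_neutral_cong G finite_words) (auto simp: G_def)
    finally show "cinner (M i (e \<delta>)) (e \<gamma>) = (\<Sum>\<alpha> | length \<alpha> \<le> n. if \<alpha> @ \<delta> = \<gamma> then g i \<alpha> else 0)" .
  qed (simp_all add: M e_def[symmetric] S_opalg S_e tot, simp add: e_def orth)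
  then show ?thesis by blast
qed

section \<open>Hilbert spaces of power series\<close>

definition unit_ell2 :: "'i \<Rightarrow> 'i ell2" where
  "unit_ell2 i = Abs_ell2 (\<lambda>j. if j = i then 1 else 0)"

lemma coords_unit_ell2: "coords (unit_ell2 i) j = (if j = i then 1 else 0)"
proof -
  have "(\<lambda>j. (cmod (if j = i then 1 else 0))\<^sup>2) summable_on UNIV"
    by (rule finite_nonzero_values_imp_summable_on) (auto intro: finite_subset[of _ "{i}"])
  then show ?thesis by (simp add: unit_ell2_def Abs_ell2_inverse)
qed

lemma cinner_unit_ell2: "cinner x (unit_ell2 i) = coords x i"
proof -
  have "cinner x (unit_ell2 i) = (\<Sum>\<^sub>\<infinity>j\<in>{i}. coords x j * cnj (coords (unit_ell2 i) j))"
    unfolding cinner_ell2_def by (rule infsum_cong_neutral) (auto simp: coords_unit_ell2)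
  then show ?thesis by (simp add: coords_unit_ell2)
qed

lemma shift_ell2_exists: "\<exists>b. coords b = shift \<beta> (coords a)"
proof -
  have inj: "inj (\<lambda>\<alpha>. \<alpha> @ \<beta>)" by (auto intro: injI)
  have "(\<lambda>\<alpha>. (cmod (shift \<beta> (coords a) (\<alpha> @ \<beta>)))\<^sup>2) summable_on UNIV"
    by (simp add: coords_summable)
  then have "(\<lambda>\<gamma>. (cmod (shift \<beta> (coords a) \<gamma>))\<^sup>2) summable_on range (\<lambda>\<alpha>. \<alpha> @ \<beta>)"
    using summable_on_reindex[OF inj, of "\<lambda>\<gamma>. (cmod (shift \<beta> (coords a) \<gamma>))\<^sup>2"] by (simp add: comp_def)
  then have "(\<lambda>\<gamma>. (cmod (shift \<beta> (coords a) \<gamma>))\<^sup>2) summable_on UNIV"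
    by (rule summable_on_cong_neutral[THEN iffD1, rotated -1]) (auto simp: shift_def)
  then show ?thesis using Abs_ell2_inverse[of "shift \<beta> (coords a)"] by auto
qed

text \<open>Shared by the series and the free holomorphic case. The product of
  \<open>Z\<^sub>i\<close> and \<open>f\<^sub>\<beta>\<close> has the shifted, still square summable
  coefficients, and its inner products with the \<open>f\<^sub>\<gamma>\<close> read them
  off.\<close>

lemma hilbert_space_of_fock:
  fixes M :: "'n::finite \<Rightarrow> 'h::chilbert_space \<Rightarrow> 'h" and \<Phi> :: "'n list ell2 \<Rightarrow> 'v"
  assumes H: "is_hilbert_space_of \<iota> \<Phi>" and M: "\<And>i. bounded_clinear (M i)"
    and S: "\<And>j. S j \<in> opalg M"
    and S_iota: "\<And>j x \<alpha>. \<iota> x = \<Phi> (unit_ell2 \<alpha>) \<Longrightarrow> \<iota> (S j x) = \<Phi> (unit_ell2 (j # \<alpha>))"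
    and M_iota: "\<And>i x \<beta> b. \<iota> x = \<Phi> (unit_ell2 \<beta>) \<Longrightarrow> coords b = shift \<beta> (coords (a i)) \<Longrightarrow> \<iota> (M i x) = \<Phi> b"
  shows "\<exists>e S a. fock_model M e S a"
proof -
  have inj: "inj \<iota>" and range: "range \<iota> = range \<Phi>"
    and inner: "\<And>x y a b. \<iota> x = \<Phi> a \<Longrightarrow> \<iota> y = \<Phi> b \<Longrightarrow> cinner x y = cinner a b"
    using H by (auto simp: is_hilbert_space_of_def)
  have "\<forall>\<alpha>. \<exists>x. \<iota> x = \<Phi> (unit_ell2 \<alpha>)" using range by (metis rangeE rangeI)
  from choice[OF this] obtain e where e: "\<And>\<alpha>. \<iota> (e \<alpha>) = \<Phi> (unit_ell2 \<alpha>)" by blast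
  have "fock_model M e S (\<lambda>i. coords (a i))"
  proof
    show "cinner (e \<alpha>) (e \<beta>) = (if \<alpha> = \<beta> then 1 else 0)" for \<alpha> \<beta>
      by (simp add: inner[OF e e] cinner_unit_ell2 coords_unit_ell2)
    show "ctotal (range e)"
    proof (rule totalI)
      fix x assume x: "\<And>s. s \<in> range e \<Longrightarrow> cinner x s = 0"
      obtain b where b: "\<iota> x = \<Phi> b" using range by (metis rangeE rangeI)
      have "coords b \<alpha> = 0" for \<alpha>
        using x[of "e \<alpha>"] by (simp add: inner[OF b e] cinner_unit_ell2)
      then have "cinner b b = 0" by (simp add: cinner_ell2_def)
      then show "x = 0" using inner[OF b b] by (simp add: cinner_self)
    qed
    show "S j (e \<alpha>) = e (j # \<alpha>)" for j \<alpha>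
      by (rule injD[OF inj]) (simp add: S_iota[OF e] e)
    fix i \<delta> \<gamma> n assume n: "length (\<gamma> :: 'n list) \<le> n"
    obtain b where b: "coords b = shift \<delta> (coords (a i))" using shift_ell2_exists by blast
    have "cinner (M i (e \<delta>)) (e \<gamma>) = shift \<delta> (coords (a i)) \<gamma>"
      by (simp add: inner[OF M_iota[OF e b] e] cinner_unit_ell2 b)
    then show "cinner (M i (e \<delta>)) (e \<gamma>) = (\<Sum>\<alpha> | length \<alpha> \<le> n. if \<alpha> @ \<delta> = \<gamma> then coords (a i) \<alpha> else 0)"
      by (simp add: shift_sum[OF n])
  qed (use M S in auto)
  then show ?thesis by blast
qed

section \<open>The functional calculus\<close>

lemma nc_partial_opalg:
  assumes "\<And>\<alpha>. word_op X \<alpha> \<in> opalg M"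
  shows "nc_partial a X N \<in> opalg M"
  unfolding nc_partial_def[abs_def] by (intro opalg_setsum opalg.scale assms)

lemma word_op_dilate_opalg: "word_op (dilate r M) \<alpha> \<in> opalg M"
  by (induction \<alpha>)
    (auto simp: id_def comp_def dilate_def scaleR_scaleC intro: opalg.ident opalg.scale[OF opalg.mult])

lemma norm_convergent_opalg:
  fixes M :: "'n::finite \<Rightarrow> 'h::chilbert_space \<Rightarrow> 'h"
  assumes conv: "norm_convergent a X" and M: "\<And>i. bounded_clinear (M i)"
    and X: "\<And>\<alpha>. word_op X \<alpha> \<in> opalg M"
  shows "nc_eval a X \<in> opalg M"
proof (rule opalg.limit)
  show part: "nc_partial a X N \<in> opalg M" for N by (rule nc_partial_opalg[OF X])
  show ev: "bounded_clinear (nc_eval a X)" using conv by (simp add: norm_convergent_def)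
  fix v
  have "(\<lambda>N. nc_partial a X N v - nc_eval a X v) \<longlonglongrightarrow> 0"
  proof (rule Lim_null_comparison)
    show "\<forall>\<^sub>F N in sequentially. norm (nc_partial a X N v - nc_eval a X v)
        \<le> onorm (\<lambda>v. nc_partial a X N v - nc_eval a X v) * norm v"
      by (intro always_eventually allI bounded_clinear_onorm bounded_clinear_minus ev opalg_bounded[OF part M])
    show "(\<lambda>N. onorm (\<lambda>v. nc_partial a X N v - nc_eval a X v) * norm v) \<longlonglongrightarrow> 0"
      using conv tendsto_mult_left_zero by (auto simp: norm_convergent_def)
  qed
  then show "(\<lambda>N. nc_partial a X N v) \<longlonglongrightarrow> nc_eval a X v" by (rule LIM_zero_cancel)
qed

lemma functional_calculus_opalg:
  fixes M :: "'n::finite \<Rightarrow> 'h::chilbert_space \<Rightarrow> 'h"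
  assumes fc: "functional_calculus f M \<Theta>" and M: "\<And>i. bounded_clinear (M i)"
  shows "\<exists>S. \<forall>j. S j \<in> opalg M \<and> \<Theta> j (S j)"
  using fc unfolding functional_calculus_def
proof (elim disjE conjE)
  assume sot: "M \<in> C_SOT f" and \<Theta>: "\<forall>j. \<Theta> j (nc_eval (f j) M)"
  have "nc_eval (f j) M \<in> opalg M" for j
  proof (rule opalg.limit)
    show "nc_partial (f j) M N \<in> opalg M" for N by (rule nc_partial_opalg[OF word_op_opalg])
  qed (use sot in \<open>auto simp: C_SOT_def sot_convergent_def\<close>)
  then show ?thesis using \<Theta> by (intro exI[of _ "\<lambda>j. nc_eval (f j) M"]) simp
next
  assume rad: "M \<in> C_rad f" and \<Theta>: "\<forall>j. \<Theta> j (rad_eval (f j) M)"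
  obtain \<delta> where \<delta>: "0 < \<delta>" "\<delta> < 1"
    and conv: "\<And>r j. \<delta> < r \<Longrightarrow> r < 1 \<Longrightarrow> norm_convergent (f j) (dilate r M)"
    using rad unfolding C_rad_def by auto
  \<comment> \<open>A sequence is needed because \<open>opalg\<close> is closed under sequential
    limits. The offset 2 keeps even the first term strictly above \<open>\<delta>\<close>.\<close>
  define r where "r n = 1 - (1 - \<delta>) / real (n + 2)" for n
  have r: "\<delta> < r n" "r n < 1" for n
  proof -
    have "(1 - \<delta>) / real (n + 2) < 1 - \<delta>" using \<delta> by (simp add: divide_less_eq)
    moreover have "0 < (1 - \<delta>) / real (n + 2)" using \<delta> by simp
    ultimately show "\<delta> < r n" "r n < 1" by (auto simp: r_def)
  qed
  have "(\<lambda>n. (1 - \<delta>) / real (n + 2)) \<longlonglongrightarrow> 0"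
    by (rule tendsto_divide_0[OF tendsto_const]) (rule filterlim_at_top_imp_at_infinity,
      rule filterlim_compose[OF filterlim_real_sequentially], rule filterlim_add_const_nat_at_top)
  then have "r \<longlonglongrightarrow> 1" unfolding r_def[abs_def] using tendsto_diff[OF tendsto_const[of 1]] by fastforce
  then have rlim: "filterlim r (at_left 1) sequentially"
    unfolding filterlim_at using r by (auto simp: less_imp_neq)
  have "rad_eval (f j) M \<in> opalg M" for j
  proof (rule opalg.limit)
    show "nc_eval (f j) (dilate (r n) M) \<in> opalg M" for n
      by (rule norm_convergent_opalg[OF conv[OF r] M word_op_dilate_opalg])
    show "bounded_clinear (rad_eval (f j) M)" using rad by (auto simp: C_rad_def)
    fix v
    have "((\<lambda>r. nc_eval (f j) (dilate r M) v) \<longlongrightarrow> rad_eval (f j) M v) (at_left 1)"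
      using rad by (auto simp: C_rad_def)
    then show "(\<lambda>n. nc_eval (f j) (dilate (r n) M) v) \<longlonglongrightarrow> rad_eval (f j) M v"
      by (rule filterlim_compose[OF _ rlim])
  qed
  then show ?thesis using \<Theta> by (intro exI[of _ "\<lambda>j. rad_eval (f j) M"]) simp
qed

section \<open>The power series case\<close>

text \<open>Without constant terms, every factor consumes at least one letter of
  \<open>w\<close>.\<close>

lemma nc_word_eq_0:
  assumes "\<And>i. f i [] = 0" "length w < length \<alpha>"
  shows "nc_word f \<alpha> w = 0"
  using assms(2)
proof (induction \<alpha> arbitrary: w)
  case (Cons i \<alpha>)
  have "f i (take k w) * nc_word f \<alpha> (drop k w) = 0" for k
  proof (cases "k = 0 \<or> w = []")
    case True
    then show ?thesis using assms(1) by auto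
  next
    case False
    then have "length (drop k w) < length \<alpha>" using Cons.prems by (cases w) auto
    then show ?thesis using Cons.IH by simp
  qed
  then show ?case unfolding nc_word.simps nc_mult_def by (intro sum.neutral ballI)
qed simp

text \<open>The cutoff \<open>n\<close> is left free so that one range of summation serves all
  prefixes of a word in \<open>nc_subst_shift\<close>.\<close>

lemma nc_subst_eq_sum:
  fixes f :: "'n::finite \<Rightarrow> 'n ncseries"
  assumes f: "\<And>i. f i [] = 0" and n: "length w \<le> n"
  shows "nc_subst a f w = (\<Sum>\<alpha> | length \<alpha> \<le> n. a \<alpha> * nc_word f \<alpha> w)"
proof -
  have "nc_subst a f w = (\<Sum>\<^sub>\<infinity>\<alpha> | length \<alpha> \<le> n. a \<alpha> * nc_word f \<alpha> w)"
    unfolding nc_subst_def using n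
    by (intro infsum_cong_neutral) (auto intro!: nc_word_eq_0[of f, OF f])
  then show ?thesis by (simp add: finite_words)
qed

lemma nc_subst_unit:
  assumes f: "\<And>i. f i [] = 0"
  shows "nc_subst (coords (unit_ell2 \<alpha>)) f = nc_word f (\<alpha> :: 'n::finite list)"
proof
  fix w
  have "nc_subst (coords (unit_ell2 \<alpha>)) f w = (\<Sum>\<^sub>\<infinity>\<beta>\<in>{\<alpha>}. coords (unit_ell2 \<alpha>) \<beta> * nc_word f \<beta> w)"
    unfolding nc_subst_def by (rule infsum_cong_neutral) (auto simp: coords_unit_ell2)
  then show "nc_subst (coords (unit_ell2 \<alpha>)) f w = nc_word f \<alpha> w" by (simp add: coords_unit_ell2)
qed

lemma nc_subst_shift:
  fixes f :: "'n::finite \<Rightarrow> 'n ncseries"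
  assumes f: "\<And>i. f i [] = 0"
  shows "nc_subst (shift \<beta> a) f = nc_mult (nc_subst a f) (nc_word f \<beta>)"
proof
  fix w :: "'n list"
  let ?F = "{\<alpha> :: 'n list. length \<alpha> \<le> length w}"
  have inj: "inj (\<lambda>\<alpha>. \<alpha> @ \<beta>)" by (auto intro: injI)
  have "nc_subst (shift \<beta> a) f w = (\<Sum>\<^sub>\<infinity>\<gamma>\<in>range (\<lambda>\<alpha>. \<alpha> @ \<beta>). shift \<beta> a \<gamma> * nc_word f \<gamma> w)"
    unfolding nc_subst_def by (rule infsum_cong_neutral) (auto simp: shift_def)
  also have "\<dots> = (\<Sum>\<^sub>\<infinity>\<alpha>. a \<alpha> * nc_word f (\<alpha> @ \<beta>) w)"
    by (subst infsum_reindex[OF inj]) (simp add: comp_def)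
  also have "\<dots> = (\<Sum>\<^sub>\<infinity>\<alpha>\<in>?F. a \<alpha> * nc_word f (\<alpha> @ \<beta>) w)"
    by (intro infsum_cong_neutral) (auto intro!: nc_word_eq_0[of f, OF f])
  also have "\<dots> = (\<Sum>\<alpha>\<in>?F. a \<alpha> * nc_mult (nc_word f \<alpha>) (nc_word f \<beta>) w)"
    by (simp add: finite_words nc_word_append)
  also have "\<dots> = nc_mult (\<lambda>u. \<Sum>\<alpha>\<in>?F. a \<alpha> * nc_word f \<alpha> u) (nc_word f \<beta>) w"
    by (rule nc_mult_sum_left[symmetric])
  also have "\<dots> = nc_mult (nc_subst a f) (nc_word f \<beta>) w"
    unfolding nc_mult_def by (intro sum.cong refl) (simp add: nc_subst_eq_sum[of f, OF f])
  finally show "nc_subst (shift \<beta> a) f w = nc_mult (nc_subst a f) (nc_word f \<beta>) w" .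
qed

lemma model_series_fock:
  fixes f :: "'n::finite \<Rightarrow> 'n ncseries" and M :: "'n \<Rightarrow> 'h::chilbert_space \<Rightarrow> 'h"
  assumes "model_series f M"
  shows "\<exists>e S a. fock_model M e S a"
proof -
  obtain \<iota> where f: "\<And>i. f i [] = 0" and H: "is_hilbert_space_of \<iota> (\<lambda>a. nc_subst (coords a) f)"
    and var: "\<And>i. nc_var i \<in> range \<iota>" and M: "\<And>i. bounded_clinear (M i)"
    and M_iota: "\<And>i x. \<iota> (M i x) = nc_mult (nc_var i) (\<iota> x)"
    and fc: "functional_calculus f M (\<lambda>j T. \<forall>x. \<iota> (T x) = nc_mult (f j) (\<iota> x))"
    using assms unfolding model_series_def by blast
  obtain S where S: "\<And>j. S j \<in> opalg M" "\<And>j x. \<iota> (S j x) = nc_mult (f j) (\<iota> x)"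
    using functional_calculus_opalg[OF fc M] by blast
  have "\<exists>a. nc_var i = nc_subst (coords a) f" for i
    using var[of i] H by (auto simp: is_hilbert_space_of_def)
  then obtain a where a: "\<And>i. nc_var i = nc_subst (coords (a i)) f" by metis
  show ?thesis
  proof (rule hilbert_space_of_fock[OF H M S(1), where a = a])
    show "\<iota> (S j x) = nc_subst (coords (unit_ell2 (j # \<alpha>))) f"
      if "\<iota> x = nc_subst (coords (unit_ell2 \<alpha>)) f" for j x \<alpha>
      using that by (simp add: S nc_subst_unit[of f, OF f])
    show "\<iota> (M i x) = nc_subst (coords b) f"
      if "\<iota> x = nc_subst (coords (unit_ell2 \<beta>)) f" "coords b = shift \<beta> (coords (a i))" for i x \<beta> b
      using that by (simp add: M_iota nc_subst_unit[of f, OF f] nc_subst_shift[of f, OF f] a)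
  qed
qed

section \<open>The free holomorphic case\<close>

lemma word_op_append: "word_op X (\<alpha> @ \<beta>) v = word_op X \<alpha> (word_op X \<beta> v)"
  by (induction \<alpha>) auto

lemma finite_words_eq: "finite {\<alpha> :: 'n::finite list. length \<alpha> = n}"
  using finite_words[of n] by (rule rev_finite_subset) auto

lemma nc_eval_unit:
  fixes \<alpha> :: "'n::finite list"
  shows "nc_eval (coords (unit_ell2 \<alpha>)) X = word_op X \<alpha>"
proof
  fix v
  have "nc_partial (coords (unit_ell2 \<alpha>)) X N v = word_op X \<alpha> v" if "N > length \<alpha>" for N
  proof -
    have "(\<Sum>\<beta> | length \<beta> = k. coords (unit_ell2 \<alpha>) \<beta> *\<^sub>C word_op X \<beta> v) =
        (\<Sum>\<beta> | length \<beta> = k. if \<beta> = \<alpha> then word_op X \<alpha> v else 0)" for k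
      by (intro sum.cong) (auto simp: coords_unit_ell2)
    then show ?thesis using that by (simp add: nc_partial_def finite_words_eq)
  qed
  then have "(\<lambda>N. nc_partial (coords (unit_ell2 \<alpha>)) X N v) \<longlonglongrightarrow> word_op X \<alpha> v"
    by (intro tendsto_eventually) (auto simp: eventually_sequentially intro!: exI[of _ "Suc (length \<alpha>)"])
  then show "nc_eval (coords (unit_ell2 \<alpha>)) X v = word_op X \<alpha> v"
    unfolding nc_eval_def by (rule limI)
qed

text \<open>The layers of degree below \<open>length \<beta>\<close> vanish, and the layer of degree
  \<open>m + length \<beta>\<close> is the layer of degree \<open>m\<close> of \<open>a\<close>,
  applied after the word \<open>\<beta>\<close>.\<close>

lemma nc_partial_shift:
  fixes X :: "'n::finite \<Rightarrow> 'h::chilbert_space \<Rightarrow> 'h"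
  shows "nc_partial (shift \<beta> a) X (N + length \<beta>) v = nc_partial a X N (word_op X \<beta> v)"
proof -
  let ?h = "\<lambda>k. \<Sum>\<gamma> | length \<gamma> = k. shift \<beta> a \<gamma> *\<^sub>C word_op X \<gamma> v"
  have low: "?h k = 0" if "k < length \<beta>" for k
    using that by (intro sum.neutral) (auto simp: shift_def)
  have high: "?h (m + length \<beta>) = (\<Sum>\<alpha> | length \<alpha> = m. a \<alpha> *\<^sub>C word_op X \<alpha> (word_op X \<beta> v))" for m
  proof -
    have "?h (m + length \<beta>) = (\<Sum>\<gamma>\<in>(\<lambda>\<alpha>. \<alpha> @ \<beta>) ` {\<alpha>. length \<alpha> = m}. shift \<beta> a \<gamma> *\<^sub>C word_op X \<gamma> v)"
      by (rule sum.mono_neutral_right) (auto simp: finite_words_eq shift_def)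
    then show ?thesis by (simp add: sum.reindex inj_on_def word_op_append)
  qed
  show ?thesis
  proof (induction N)
    case 0
    show ?case using low by (simp add: nc_partial_def)
  next
    case (Suc N)
    then show ?case using high[of N] by (simp add: nc_partial_def)
  qed
qed

text \<open>The partial sums agree up to an offset of the index. So they have the same limits, and
  the two values of \<open>lim\<close> agree even if nothing converges.\<close>

lemma nc_eval_shift:
  fixes X :: "'n::finite \<Rightarrow> 'h::chilbert_space \<Rightarrow> 'h"
  shows "nc_eval (shift \<beta> a) X v = nc_eval a X (word_op X \<beta> v)"
proof -
  have "(\<lambda>N. nc_partial (shift \<beta> a) X N v) \<longlonglongrightarrow> l \<longleftrightarrow> (\<lambda>N. nc_partial a X N (word_op X \<beta> v)) \<longlonglongrightarrow> l" for l
    unfolding nc_partial_shift[symmetric]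
    by (rule iffI, erule LIMSEQ_ignore_initial_segment, erule LIMSEQ_offset)
  then show ?thesis by (simp add: nc_eval_def lim_def)
qed

lemma model_free_hol_fock:
  fixes f :: "'n::finite \<Rightarrow> 'n ncseries" and M :: "'n \<Rightarrow> 'h::chilbert_space \<Rightarrow> 'h"
  assumes "model_free_hol f M"
  shows "\<exists>e S a. fock_model M e S a"
proof -
  obtain \<gamma> \<iota> where
    H: "is_hilbert_space_of \<iota> (\<lambda>a. on_ball \<gamma> (\<lambda>X. nc_eval (coords a) (eval_tuple f X)))"
    and var: "\<And>i. on_ball \<gamma> (\<lambda>X. X i) \<in> range \<iota>" and M: "\<And>i. bounded_clinear (M i)"
    and M_iota: "\<And>i x. \<iota> (M i x) = on_ball \<gamma> (\<lambda>X. X i \<circ> \<iota> x X)"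
    and fc: "functional_calculus f M (\<lambda>j T. \<forall>x. \<iota> (T x) = on_ball \<gamma> (\<lambda>X. nc_eval (f j) X \<circ> \<iota> x X))"
    using assms unfolding model_free_hol_def by blast
  obtain S where S: "\<And>j. S j \<in> opalg M"
    "\<And>j x. \<iota> (S j x) = on_ball \<gamma> (\<lambda>X. nc_eval (f j) X \<circ> \<iota> x X)"
    using functional_calculus_opalg[OF fc M] by blast
  have "\<exists>a. on_ball \<gamma> (\<lambda>X. X i) = on_ball \<gamma> (\<lambda>X. nc_eval (coords a) (eval_tuple f X))" for i
    using var[of i] H by (auto simp: is_hilbert_space_of_def)
  then obtain a where
    a: "\<And>i. on_ball \<gamma> (\<lambda>X. X i) = on_ball \<gamma> (\<lambda>X. nc_eval (coords (a i)) (eval_tuple f X))" by metis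
  have a_ball: "X i = nc_eval (coords (a i)) (eval_tuple f X)" if "X \<in> op_ball \<gamma>" for X i
    using fun_cong[OF a[of i], of X] that by (simp add: on_ball_def)
  show ?thesis
  proof (rule hilbert_space_of_fock[OF H M S(1), where a = a])
    fix j x \<alpha> assume x: "\<iota> x = on_ball \<gamma> (\<lambda>X. nc_eval (coords (unit_ell2 \<alpha>)) (eval_tuple f X))"
    show "\<iota> (S j x) = on_ball \<gamma> (\<lambda>X. nc_eval (coords (unit_ell2 (j # \<alpha>))) (eval_tuple f X))"
      unfolding S(2) x nc_eval_unit by (rule ext) (simp add: on_ball_def eval_tuple_def)
  next
    fix i x \<beta> b assume x: "\<iota> x = on_ball \<gamma> (\<lambda>X. nc_eval (coords (unit_ell2 \<beta>)) (eval_tuple f X))"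
      and b: "coords b = shift \<beta> (coords (a i))"
    \<comment> \<open>On the ball, \<open>X i\<close> is itself a series in the values of
      \<open>f\<close>, and composing it with the word \<open>\<beta>\<close> in these values shifts
      its coefficients.\<close>
    have "X i (word_op (eval_tuple f X) \<beta> v) = nc_eval (coords b) (eval_tuple f X) v"
      if "X \<in> op_ball \<gamma>" for X v
      unfolding b nc_eval_shift by (subst a_ball[OF that]) (rule refl)
    then show "\<iota> (M i x) = on_ball \<gamma> (\<lambda>X. nc_eval (coords b) (eval_tuple f X))"
      unfolding M_iota x nc_eval_unit by (intro ext) (simp add: on_ball_def)
  qed
qed

lemma universal_model_fock:
  assumes "universal_model f M"
  obtains e S a where "fock_model M e S a"
  using assms model_poly_fock model_series_fock model_free_hol_fock
  unfolding universal_model_def by blast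

theorem theorem9p1:
  fixes f :: "'n::finite \<Rightarrow> 'n ncseries"
    and M :: "'n \<Rightarrow> 'h::chilbert_space \<Rightarrow> 'h"
    and t1 :: "'h \<Rightarrow> 'k1::chilbert_space \<Rightarrow> 't1::chilbert_space"
    and t2 :: "'h \<Rightarrow> 'k2::chilbert_space \<Rightarrow> 't2::chilbert_space"
    and E1 :: "'t1 set" and E2 :: "'t2 set"
    and X :: "'t1 \<Rightarrow> 't2"
  assumes "universal_model f M"
    and "hilbert_tensor t1" and "hilbert_tensor t2"
    and "csubspace E1" and "closed E1" and "\<And>i. coinvariant (tensor_id t1 (M i)) E1"
    and "csubspace E2" and "closed E2" and "\<And>i. coinvariant (tensor_id t2 (M i)) E2"
    and "bounded_op_on E1 E2 X"
    and "\<And>i x. x \<in> E1 \<Longrightarrow>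
           X (proj E1 (tensor_id t1 (M i) x)) = proj E2 (tensor_id t2 (M i) (X x))"
  shows "\<exists>Y :: 't1 \<Rightarrow> 't2.
           bounded_clinear Y \<and>
           (\<forall>i. Y \<circ> tensor_id t1 (M i) = tensor_id t2 (M i) \<circ> Y) \<and>
           cadj Y ` E2 \<subseteq> E1 \<and>
           (\<forall>y\<in>E2. cadj Y y = adj_on E1 X y) \<and>
           onorm Y = onorm_on E1 X"
proof -
  obtain e S a where fock: "fock_model M e S a" using universal_model_fock[OF assms(1)] .
  interpret fock_tensor_pair M e S a t1 t2
    by (intro fock_tensor_pair.intro fock_tensor.intro tensor.intro fock assms(2,3))
  show ?thesis by (rule lifting[OF assms(4-)])
qed

end
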